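(* Let $p,q>1$ with $1/p+1/q=1$ and $T>0$. Let $(U,d)$ be a complete metric space endowed with a Hausdorff topology $\sigma$ compatible with $d$, in the sense that $u_n\stackrel{\sigma}{\to}u$ and $v_n\stackrel{\sigma}{\to}v$ imply $d(u,v)\le\liminf_{n\to\infty}d(u_n,v_n)$. Let $\phi:U\to(-\infty,\infty]$ be proper, with sequentially $\sigma$-compact sublevels, and such that the local slope $|\partial\phi|$ is a strong upper gradient for $\phi$ and is sequentially $\sigma$-lower semicontinuous on $d$-bounded sublevels of $\phi$. Let $u^0\in D(\phi)$. Assume that there exist $\tau_*>0$ and $\lambda\in\mathbb{R}$ such that for all $\tau\in(0,\tau_* )$ and all $v\in D(\phi)$ the functional $u\mapsto E(\tau,v,u)$ is $(\kappa,p)$-generalized-geodesically convex with $\kappa=(p-1)\tau^{1-p}+\lambda$, and assume that either $\lambda\ge0$ or $p>2$. Let $\{0=t_0^n<t_1^n<\dots<t^n_{N^n}=T\}$, $n\in\mathbb{N}$, be a sequence of partitions with steps $\tau_i^n=t_i^n-t_{i-1}^n$, $\tau^n:=\max_i\tau_i^n<\tau_*$, and $\tau^n\to0$ as $n\to\infty$. Then all solutions $\{u_i^n\}_{i=0}^{N^n}$ of the scheme $$u_0^n=u^0,\qquad u_i^n\in M_G(\tau_i^n,u_{i-1}^n)\quad\text{for }i=1,\dots,N^n,$$ fulfill $$\sum_{i=1}^{N^n}\big(G(\tau_i^n,u_{i-1}^n,u_i^n)\big)^+\to0\quad\text{as }n\to\infty .$$ Hence, up to subsequences, the backward piecewise constant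 interpolants $\overline u^n$ of $\{u_i^n\}$ converge pointwise on $[0,T]$ (with respect to $\sigma$) to a curve of maximal slope.
   Context: Notation: $r^+=\max\{r,0\}$. $D(\phi)=\{u\in U:\phi(u)<\infty\}$; $\phi$ is proper if $D(\phi)\neq\emptyset$. $AC^p([0,T];U)$ is the set of curves $u:[0,T]\to U$ for which there is $m\in L^p(0,T)$ with $d(u(s),u(t))\le\int_s^t m(r)\,dr$ for all $0\le s\le t\le T$. For such $u$ the metric derivative $|u'|(t)=\lim_{s\to t}d(u(s),u(t))/|t-s|$ exists for a.e. $t\in(0,T)$ and belongs to $L^p(0,T)$. Local slope: for $u\in D(\phi)$, $|\partial\phi|(u):=\limsup_{v\to u}\frac{(\phi(u)-\phi(v))^+}{d(u,v)}$ (convergence $v\to u$ in $d$), and $D(|\partial\phi|)=\{u\in D(\phi):|\partial\phi|(u)<\infty\}$. $|\partial\phi|$ is a strong upper gradient for $\phi$ if for all $u\in AC^p([0,T];U)$ the map $r\mapsto|\partial\phi|(u(r))$ is Borel and $|\phi(u(t))-\phi(u(s))|\le\int_s^t|\partial\phi|(u(r))\,|u'|(r)\,dr$ for all $0\le s\le t\le T$. Incremental functionals: for $\tau>0$, $v\in D(\phi)$, $$G(\tau,v,u)=\phi(u)+\frac{\tau^{1-p}}{p}d^p(v,u)+\frac{\tau}{q}|\partial\phi|^q(u)-\phi(v)\quad(u\in D(|\partial\phi|)),$$ $$E(\tau,v,u)=\phi(u)+\frac{\tau^{1-p}}{p}d^p(v,u)-\phi(v)\quad(u\in D(\phi)),$$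 and $M_G(\tau,v)=\operatorname{arg\,min}_{u\in D(|\partial\phi|)}G(\tau,v,u)$. Generalized geodesic convexity: a functional $\psi$ on $U$ is $(\kappa,p)$-generalized-geodesically convex, $\kappa\in\mathbb{R}$, if for all $v_0,v_1\in D(\psi)$ there exists a (continuous) curve $\gamma:[0,1]\to U$, not necessarily a geodesic, with $\gamma(0)=v_0$, $\gamma(1)=v_1$ and $$\psi(\gamma(\theta))\le\theta\psi(v_1)+(1-\theta)\psi(v_0)-\frac{\kappa}{p}\theta(1-\theta)d^p(v_0,v_1)\quad\forall\theta\in[0,1].$$ In this case $U$ is implicitly assumed to be path-connected. Here $E(\tau,v,\cdot)$ has effective domain $D(\phi)$. Backward piecewise constant interpolant: $\overline u^n(0)=u_0^n$ and $\overline u^n(t)=u_i^n$ for $t\in(t_{i-1}^n,t_i^n]$, $i=1,\dots,N^n$. Curve of maximal slope: $u\in AC^p([0,T];U)$ such that $\phi\circ u\in W^{1,1}(0,T)$ and $$\phi(u(t))+\frac1p\int_0^t|u'|^p(r)\,dr+\frac1q\int_0^t|\partial\phi|^q(u(r))\,dr=\phi(u(0))\quad\forall t\in[0,T].$$ *)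

theory Defs
  imports "HOL-Analysis.Analysis"
begin

definition seq_compactin :: "'a topology \<Rightarrow> 'a set \<Rightarrow> bool" where
  "seq_compactin X S \<longleftrightarrow> S \<subseteq> topspace X \<and>
     (\<forall>w. (\<forall>n. w n \<in> S) \<longrightarrow>
        (\<exists>l\<in>S. \<exists>r::nat \<Rightarrow> nat. strict_mono r \<and> limitin X (w \<circ> r) l sequentially))"

definition seq_lsc_on :: "'a topology \<Rightarrow> 'a set \<Rightarrow> ('a \<Rightarrow> ereal) \<Rightarrow> bool" where
  "seq_lsc_on X S f \<longleftrightarrow>
     (\<forall>w l. (\<forall>n. w n \<in> S) \<and> l \<in> S \<and> limitin X w l sequentially
        \<longrightarrow> f l \<le> liminf (\<lambda>n. f (w n)))"

definition compatible_topology :: "'a::metric_space topology \<Rightarrow> bool" where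
  "compatible_topology X \<longleftrightarrow>
     (\<forall>u v l m. limitin X u l sequentially \<and> limitin X v m sequentially
        \<longrightarrow> ereal (dist l m) \<le> liminf (\<lambda>n. ereal (dist (u n) (v n))))"

definition Lp_on :: "real \<Rightarrow> real set \<Rightarrow> (real \<Rightarrow> real) \<Rightarrow> bool" where
  "Lp_on p A m \<longleftrightarrow> set_borel_measurable lborel A m \<and>
     set_integrable lborel A (\<lambda>r. \<bar>m r\<bar> powr p)"

text \<open>A curve on \<open>[0,T]\<close> is a total function on the reals of which only the restriction
  to \<open>[0,T]\<close> is relevant.\<close>

definition ACp :: "real \<Rightarrow> real \<Rightarrow> (real \<Rightarrow> 'a::metric_space) set" where
  "ACp p T = {u. \<exists>m. Lp_on p {0<..<T} m \<and>
     (\<forall>s t. 0 \<le> s \<and> s \<le> t \<and> t \<le> T \<longrightarrow> dist (u s) (u t) \<le> (LBINT r:{s..t}. m r))}"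

text \<open>The value is meaningful only where the limit exists, which for curves in \<open>ACp p T\<close>
  is the case for almost every point of \<open>(0,T)\<close>; it is only used under integrals.\<close>

definition metric_derivative :: "(real \<Rightarrow> 'a::metric_space) \<Rightarrow> real \<Rightarrow> real" where
  "metric_derivative u t = Lim (at t) (\<lambda>s. dist (u s) (u t) / \<bar>t - s\<bar>)"

definition test_function :: "real \<Rightarrow> (real \<Rightarrow> real) \<Rightarrow> bool" where
  "test_function T \<psi> \<longleftrightarrow> (\<forall>k x. (deriv ^^ k) \<psi> differentiable (at x)) \<and>
     (\<exists>a b. 0 < a \<and> a \<le> b \<and> b < T \<and> (\<forall>x. x \<notin> {a..b} \<longrightarrow> \<psi> x = 0))"

definition W11 :: "real \<Rightarrow> (real \<Rightarrow> real) \<Rightarrow> bool" where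
  "W11 T f \<longleftrightarrow> set_integrable lborel {0<..<T} f \<and>
     (\<exists>g. set_integrable lborel {0<..<T} g \<and>
        (\<forall>\<psi>. test_function T \<psi> \<longrightarrow>
           (LBINT x:{0<..<T}. f x * deriv \<psi> x) = - (LBINT x:{0<..<T}. g x * \<psi> x)))"

definition edom :: "('a \<Rightarrow> ereal) \<Rightarrow> 'a set" where
  "edom \<phi> = {u. \<phi> u < \<infinity>}"

text \<open>The limit superior is over \<open>v \<noteq> u\<close>; the outer maximum matters only at isolated
  points, where the limit superior over the trivial filter is \<open>-\<infinity>\<close> and the slope is \<open>0\<close>
  by convention. Outside the domain of \<open>\<phi>\<close> the slope is \<open>\<infinity>\<close>.\<close>

definition local_slope :: "('a::metric_space \<Rightarrow> ereal) \<Rightarrow> 'a \<Rightarrow> ereal" where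
  "local_slope \<phi> u = (if u \<in> edom \<phi>
     then max 0 (Limsup (at u) (\<lambda>v. max 0 (\<phi> u - \<phi> v) / ereal (dist u v)))
     else \<infinity>)"

definition slope_dom :: "('a::metric_space \<Rightarrow> ereal) \<Rightarrow> 'a set" where
  "slope_dom \<phi> = {u \<in> edom \<phi>. local_slope \<phi> u < \<infinity>}"

text \<open>In \<open>ereal\<close>, \<open>\<infinity> - \<infinity> = \<infinity>\<close>, so without the guard even constant curves outside the
  domain of \<open>\<phi>\<close> would violate the inequality; the guard amounts to reading \<open>\<infinity> - \<infinity>\<close> as \<open>0\<close>
  here. The integral may be infinite.\<close>

definition strong_upper_gradient ::
    "real \<Rightarrow> real \<Rightarrow> ('a::metric_space \<Rightarrow> ereal) \<Rightarrow> ('a \<Rightarrow> ereal) \<Rightarrow> bool" where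
  "strong_upper_gradient p T \<phi> g \<longleftrightarrow> (\<forall>u\<in>ACp p T.
     (\<lambda>r. g (u r)) \<in> borel_measurable (restrict_space borel {0..T}) \<and>
     (\<forall>s t. 0 \<le> s \<and> s \<le> t \<and> t \<le> T \<and> \<not> (\<phi> (u s) = \<infinity> \<and> \<phi> (u t) = \<infinity>) \<longrightarrow>
        \<bar>\<phi> (u t) - \<phi> (u s)\<bar> \<le>
          enn2ereal (\<integral>\<^sup>+r\<in>{s..t}. e2ennreal (g (u r)) * ennreal (metric_derivative u r) \<partial>lborel)))"

text \<open>Used for nonnegative arguments only.\<close>

definition ereal_powr :: "ereal \<Rightarrow> real \<Rightarrow> ereal" where
  "ereal_powr x a = (if x = \<infinity> then \<infinity> else ereal (real_of_ereal x powr a))"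

definition incr_E ::
    "real \<Rightarrow> ('a::metric_space \<Rightarrow> ereal) \<Rightarrow> real \<Rightarrow> 'a \<Rightarrow> 'a \<Rightarrow> ereal" where
  "incr_E p \<phi> \<tau> v u = \<phi> u + ereal (\<tau> powr (1 - p) / p * dist v u powr p) - \<phi> v"

definition incr_G ::
    "real \<Rightarrow> real \<Rightarrow> ('a::metric_space \<Rightarrow> ereal) \<Rightarrow> real \<Rightarrow> 'a \<Rightarrow> 'a \<Rightarrow> ereal" where
  "incr_G p q \<phi> \<tau> v u = \<phi> u + ereal (\<tau> powr (1 - p) / p * dist v u powr p)
     + ereal (\<tau> / q) * ereal_powr (local_slope \<phi> u) q - \<phi> v"

definition argmin_G ::
    "real \<Rightarrow> real \<Rightarrow> ('a::metric_space \<Rightarrow> ereal) \<Rightarrow> real \<Rightarrow> 'a \<Rightarrow> 'a set" where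
  "argmin_G p q \<phi> \<tau> v = {u. is_arg_min (incr_G p q \<phi> \<tau> v) (\<lambda>w. w \<in> slope_dom \<phi>) u}"

text \<open>Path-connectedness of the whole space is part of the notion.\<close>

definition gen_geod_convex ::
    "real \<Rightarrow> real \<Rightarrow> ('a::metric_space \<Rightarrow> ereal) \<Rightarrow> bool" where
  "gen_geod_convex \<kappa> p \<psi> \<longleftrightarrow> path_connected (UNIV :: 'a set) \<and>
     (\<forall>v0\<in>edom \<psi>. \<forall>v1\<in>edom \<psi>. \<exists>\<gamma>.
        path \<gamma> \<and> pathstart \<gamma> = v0 \<and> pathfinish \<gamma> = v1 \<and>
        (\<forall>\<theta>\<in>{0..1}. \<psi> (\<gamma> \<theta>) \<le> ereal \<theta> * \<psi> v1 + ereal (1 - \<theta>) * \<psi> v0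
            - ereal (\<kappa> / p * \<theta> * (1 - \<theta>) * dist v0 v1 powr p)))"

definition curve_of_maximal_slope ::
    "real \<Rightarrow> real \<Rightarrow> real \<Rightarrow> ('a::metric_space \<Rightarrow> ereal) \<Rightarrow> (real \<Rightarrow> 'a) \<Rightarrow> bool" where
  "curve_of_maximal_slope p q T \<phi> u \<longleftrightarrow> u \<in> ACp p T \<and>
     (\<forall>t\<in>{0..T}. u t \<in> edom \<phi>) \<and> W11 T (\<lambda>t. real_of_ereal (\<phi> (u t))) \<and>
     (\<forall>t\<in>{0..T}. \<phi> (u t)
        + ereal (1 / p) * enn2ereal (\<integral>\<^sup>+r\<in>{0..t}. ennreal (metric_derivative u r powr p) \<partial>lborel)
        + ereal (1 / q) * enn2ereal (\<integral>\<^sup>+r\<in>{0..t}. e2ennreal (ereal_powr (local_slope \<phi> (u r)) q) \<partial>lborel)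
        = \<phi> (u 0))"

definition is_partition :: "real \<Rightarrow> nat \<Rightarrow> (nat \<Rightarrow> real) \<Rightarrow> bool" where
  "is_partition T N t \<longleftrightarrow> t 0 = 0 \<and> t N = T \<and> (\<forall>i\<in>{1..N}. t (i - 1) < t i)"

definition step :: "(nat \<Rightarrow> real) \<Rightarrow> nat \<Rightarrow> real" where
  "step t i = t i - t (i - 1)"

definition mesh :: "nat \<Rightarrow> (nat \<Rightarrow> real) \<Rightarrow> real" where
  "mesh N t = Max (step t ` {1..N})"

definition scheme_solution ::
    "real \<Rightarrow> real \<Rightarrow> ('a::metric_space \<Rightarrow> ereal) \<Rightarrow> 'a \<Rightarrow> nat \<Rightarrow> (nat \<Rightarrow> real) \<Rightarrow> (nat \<Rightarrow> 'a) \<Rightarrow> bool"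
where
  "scheme_solution p q \<phi> u0 N t u \<longleftrightarrow> u 0 = u0 \<and>
     (\<forall>i\<in>{1..N}. u i \<in> argmin_G p q \<phi> (step t i) (u (i - 1)))"

definition backward_interpolant ::
    "nat \<Rightarrow> (nat \<Rightarrow> real) \<Rightarrow> (nat \<Rightarrow> 'a) \<Rightarrow> real \<Rightarrow> 'a" where
  "backward_interpolant N t u s =
     (if s = 0 then u 0 else u (THE i. i \<in> {1..N} \<and> s \<in> {t (i - 1)<..t i}))"

end

theory Submission
  imports Defs "HOL-Library.Diagonal_Subsequence"
begin

text \<open>
  Two things have to be shown: the positive parts of the incremental functional \<open>G\<close> sum up to
  something negligible, and this makes the interpolants converge to a curve of maximal slope.

  For the first, a minimizer \<open>w\<close> of \<open>G(\<tau>, v, \<cdot>)\<close> is compared with a minimizer \<open>u\<close> of \<open>E(\<tau>, v, \<cdot>)\<close>, which exists by the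
  direct method. Generalized convexity of \<open>E\<close> improves \<open>E(u) \<le> 0\<close> to \<open>E(u) \<le> - (\<kappa> / p) d\<^sup>p(v, u)\<close>,
  minimality bounds the slope at \<open>u\<close> by \<open>(d(v, u) / \<tau>)\<^sup>p\<^sup>-\<^sup>1\<close>, and the two main terms cancel, leaving
  \<open>G(w) \<le> - (lam / p) d\<^sup>p(v, u)\<close> (lemma \<open>incr_G_argmin_le\<close>). So \<open>G(w) \<le> 0\<close> if \<open>lam \<ge> 0\<close>. Otherwise \<open>d\<^sup>p(v, u)\<close> is
  of order \<open>\<tau>\<^sup>p\<^sup>-\<^sup>1\<close>, and for \<open>p > 2\<close> the sum of these terms vanishes with the mesh (\<open>scheme_estimates\<close>).

  For the second, summing the definition of \<open>G\<close> gives the energy inequality for the discrete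
  solution up to the vanishing sum. Hence the discrete speeds are bounded in \<open>L\<^sup>p\<close>, the
  interpolants are equicontinuous up to the mesh, and a subsequence converges pointwise
  (\<open>curves_pointwise_compactness\<close>). All three terms of the energy inequality are lower
  semicontinuous, so the limit curve satisfies it too. The strong upper
  gradient property gives the reverse inequality (\<open>curve_of_maximal_slope_if_energy_inequality\<close>).

  The last two steps need one-dimensional real analysis. Instead of a weak limit of the speeds in
  \<open>L\<^sup>p\<close>, the pointwise limit of their cumulative integrals is used: it is absolutely continuous, has a density
  (\<open>density_of_absolutely_continuous\<close>), and Lebesgue's differentiation theorem
  (\<open>AE_has_derivative_indefinite_integral\<close>) recovers the density as its derivative, which yields the lower
  semicontinuity of the action (\<open>nn_integral_derivative_powr_le_liminf\<close>). The same theorem, applied to the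
  distances from the points of the curve, shows that the metric derivative exists almost
  everywhere (\<open>AE_metric_derivative_exists\<close>).
\<close>

section \<open>Differentiation of indefinite integrals\<close>

text \<open>This is Lebesgue's differentiation theorem on the line. Call an interval with end point \<open>x\<close> bad if
  the difference quotient of \<open>F\<close> over it misses \<open>h x\<close> by more than \<open>a\<close>. Points where differentiability
  fails are covered by arbitrarily short bad intervals, so Vitali's theorem selects disjoint bad
  intervals covering almost all of them; tagged with their end points \<open>x\<close> these form a partial
  division on which the Riemann sum and the integral differ by at least \<open>a\<close> times the total length,
  whereas Henstock's lemma makes that difference as small as desired.\<close>

lemma AE_has_derivative_indefinite_integral:
  fixes h F :: "real \<Rightarrow> real"
  assumes hint: "\<And>x y. set_integrable lborel {x..y} h"
    and F: "\<And>x y. x \<le> y \<Longrightarrow> F y - F x = (LBINT r:{x..y}. h r)"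
  shows "AE x in lborel. (F has_real_derivative h x) (at x)"
proof -
  define E where "E a = {x. \<forall>\<delta>>0. \<exists>y. y \<noteq> x \<and> \<bar>y - x\<bar> < \<delta> \<and>
     \<bar>F y - F x - h x * (y - x)\<bar> > a * \<bar>y - x\<bar>}" for a
  have intF: "integral {x..y} h = F y - F x" if "x \<le> y" for x y
    using set_borel_integral_eq_integral(2)[OF hint[of x y]] F[OF that] by simp
  have hkint: "h integrable_on cbox x y" for x y
    unfolding cbox_interval by (rule set_borel_integral_eq_integral(1)[OF hint[of x y]])
  have neg: "negligible (E a \<inter> {-k<..<k})" if "a > 0" for a k
    unfolding negligible_outer_le
  proof (intro allI impI)
    fix e :: real assume "e > 0"
    then have ae: "a * e > 0" using that by simp
    \<comment> \<open>The error is taken to be \<open>a * e\<close>, so that bad intervals have total length below \<open>e\<close>.\<close>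
    obtain \<gamma> where \<gamma>: "gauge \<gamma>"
      and small: "\<And>p. \<lbrakk>p tagged_partial_division_of (cbox (-k) k); \<gamma> fine p\<rbrakk> \<Longrightarrow>
             (\<Sum>(x,K)\<in>p. norm (measure lborel K *\<^sub>R h x - integral K h)) < a * e"
      using Henstock_lemma[OF hkint[of "-k" k] ae] by blast
    \<comment> \<open>A pair \<open>(x, y)\<close> stands for the interval between \<open>x\<close> and \<open>y\<close> tagged at \<open>x\<close>; on the line it is a ball, as the covering theorem demands.\<close>
    define ctr where "ctr = (\<lambda>(x::real,y). (x + y) / 2)"
    define rad where "rad = (\<lambda>(x::real,y). \<bar>y - x\<bar> / 2)"
    define I where "I = (\<lambda>(x::real,y). {min x y..max x y})"
    have I_cball: "cball (ctr i) (rad i) = I i" for i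
      by (auto simp: ctr_def rad_def I_def case_prod_beta cball_eq_atLeastAtMost abs_if min_def max_def field_simps)
    define K where "K = {(x,y). y \<noteq> x \<and> I (x,y) \<subseteq> \<gamma> x \<inter> {-k<..<k} \<and>
       \<bar>F y - F x - h x * (y - x)\<bar> > a * \<bar>y - x\<bar>}"
    have rpos: "0 < rad i" if "i \<in> K" for i
      using that by (auto simp: K_def rad_def)
    have ex: "\<exists>i. i \<in> K \<and> x \<in> cball (ctr i) (rad i) \<and> rad i < d"
      if x: "x \<in> E a \<inter> {-k<..<k}" and "0 < d" for x d
    proof -
      have "open (\<gamma> x \<inter> {-k<..<k})" "x \<in> \<gamma> x \<inter> {-k<..<k}"
        using \<gamma> x by (auto simp: gauge_def)
      then obtain r where r: "r > 0" "ball x r \<subseteq> \<gamma> x \<inter> {-k<..<k}"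
        by (meson open_contains_ball)
      from \<open>0 < d\<close> r(1) have "0 < min d r" by simp
      with x obtain y where y: "y \<noteq> x" "\<bar>y - x\<bar> < min d r"
        "\<bar>F y - F x - h x * (y - x)\<bar> > a * \<bar>y - x\<bar>"
        unfolding E_def Int_iff mem_Collect_eq by (meson min_less_iff_conj)
      have "I (x,y) \<subseteq> ball x r"
        using y by (auto simp: I_def dist_real_def)
      then have "(x,y) \<in> K" using y r by (auto simp: K_def)
      moreover have "x \<in> cball (ctr (x,y)) (rad (x,y))"
        unfolding I_cball by (simp add: I_def)
      moreover have "rad (x,y) < d" using y \<open>0 < d\<close> by (simp add: rad_def)
      ultimately show ?thesis by blast
    qed
    obtain C where C: "countable C" "C \<subseteq> K"
     "pairwise (\<lambda>i j. disjnt (cball (ctr i) (rad i)) (cball (ctr j) (rad j))) C"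
     "negligible ((E a \<inter> {-k<..<k}) - (\<Union>i \<in> C. cball (ctr i) (rad i)))"
      using Vitali_covering_theorem_cballs[of K rad "E a \<inter> {-k<..<k}" ctr] rpos ex by blast
    have fin: "measure lebesgue (\<Union>i\<in>D. I i) \<le> e" if D: "D \<subseteq> C" "finite D" for D
    proof -
      have disj: "I i \<inter> I j = {}" if "i \<in> D" "j \<in> D" "i \<noteq> j" for i j
        using C(3) that D unfolding pairwise_def disjnt_def I_cball by blast
      have ne: "I i \<noteq> {}" for i by (auto simp: I_def split: prod.splits)
      define p where "p = (\<lambda>i. (fst i, I i)) ` D"
      have inj: "inj_on (\<lambda>i. (fst i, I i)) D"
        using disj ne by (auto simp: inj_on_def) (metis Int_absorb)
      have "p tagged_partial_division_of (cbox (-k) k)"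
        unfolding tagged_partial_division_of_def
      proof (intro conjI allI impI)
        show "finite p" using D by (simp add: p_def)
        fix x L assume "(x, L) \<in> p"
        then obtain i where i: "i \<in> D" "x = fst i" "L = I i" by (auto simp: p_def)
        show "x \<in> L" using i by (auto simp: I_def split: prod.splits)
        show "L \<subseteq> cbox (-k) k" using i D C(2) by (force simp: K_def)
        show "\<exists>c d. L = cbox c d" using i by (auto simp: I_def split: prod.splits)
      next
        fix x1 K1 x2 K2
        assume "(x1, K1) \<in> p \<and> (x2, K2) \<in> p \<and> (x1, K1) \<noteq> (x2, K2)"
        then obtain i j where "i \<in> D" "j \<in> D" "i \<noteq> j" "K1 = I i" "K2 = I j"
          by (auto simp: p_def)
        then have "K1 \<inter> K2 = {}" using disj by blast
        then show "interior K1 \<inter> interior K2 = {}"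
          using interior_subset by blast
      qed
      moreover have "\<gamma> fine p"
        using D C(2) by (force simp: fine_def p_def K_def)
      ultimately have "(\<Sum>(x,K)\<in>p. norm (measure lborel K *\<^sub>R h x - integral K h)) < a * e"
        by (rule small)
      also have "(\<Sum>(x,K)\<in>p. norm (measure lborel K *\<^sub>R h x - integral K h)) =
         (\<Sum>i\<in>D. norm (measure lborel (I i) *\<^sub>R h (fst i) - integral (I i) h))"
        unfolding p_def by (subst sum.reindex[OF inj]) (simp add: o_def)
      finally have 1: "(\<Sum>i\<in>D. norm (measure lborel (I i) *\<^sub>R h (fst i) - integral (I i) h)) < a * e" .
      have "a * measure lborel (I i) \<le> norm (measure lborel (I i) *\<^sub>R h (fst i) - integral (I i) h)"
        if i: "i \<in> D" for i
      proof -
        obtain x y where xy: "i = (x,y)" by fastforce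
        have g: "\<bar>F y - F x - h x * (y - x)\<bar> > a * \<bar>y - x\<bar>"
          using i D C(2) xy by (auto simp: K_def)
        show ?thesis
        proof (cases "x \<le> y")
          case True
          then show ?thesis using g intF[of x y]
            by (simp add: xy I_def min_def max_def abs_minus_commute algebra_simps)
        next
          case False
          then show ?thesis using g intF[of y x]
            by (simp add: xy I_def min_def max_def algebra_simps abs_if split: if_splits)
        qed
      qed
      then have "a * (\<Sum>i\<in>D. measure lborel (I i)) \<le> (\<Sum>i\<in>D. norm (measure lborel (I i) *\<^sub>R h (fst i) - integral (I i) h))"
        unfolding sum_distrib_left by (rule sum_mono)
      with 1 have "a * (\<Sum>i\<in>D. measure lborel (I i)) < a * e" by simp
      then have "(\<Sum>i\<in>D. measure lborel (I i)) < e" using \<open>a > 0\<close> by simp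
      moreover have "measure lebesgue (\<Union>i\<in>D. I i) \<le> (\<Sum>i\<in>D. measure lebesgue (I i))"
        by (rule measure_UNION_le) (auto simp: D I_def split: prod.splits)
      moreover have "measure lebesgue (I i) = measure lborel (I i)" for i
        by (auto simp: I_def split: prod.splits)
      ultimately show ?thesis by simp
    qed
    have mI: "I i \<in> lmeasurable" for i by (auto simp: I_def split: prod.splits)
    let ?U = "\<Union>i\<in>C. I i"
    let ?R = "(E a \<inter> {-k<..<k}) - ?U"
    have nR: "negligible ?R" using C(4) by (simp add: I_cball)
    have U: "?U \<in> lmeasurable" "measure lebesgue ?U \<le> e"
      using fmeasurable_UN_bound[OF C(1) mI fin] measure_UN_bound[OF C(1) mI fin] by auto
    show "\<exists>T. E a \<inter> {-k<..<k} \<subseteq> T \<and> T \<in> lmeasurable \<and> measure lebesgue T \<le> e"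
    proof (intro exI conjI)
      show "E a \<inter> {-k<..<k} \<subseteq> ?U \<union> ?R" by blast
      show "?U \<union> ?R \<in> lmeasurable"
        using U nR by (intro fmeasurable.Un) (auto intro: negligible_imp_measurable)
      show "measure lebesgue (?U \<union> ?R) \<le> e"
        using U nR by (subst measure_Un_null_set) (auto simp only: negligible_iff_null_sets fmeasurableD)
    qed
  qed
  define Bad where "Bad = (\<Union>(n,k). E (1 / real (Suc n)) \<inter> {-real k<..<real k})"
  have "negligible Bad"
    unfolding Bad_def by (rule negligible_countable_Union) (auto intro!: neg)
  then have "AE x in lebesgue. x \<notin> Bad"
    by (simp add: negligible_iff_null_sets AE_not_in)
  then have "AE x in lborel. x \<notin> Bad"
    by (simp add: AE_completion_iff)
  then show ?thesis
  proof (rule AE_mp, intro AE_I2 impI)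
    fix x assume nb: "x \<notin> Bad"
    obtain k :: nat where k: "\<bar>x\<bar> < real k" using reals_Archimedean2 by blast
    then have "x \<in> {- real k<..<real k}" by auto
    then have nE: "x \<notin> E (1 / real (Suc n))" for n
      using nb unfolding Bad_def by blast
    show "(F has_real_derivative h x) (at x)"
      unfolding has_field_derivative_iff LIM_def
    proof (intro allI impI)
      fix e :: real assume "e > 0"
      then obtain n where n: "1 / real (Suc n) < e" using nat_approx_posE by blast
      from nE[of n] obtain \<delta> where \<delta>: "\<delta> > 0"
        "\<And>y. y \<noteq> x \<Longrightarrow> \<bar>y - x\<bar> < \<delta> \<Longrightarrow> \<bar>F y - F x - h x * (y - x)\<bar> \<le> 1 / real (Suc n) * \<bar>y - x\<bar>"
        unfolding E_def by (force simp: not_less)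
      show "\<exists>s>0. \<forall>y. y \<noteq> x \<and> dist y x < s \<longrightarrow> dist ((F y - F x) / (y - x)) (h x) < e"
      proof (intro exI[of _ \<delta>] conjI allI impI \<delta>(1))
        fix y assume y: "y \<noteq> x \<and> dist y x < \<delta>"
        have "dist ((F y - F x) / (y - x)) (h x) = \<bar>F y - F x - h x * (y - x)\<bar> / \<bar>y - x\<bar>"
          using y by (simp add: dist_real_def diff_divide_distrib flip: abs_divide)
        also have "\<dots> \<le> 1 / real (Suc n)"
          using \<delta>(2)[of y] y by (simp add: dist_real_def pos_divide_le_eq)
        finally show "dist ((F y - F x) / (y - x)) (h x) < e" using n by simp
      qed
    qed
  qed
qed

section \<open>Densities of absolutely continuous functions\<close>

text \<open>Absolute continuity is required only for families of cells of a uniform grid, and in the form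
  \<open>\<eta> + K \<cdot> length\<close> rather than with \<open>\<epsilon>\<close> and \<open>\<delta>\<close>: in this form it passes to pointwise limits and follows
  at once from a bound on \<open>L\<^sup>p\<close> norms. Since every open set is exhausted by dyadic cells, the bound on
  cells makes the Stieltjes measure of \<open>F\<close> small on open sets of small length, hence zero on null sets,
  and the Radon-Nikodym theorem supplies the density.\<close>

lemma density_of_absolutely_continuous:
  fixes F :: "real \<Rightarrow> real"
  assumes mono: "\<And>x y. x \<le> y \<Longrightarrow> F x \<le> F y"
    and ac: "\<And>\<eta>. \<eta> > 0 \<Longrightarrow> \<exists>K\<ge>0. \<forall>\<delta>>0. \<forall>J::int set. finite J \<longrightarrow>
       (\<Sum>j\<in>J. F ((of_int j + 1) * \<delta>) - F (of_int j * \<delta>)) \<le> \<eta> + K * (real (card J) * \<delta>)"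
  obtains h where "h \<in> borel_measurable borel" "\<And>x. 0 \<le> h x"
    "\<And>x y. set_integrable lborel {x..y} h"
    "\<And>x y. x \<le> y \<Longrightarrow> F y - F x = (LBINT r:{x..y}. h r)"
proof -
  let ?inc = "\<lambda>(J :: int set) \<delta>. \<Sum>j\<in>J. F ((of_int j + 1) * \<delta>) - F (of_int j * \<delta>)"
  have cont: "continuous (at_right a) F" for a
    unfolding continuous_within tendsto_iff
  proof (intro allI impI)
    fix e :: real assume "e > 0"
    then have "e / 2 > 0" by simp
    from ac[OF this] obtain K where K: "K \<ge> 0" "\<And>\<delta> J. \<delta> > 0 \<Longrightarrow> finite (J::int set) \<Longrightarrow>
       ?inc J \<delta> \<le> e/2 + K * (real (card J) * \<delta>)"
      by blast
    \<comment> \<open>Two neighbouring cells of this length around \<open>a\<close> contain a right neighbourhood of \<open>a\<close>.\<close>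
    define \<delta> where "\<delta> = e / (8 * (K + 1))"
    have \<delta>: "\<delta> > 0" "K * (2 * \<delta>) < e / 2"
      using \<open>e > 0\<close> K(1) by (auto simp: \<delta>_def field_simps add_pos_nonneg)
    define j where "j = \<lfloor>a / \<delta>\<rfloor>"
    have j: "of_int j * \<delta> \<le> a" "a < (of_int j + 1) * \<delta>"
      using \<delta>(1) by (simp_all add: j_def floor_divide_lower floor_divide_upper)
    have "F y - F a < e" if "a \<le> y" "y < (of_int j + 2) * \<delta>" for y
    proof -
      have "F y - F a \<le> F ((of_int (j+1) + 1) * \<delta>) - F (of_int j * \<delta>)"
        using mono[of y "(of_int (j+1) + 1) * \<delta>"] mono[OF j(1)] that by (simp add: algebra_simps)
      also have "\<dots> = (\<Sum>i\<in>{j,j+1}. F ((of_int i + 1) * \<delta>) - F (of_int i * \<delta>))" by simp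
      also have "\<dots> \<le> e/2 + K * (2 * \<delta>)"
        using K(2)[OF \<delta>(1), of "{j,j+1}"] by simp
      finally show ?thesis using \<delta>(2) by simp
    qed
    moreover have "\<forall>\<^sub>F y in at_right a. a < y \<and> y < (of_int j + 2) * \<delta>"
      using j(2) \<delta>(1) by (intro eventually_conj eventually_at_right_less)
        (auto intro!: eventually_at_rightI[of a] simp: algebra_simps)
    ultimately show "\<forall>\<^sub>F y in at_right a. dist (F y) (F a) < e"
      by (auto elim!: eventually_mono simp: dist_real_def mono abs_if) (smt (verit) mono)
  qed
  define \<mu> where "\<mu> = interval_measure F"
  have sets\<mu>[simp]: "sets \<mu> = sets borel" by (simp add: \<mu>_def)
  have \<mu>Ioc: "emeasure \<mu> {x<..y} = ennreal (F y - F x)" if "x \<le> y" for x y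
    unfolding \<mu>_def by (rule emeasure_interval_measure_Ioc[OF that mono cont])
  interpret \<mu>: sigma_finite_measure \<mu>
    unfolding \<mu>_def by (rule sigma_finite_interval_measure[OF mono cont])

  define cell where "cell n j = {of_int j / 2^n <.. (of_int j + 1) / (2::real)^n}" for n :: nat and j :: int
  have cell_disj: "cell n i \<inter> cell n j = {}" if "i \<noteq> j" for n i j
  proof -
    have False if "x \<in> cell n i" "x \<in> cell n j" for x
    proof -
      have "of_int i < x * 2^n" "x * 2^n \<le> of_int i + 1" "of_int j < x * 2^n" "x * 2^n \<le> of_int j + 1"
        using that by (auto simp: cell_def field_simps)
      then have "real_of_int i < of_int (j + 1)" "real_of_int j < of_int (i + 1)" by auto
      then show False using \<open>i \<noteq> j\<close> by linarith
    qed
    then show ?thesis by blast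
  qed
  have cell_sets[measurable]: "cell n j \<in> sets borel" for n j by (simp add: cell_def)
  have open_bound: "emeasure \<mu> U \<le> ennreal (\<eta> + K * e)"
    if "open U" "emeasure lborel U \<le> ennreal e" "e \<ge> 0" "\<eta> > 0" "K \<ge> 0"
      and K: "\<And>\<delta> J. \<delta> > 0 \<Longrightarrow> finite (J::int set) \<Longrightarrow>
       ?inc J \<delta> \<le> \<eta> + K * (real (card J) * \<delta>)"
    for U e \<eta> K
  proof -
    \<comment> \<open>The cut-off \<open>4^n\<close> keeps the family finite while its cells of length \<open>1 / 2^n\<close> still reach out to \<open>2^n\<close>.\<close>
    define J where "J n = {j. \<bar>j\<bar> \<le> 4^n \<and> cell n j \<subseteq> U}" for n
    have finJ: "finite (J n)" for n
      by (rule finite_subset[of _ "{-(4^n)..4^n}"]) (auto simp: J_def abs_le_iff)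
    define V where "V n = (\<Union>j\<in>J n. cell n j)" for n
    have V_sub: "V n \<subseteq> U" for n by (auto simp: V_def J_def)
    have V_sets[measurable]: "V n \<in> sets borel" for n using finJ by (auto simp: V_def)
    have U_sets[measurable]: "U \<in> sets borel" using \<open>open U\<close> by simp
    have disjf: "disjoint_family_on (cell n) (J n)" for n
      using cell_disj by (auto simp: disjoint_family_on_def)
    have card: "real (card (J n)) * (1/2^n) \<le> e" for n
    proof -
      have "ennreal (real (card (J n)) * (1/2^n)) = (\<Sum>j\<in>J n. ennreal (1/2^n))"
        by (simp only: sum_constant ennreal_of_nat_eq_real_of_nat) (rule ennreal_mult, auto)
      also have "\<dots> = (\<Sum>j\<in>J n. emeasure lborel (cell n j))"
        by (intro sum.cong refl) (simp add: cell_def divide_right_mono flip: diff_divide_distrib)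
      also have "\<dots> = emeasure lborel (V n)"
        unfolding V_def by (rule sum_emeasure) (auto simp: finJ disjf)
      also have "\<dots> \<le> emeasure lborel U" by (rule emeasure_mono[OF V_sub]) simp
      also have "\<dots> \<le> ennreal e" by fact
      finally show ?thesis using \<open>e \<ge> 0\<close> by simp
    qed
    have bd: "emeasure \<mu> (V n) \<le> ennreal (\<eta> + K * e)" for n
    proof -
      have "emeasure \<mu> (V n) = (\<Sum>j\<in>J n. emeasure \<mu> (cell n j))"
        unfolding V_def by (rule sum_emeasure[symmetric]) (auto simp: finJ disjf)
      also have "\<dots> = (\<Sum>j\<in>J n. ennreal (F ((of_int j + 1) * (1/2^n)) - F (of_int j * (1/2^n))))"
        by (intro sum.cong refl) (simp add: cell_def \<mu>Ioc divide_right_mono)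
      also have "\<dots> = ennreal (?inc (J n) (1/2^n))"
        by (rule sum_ennreal) (auto intro!: mono divide_right_mono)
      also have "\<dots> \<le> ennreal (\<eta> + K * (real (card (J n)) * (1/2^n)))"
        by (rule ennreal_leI) (rule K[OF _ finJ], simp)
      also have "\<dots> \<le> ennreal (\<eta> + K * e)"
        using mult_left_mono[OF card \<open>K \<ge> 0\<close>] by (intro ennreal_leI) simp
      finally show ?thesis .
    qed
    have ev: "\<forall>\<^sub>F n in sequentially. x \<in> V n" if x: "x \<in> U" for x
    proof -
      obtain r where r: "r > 0" "ball x r \<subseteq> U" using \<open>open U\<close> x by (meson open_contains_ball)
      obtain n0 where n0: "(1/2)^n0 < r" using r(1) real_arch_pow_inv[of r "1/2"] by auto
      obtain n1 where n1: "\<bar>x\<bar> + 1 < 2^n1" using real_arch_pow[of 2 "\<bar>x\<bar> + 1"] by auto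
      show ?thesis
        unfolding eventually_sequentially
      proof (intro exI allI impI)
        fix n assume n: "max n0 n1 \<le> n"
        have "(1/2::real)^n \<le> (1/2)^n0" by (rule power_decreasing) (use n in auto)
        with n0 have a: "(1/2::real)^n < r" by linarith
        have "(2::real)^n1 \<le> 2^n" by (rule power_increasing) (use n in auto)
        with n1 have b: "\<bar>x\<bar> + 1 < 2^n" by linarith
        define j where "j = \<lceil>x * 2^n\<rceil> - 1"
        have j: "of_int j < x * 2^n" "x * 2^n \<le> of_int j + 1" by (auto simp: j_def) linarith
        have xc: "x \<in> cell n j" using j by (auto simp: cell_def field_simps)
        have "cell n j \<subseteq> ball x r"
        proof
          fix y assume "y \<in> cell n j"
          then have "\<bar>y - x\<bar> < 1 / 2^n"
            using xc by (auto simp: cell_def add_divide_distrib abs_if)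
          then show "y \<in> ball x r" using a by (simp add: dist_real_def power_one_over abs_minus_commute)
        qed
        moreover have "\<bar>j\<bar> \<le> 4^n"
        proof -
          have "\<bar>real_of_int j\<bar> \<le> \<bar>x\<bar> * 2^n + 1"
            using j abs_mult[of x "2^n"] by (simp add: abs_if split: if_splits)
          also have "\<dots> \<le> (\<bar>x\<bar> + 1) * 2^n" by (simp add: algebra_simps)
          also have "\<dots> \<le> 2^n * 2^n" using b by (intro mult_right_mono) auto
          also have "\<dots> = 4^n" by (simp flip: power_mult_distrib)
          finally have "real_of_int \<bar>j\<bar> \<le> of_int (4^n)" by simp
          then show ?thesis by (simp only: of_int_le_iff)
        qed
        ultimately show "x \<in> V n" using xc r(2) by (auto simp: V_def J_def)
      qed
    qed
    have "emeasure \<mu> U = (\<integral>\<^sup>+x. indicator U x \<partial>\<mu>)" by simp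
    also have "\<dots> \<le> (\<integral>\<^sup>+x. liminf (\<lambda>n. indicator (V n) x) \<partial>\<mu>)"
    proof (rule nn_integral_mono)
      fix x
      show "indicator U x \<le> liminf (\<lambda>n. indicator (V n) x :: ennreal)"
      proof (cases "x \<in> U")
        case True
        then have "\<forall>\<^sub>F n in sequentially. (1::ennreal) \<le> indicator (V n) x"
          using ev[OF True] by (auto elim: eventually_mono)
        then show ?thesis using True by (auto intro: Liminf_bounded)
      qed simp
    qed
    also have "\<dots> \<le> liminf (\<lambda>n. \<integral>\<^sup>+x. indicator (V n) x \<partial>\<mu>)"
      by (rule nn_integral_liminf) (simp add: measurable_cong_sets[OF sets\<mu> refl])
    also have "\<dots> = liminf (\<lambda>n. emeasure \<mu> (V n))" by simp
    also have "\<dots> \<le> ennreal (\<eta> + K * e)"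
      using bd by (intro Liminf_le) (auto intro: always_eventually)
    finally show ?thesis .
  qed

  have "absolutely_continuous lborel \<mu>"
    unfolding absolutely_continuous_def
  proof
    fix A :: "real set" assume A: "A \<in> null_sets lborel"
    have bd: "emeasure \<mu> A \<le> ennreal e" if "e > 0" for e
    proof -
      have "e / 2 > 0" using that by simp
      from ac[OF this] obtain K where K: "K \<ge> 0" "\<And>\<delta> J. \<delta> > 0 \<Longrightarrow> finite (J::int set) \<Longrightarrow>
         ?inc J \<delta> \<le> e/2 + K * (real (card J) * \<delta>)"
        by blast
      define d where "d = e / (2 * (K + 1))"
      have d: "d > 0" "K * d \<le> e/2" using that K(1) by (auto simp: d_def field_simps add_pos_nonneg)
      obtain U where U: "open U" "A \<subseteq> U" "emeasure lborel (U - A) < d"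
        using outer_regular_lborel[of A d] A d(1) by (auto simp: null_sets_def)
      have "emeasure lborel U \<le> emeasure lborel (A \<union> (U - A))"
        using A U(1) by (intro emeasure_mono) (auto simp: null_sets_def)
      also have "\<dots> \<le> emeasure lborel A + emeasure lborel (U - A)"
        using A U(1) by (intro emeasure_subadditive) (auto simp: null_sets_def)
      also have "\<dots> \<le> ennreal d" using U(3) A by (simp add: null_sets_def)
      finally have "emeasure \<mu> U \<le> ennreal (e/2 + K * d)"
        using that d(1) K by (intro open_bound[OF U(1)]) auto
      then have "emeasure \<mu> U \<le> ennreal e" 
        by (rule order_trans) (use d in \<open>auto intro!: ennreal_leI\<close>)
      moreover have "emeasure \<mu> A \<le> emeasure \<mu> U" using U by (intro emeasure_mono) auto
      ultimately show ?thesis by simp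
    qed
    have "emeasure \<mu> A \<le> 0"
    proof (rule ennreal_le_epsilon)
      fix e :: real assume "0 < e"
      then show "emeasure \<mu> A \<le> 0 + ennreal e" using bd[of e] by simp
    qed
    then show "A \<in> null_sets \<mu>" using A by (auto simp: null_sets_def)
  qed
  then obtain f where f: "f \<in> borel_measurable lborel" "density lborel f = \<mu>"
    using sigma_finite_measure.Radon_Nikodym[OF sigma_finite_lborel, of \<mu>] by auto
  define h where "h x = enn2real (f x)" for x
  have fb[measurable]: "f \<in> borel_measurable borel" using f by simp
  have hm[measurable]: "h \<in> borel_measurable borel" unfolding h_def by measurable
  have fI: "(\<integral>\<^sup>+r. f r * indicator {x<..y} r \<partial>lborel) = ennreal (F y - F x)" if "x \<le> y" for x y
    using \<mu>Ioc[OF that] f by (simp add: emeasure_density[symmetric])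
  have ffin: "AE r in lborel. f r \<noteq> \<infinity>"
  proof -
    have "AE r in lborel. f r * indicator {- real n<..real n} r \<noteq> \<infinity>" for n
      by (rule nn_integral_PInf_AE) (auto simp: fI)
    then have "AE r in lborel. \<forall>n. f r * indicator {- real n<..real n} r \<noteq> \<infinity>"
      by (simp add: AE_all_countable)
    then show ?thesis
    proof (rule AE_mp, intro AE_I2 impI)
      fix r assume *: "\<forall>n. f r * indicator {- real n<..real n} r \<noteq> \<infinity>"
      obtain n :: nat where "\<bar>r\<bar> < real n" using reals_Archimedean2 by blast
      then have "r \<in> {- real n<..real n}" by auto
      then show "f r \<noteq> \<infinity>" using spec[OF *, of n] by simp
    qed
  qed
  have nnI: "(\<integral>\<^sup>+r. ennreal (indicator {x..y} r *\<^sub>R h r) \<partial>lborel) = ennreal (F y - F x)" if "x \<le> y" for x y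
  proof -
    have "(\<integral>\<^sup>+r. ennreal (indicator {x..y} r *\<^sub>R h r) \<partial>lborel) = (\<integral>\<^sup>+r. f r * indicator {x<..y} r \<partial>lborel)"
    proof (rule nn_integral_cong_AE)
      show "AE r in lborel. ennreal (indicator {x..y} r *\<^sub>R h r) = f r * indicator {x<..y} r"
        using ffin AE_lborel_singleton[of x]
        by eventually_elim (auto simp: h_def indicator_def less_top)
    qed
    then show ?thesis using fI[OF that] by simp
  qed
  show ?thesis
  proof
    show "h \<in> borel_measurable borel" by measurable
    show "0 \<le> h x" for x by (simp add: h_def)
    show "set_integrable lborel {x..y} h" for x y
    proof (cases "x \<le> y")
      case True
      have "(\<integral>\<^sup>+r. ennreal (indicator {x..y} r *\<^sub>R h r) \<partial>lborel) < \<infinity>"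
        unfolding nnI[OF True] by simp
      then show ?thesis unfolding set_integrable_def
        by (intro integrableI_nonneg) (auto simp: h_def)
    qed (simp add: set_integrable_def)
    fix x y :: real assume xy: "x \<le> y"
    show "F y - F x = (LBINT r:{x..y}. h r)"
      unfolding set_lebesgue_integral_def
      using nnI[OF xy] mono[OF xy]
      by (subst integral_eq_nn_integral) (auto simp: h_def)
  qed
qed

section \<open>Cumulative integrals of functions bounded in \<open>L\<^sup>p\<close>\<close>

lemma integrable_imp_set_integrable:
  fixes M :: "real \<Rightarrow> real"
  assumes "integrable lborel M" "A \<in> sets borel"
  shows "set_integrable lborel A M"
  using assms set_integrable_subset[of lborel UNIV M A] by (simp add: set_integrable_def)

lemma cumulative_integral_diff:
  fixes M :: "real \<Rightarrow> real"
  assumes "integrable lborel M" "x \<le> y"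
  shows "(LBINT r:{..y}. M r) - (LBINT r:{..x}. M r) = (LBINT r:{x..y}. M r)"
proof -
  have si: "set_integrable lborel A M" if "A \<in> sets borel" for A
    by (rule integrable_imp_set_integrable[OF assms(1) that])
  have "{..y} = {..x} \<union> {x<..y}" using assms(2) by auto
  then have "(LBINT r:{..y}. M r) = (LBINT r:{..x}. M r) + (LBINT r:{x<..y}. M r)"
    by (simp only:) (rule set_integral_Un, auto intro!: si)
  moreover have "(LBINT r:{x<..y}. M r) = (LBINT r:{x..y}. M r)"
    unfolding set_lebesgue_integral_def
  proof (rule integral_cong_AE)
    show "(\<lambda>r. indicator {x<..y} r *\<^sub>R M r) \<in> borel_measurable lborel"
      using borel_measurable_integrable[OF si[of "{x<..y}", unfolded set_integrable_def]] by simp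
    show "(\<lambda>r. indicator {x..y} r *\<^sub>R M r) \<in> borel_measurable lborel"
      using borel_measurable_integrable[OF si[of "{x..y}", unfolded set_integrable_def]] by simp
    show "AE r in lborel. indicator {x<..y} r *\<^sub>R M r = indicator {x..y} r *\<^sub>R M r"
      using AE_lborel_singleton[of x] by eventually_elim (auto simp: indicator_def)
  qed
  ultimately show ?thesis by simp
qed

lemma cumulative_integral_diff_nn:
  fixes M :: "real \<Rightarrow> real"
  assumes "integrable lborel M" "\<And>r. 0 \<le> M r" "x \<le> y"
  shows "ennreal ((LBINT r:{..y}. M r) - (LBINT r:{..x}. M r)) = (\<integral>\<^sup>+r. ennreal (M r) * indicator {x<..y} r \<partial>lborel)"
proof -
  have si: "integrable lborel (\<lambda>r. indicator {x..y} r *\<^sub>R M r)"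
    using integrable_imp_set_integrable[OF assms(1), of "{x..y}"] by (simp add: set_integrable_def)
  have "ennreal (LBINT r:{x..y}. M r) = (\<integral>\<^sup>+r. ennreal (indicator {x..y} r *\<^sub>R M r) \<partial>lborel)"
    unfolding set_lebesgue_integral_def
    by (rule nn_integral_eq_integral[symmetric, OF si]) (auto simp: assms(2))
  also have "\<dots> = (\<integral>\<^sup>+r. ennreal (M r) * indicator {x<..y} r \<partial>lborel)"
  proof (rule nn_integral_cong_AE)
    show "AE r in lborel. ennreal (indicator {x..y} r *\<^sub>R M r) = ennreal (M r) * indicator {x<..y} r"
      using AE_lborel_singleton[of x] by eventually_elim (auto simp: indicator_def)
  qed
  finally show ?thesis using cumulative_integral_diff[OF assms(1,3)] by simp
qed

lemma cumulative_integral_mono: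
  fixes M :: "real \<Rightarrow> real"
  assumes "integrable lborel M" "\<And>r. 0 \<le> M r" "x \<le> y"
  shows "(LBINT r:{..x}. M r) \<le> (LBINT r:{..y}. M r)"
proof -
  have "0 \<le> (LBINT r:{x..y}. M r)"
    unfolding set_lebesgue_integral_def
    by (rule Bochner_Integration.integral_nonneg) (simp add: assms(2))
  then show ?thesis using cumulative_integral_diff[OF assms(1,3)] by simp
qed

text \<open>A bound in \<open>L\<^sup>p\<close> with \<open>p > 1\<close> gives uniform integrability: \<open>M \<le> K + K\<^sup>1\<^sup>-\<^sup>p M\<^sup>p\<close> pointwise, so outside a part
  of small integral \<open>M\<close> is bounded by the constant \<open>K\<close>.\<close>

lemma sum_increments_le_of_powr_bound:
  fixes M :: "real \<Rightarrow> real" and a b :: "'i \<Rightarrow> real"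
  assumes p: "p > 1" and M: "integrable lborel M" "\<And>r. 0 \<le> M r"
    and C: "(\<integral>\<^sup>+r. ennreal (M r powr p) \<partial>lborel) \<le> ennreal C" "C \<ge> 0" and K: "K > 0"
    and J: "finite J" "\<And>j. j \<in> J \<Longrightarrow> a j \<le> b j" "disjoint_family_on (\<lambda>j. {a j<..b j}) J"
  shows "(\<Sum>j\<in>J. (LBINT r:{..b j}. M r) - (LBINT r:{..a j}. M r))
     \<le> C * K powr (1 - p) + K * (\<Sum>j\<in>J. b j - a j)"
proof -
  have Mm[measurable]: "M \<in> borel_measurable borel" using M(1) by auto
  have pt: "M r \<le> K + K powr (1 - p) * M r powr p" for r
  proof (cases "M r \<le> K")
    case True
    then show ?thesis by (simp add: add_increasing2)
  next
    case False
    then have "M r = M r powr (1 - p) * M r powr p" using K by (simp flip: powr_add)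
    also have "\<dots> \<le> K powr (1 - p) * M r powr p"
      using False K p by (intro mult_right_mono powr_mono2') auto
    finally show ?thesis using K by linarith
  qed
  have ind: "(\<Sum>j\<in>J. ennreal (M r) * indicator {a j<..b j} r)
      \<le> (\<Sum>j\<in>J. ennreal K * indicator {a j<..b j} r) + ennreal (K powr (1 - p)) * ennreal (M r powr p)" for r
  proof (cases "\<exists>j\<in>J. r \<in> {a j<..b j}")
    case True
    then obtain j where j: "j \<in> J" "r \<in> {a j<..b j}" by blast
    have eq: "(\<Sum>i\<in>J. c * indicator {a i<..b i} r) = c" for c :: ennreal
    proof -
      have "r \<notin> {a i<..b i}" if "i \<in> J" "i \<noteq> j" for i
        using j that J(3) unfolding disjoint_family_on_def by blast
      then have "(\<Sum>i\<in>J. c * indicator {a i<..b i} r) = (\<Sum>i\<in>J. if i = j then c else 0)"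
        using j(2) by (intro sum.cong refl) (auto simp: indicator_def)
      then show ?thesis using j(1) J(1) by simp
    qed
    have "ennreal (M r) \<le> ennreal (K + K powr (1 - p) * M r powr p)" by (rule ennreal_leI[OF pt])
    then show ?thesis using K unfolding eq by (simp add: ennreal_mult)
  next
    case False
    then have "(\<Sum>j\<in>J. ennreal (M r) * indicator {a j<..b j} r) = 0" by auto
    then show ?thesis by simp
  qed
  have "ennreal (\<Sum>j\<in>J. (LBINT r:{..b j}. M r) - (LBINT r:{..a j}. M r))
     = (\<Sum>j\<in>J. ennreal ((LBINT r:{..b j}. M r) - (LBINT r:{..a j}. M r)))"
    using cumulative_integral_mono[OF M] J(2) by (intro sum_ennreal[symmetric]) simp
  also have "\<dots> = (\<Sum>j\<in>J. \<integral>\<^sup>+r. ennreal (M r) * indicator {a j<..b j} r \<partial>lborel)"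
    by (intro sum.cong refl cumulative_integral_diff_nn M J)
  also have "\<dots> = (\<integral>\<^sup>+r. (\<Sum>j\<in>J. ennreal (M r) * indicator {a j<..b j} r) \<partial>lborel)"
    by (rule nn_integral_sum[symmetric]) simp
  also have "\<dots> \<le> (\<integral>\<^sup>+r. (\<Sum>j\<in>J. ennreal K * indicator {a j<..b j} r) + ennreal (K powr (1 - p)) * ennreal (M r powr p) \<partial>lborel)"
    by (rule nn_integral_mono) (rule ind)
  also have "\<dots> = (\<Sum>j\<in>J. \<integral>\<^sup>+r. ennreal K * indicator {a j<..b j} r \<partial>lborel)
      + ennreal (K powr (1 - p)) * (\<integral>\<^sup>+r. ennreal (M r powr p) \<partial>lborel)"
    by (subst nn_integral_add) (simp_all add: nn_integral_sum nn_integral_cmult)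
  also have "\<dots> = ennreal (K * (\<Sum>j\<in>J. b j - a j))
      + ennreal (K powr (1 - p)) * (\<integral>\<^sup>+r. ennreal (M r powr p) \<partial>lborel)"
  proof -
    have "(\<Sum>j\<in>J. \<integral>\<^sup>+r. ennreal K * indicator {a j<..b j} r \<partial>lborel) = (\<Sum>j\<in>J. ennreal (K * (b j - a j)))"
      using J(2) K by (intro sum.cong refl) (simp add: nn_integral_cmult ennreal_mult)
    also have "\<dots> = ennreal (K * (\<Sum>j\<in>J. b j - a j))"
      using J(2) K by (simp add: sum_distrib_left)
    finally show ?thesis by simp
  qed
  also have "\<dots> \<le> ennreal (K * (\<Sum>j\<in>J. b j - a j)) + ennreal (C * K powr (1 - p))"
  proof (rule add_left_mono)
    have "ennreal (K powr (1 - p)) * (\<integral>\<^sup>+r. ennreal (M r powr p) \<partial>lborel) \<le> ennreal (K powr (1 - p)) * ennreal C"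
      by (rule mult_left_mono[OF C(1)]) simp
    then show "ennreal (K powr (1 - p)) * (\<integral>\<^sup>+r. ennreal (M r powr p) \<partial>lborel) \<le> ennreal (C * K powr (1 - p))"
      using C(2) by (simp add: ennreal_mult mult.commute)
  qed
  also have "ennreal (K * (\<Sum>j\<in>J. b j - a j)) + ennreal (C * K powr (1 - p))
     = ennreal (C * K powr (1 - p) + K * (\<Sum>j\<in>J. b j - a j))"
    using C(2) K J(2) by (simp add: sum_nonneg add.commute flip: ennreal_plus)
  finally show ?thesis
    using C(2) K J(2) by (subst (asm) ennreal_le_iff) (auto intro!: add_nonneg_nonneg mult_nonneg_nonneg sum_nonneg)
qed

lemma increment_le_of_powr_bound:
  fixes M :: "real \<Rightarrow> real"
  assumes p: "p > 1" and M: "integrable lborel M" "\<And>r. 0 \<le> M r"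
    and C: "(\<integral>\<^sup>+r. ennreal (M r powr p) \<partial>lborel) \<le> ennreal C" "C \<ge> 0" and K: "K > 0" and "x \<le> y"
  shows "(LBINT r:{..y}. M r) - (LBINT r:{..x}. M r) \<le> C * K powr (1 - p) + K * (y - x)"
  using sum_increments_le_of_powr_bound[OF p M C K, of "{()}" "\<lambda>_. x" "\<lambda>_. y"] \<open>x \<le> y\<close>
  by (simp add: disjoint_family_on_def)

lemma exists_large_powr_small:
  fixes C \<eta> p :: real
  assumes "p > 1" "C \<ge> 0" "\<eta> > 0"
  obtains K where "K > 0" "C * K powr (1 - p) \<le> \<eta>"
proof -
  define K where "K = ((C + 1) / \<eta>) powr (1 / (p - 1))"
  have K0: "K > 0" using assms by (simp add: K_def)
  have "1 / (p - 1) * (1 - p) = -1" using assms by (simp add: field_simps)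
  then have "K powr (1 - p) = ((C + 1) / \<eta>) powr (- 1)"
    by (simp only: K_def powr_powr)
  also have "\<dots> = \<eta> / (C + 1)" using assms by (simp add: powr_minus_divide)
  finally have "C * K powr (1 - p) = C * \<eta> / (C + 1)" by simp
  also have "\<dots> \<le> \<eta>" using assms by (simp add: field_simps)
  finally show ?thesis using K0 that by blast
qed

lemma grid_disjoint:
  assumes "e > 0"
  shows "disjoint_family_on (\<lambda>j::int. {of_int j * e<..(of_int j + 1) * (e::real)}) J"
  unfolding disjoint_family_on_def
proof (intro ballI impI)
  fix i j :: int assume "i \<noteq> j"
  have *: False if "of_int i * e < x" "x \<le> (of_int i + 1) * e" "of_int j * e < x" "x \<le> (of_int j + 1) * e" for x
  proof -
    have "of_int i * e < (of_int j + 1) * e" "of_int j * e < (of_int i + 1) * e" using that by auto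
    then have "real_of_int i < of_int j + 1" "real_of_int j < of_int i + 1" using assms by auto
    then show False using \<open>i \<noteq> j\<close> by linarith
  qed
  show "{of_int i * e<..(of_int i + 1) * e} \<inter> {of_int j * e<..(of_int j + 1) * e} = {}"
  proof (rule equals0I)
    fix x assume "x \<in> {of_int i * e<..(of_int i + 1) * e} \<inter> {of_int j * e<..(of_int j + 1) * e}"
    then show False by (intro *[of x]) auto
  qed
qed

lemma grid_increments_le_of_powr_bound:
  fixes M :: "real \<Rightarrow> real"
  assumes p: "p > 1" and M: "integrable lborel M" "\<And>r. 0 \<le> M r"
    and C: "(\<integral>\<^sup>+r. ennreal (M r powr p) \<partial>lborel) \<le> ennreal C" "C \<ge> 0" and K: "K > 0"
    and J: "finite (J::int set)" "e > 0"
  shows "(\<Sum>j\<in>J. (LBINT r:{..(of_int j + 1) * e}. M r) - (LBINT r:{..of_int j * e}. M r))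
     \<le> C * K powr (1 - p) + K * (real (card J) * e)"
proof -
  have "(\<Sum>j\<in>J. (LBINT r:{..(of_int j + 1) * e}. M r) - (LBINT r:{..of_int j * e}. M r))
     \<le> C * K powr (1 - p) + K * (\<Sum>j\<in>J. (of_int j + 1) * e - of_int j * e)"
    using J by (intro sum_increments_le_of_powr_bound[OF p M C K] grid_disjoint) auto
  then show ?thesis by (simp add: algebra_simps)
qed

text \<open>Jensen's inequality for the mean \<open>a\<close> of \<open>M\<close> over an interval. It comes from integrating Young's
  inequality for the product \<open>a\<^sup>p\<^sup>-\<^sup>1 M\<close>, whose integral is \<open>a\<^sup>p\<close> times the length.\<close>

lemma difference_quotient_powr_le:
  fixes M :: "real \<Rightarrow> real"
  assumes pq: "p > 1" "q > 1" "1/p + 1/q = 1" and M: "integrable lborel M" "\<And>r. 0 \<le> M r" and "e > 0"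
  shows "ennreal ((((LBINT r:{..x+e}. M r) - (LBINT r:{..x}. M r)) / e) powr p)
     \<le> ennreal (1/e) * (\<integral>\<^sup>+r. ennreal (M r powr p) * indicator {x<..x+e} r \<partial>lborel)" (is "_ \<le> _ * ?I")
proof (cases "?I = \<infinity>")
  case True
  then show ?thesis using \<open>e > 0\<close> by (simp add: ennreal_mult_top)
next
  case False
  have Mm[measurable]: "M \<in> borel_measurable borel" using M(1) by auto
  define D where "D = (LBINT r:{..x+e}. M r) - (LBINT r:{..x}. M r)"
  have D0: "D \<ge> 0" using cumulative_integral_mono[OF M, of x "x+e"] \<open>e > 0\<close> by (simp add: D_def)
  have Dn: "ennreal D = (\<integral>\<^sup>+r. ennreal (M r) * indicator {x<..x+e} r \<partial>lborel)"
    unfolding D_def using \<open>e > 0\<close> by (intro cumulative_integral_diff_nn M) simp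
  define a where "a = D / e"
  have a0: "a \<ge> 0" using D0 \<open>e > 0\<close> by (simp add: a_def)
  obtain c where c: "?I = ennreal c" "c \<ge> 0" using False by (cases ?I) auto
  have q: "(p - 1) * q = p" using pq by (simp add: field_simps)
  have Y: "a powr (p - 1) * M r \<le> 1/p * M r powr p + a powr p / q" for r
    using Youngs_inequality[OF pq M(2)[of r], of "a powr (p-1)"] by (simp add: powr_powr q mult.commute[of "M r"])
  have "ennreal (a powr (p - 1) * D) = ennreal (a powr (p-1)) * ennreal D"
    using D0 by (simp add: ennreal_mult)
  also have "\<dots> = (\<integral>\<^sup>+r. ennreal (a powr (p-1)) * (ennreal (M r) * indicator {x<..x+e} r) \<partial>lborel)"
    unfolding Dn by (rule nn_integral_cmult[symmetric]) simp
  also have "\<dots> \<le> (\<integral>\<^sup>+r. ennreal (1/p) * (ennreal (M r powr p) * indicator {x<..x+e} r)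
       + ennreal (a powr p / q) * indicator {x<..x+e} r \<partial>lborel)"
  proof (rule nn_integral_mono)
    fix r
    show "ennreal (a powr (p-1)) * (ennreal (M r) * indicator {x<..x+e} r) \<le> ennreal (1/p) * (ennreal (M r powr p) * indicator {x<..x+e} r)
       + ennreal (a powr p / q) * indicator {x<..x+e} r"
    proof (cases "r \<in> {x<..x+e}")
      case True
      have "ennreal (a powr (p-1)) * ennreal (M r) = ennreal (a powr (p-1) * M r)"
        using M(2)[of r] by (simp add: ennreal_mult)
      also have "\<dots> \<le> ennreal (1/p * M r powr p + a powr p / q)" by (rule ennreal_leI[OF Y])
      also have "\<dots> = ennreal (1/p * M r powr p) + ennreal (a powr p / q)"
        using pq by (intro ennreal_plus) auto
      also have "ennreal (1/p * M r powr p) = ennreal (1/p) * ennreal (M r powr p)"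
        using pq by (intro ennreal_mult) auto
      finally show ?thesis using True by simp
    qed simp
  qed
  also have "\<dots> = ennreal (1/p) * ?I + ennreal (a powr p / q) * ennreal e"
    using \<open>e > 0\<close> by (subst nn_integral_add) (simp_all add: nn_integral_cmult)
  also have "\<dots> = ennreal (c / p + a powr p / q * e)"
    using c pq \<open>e > 0\<close> by (simp add: ennreal_mult[symmetric] ennreal_plus[symmetric] del: ennreal_plus)
  finally have "a powr (p - 1) * D \<le> c / p + a powr p / q * e"
    using c pq \<open>e > 0\<close> by (subst (asm) ennreal_le_iff) auto
  moreover have "a powr (p - 1) * D = a powr p * e"
  proof (cases "a = 0")
    case True
    then show ?thesis by simp
  next
    case False
    have "a powr p = a powr (p - 1) * a" using a0 False powr_add[of a "p - 1" 1] by simp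
    then show ?thesis using \<open>e > 0\<close> by (simp add: a_def)
  qed
  ultimately have "a powr p * e \<le> c / p + a powr p * e * (1/q)" by simp
  moreover have "1/q = 1 - 1/p" using pq by simp
  ultimately have "a powr p * e / p \<le> c / p" by (simp add: algebra_simps)
  then have "a powr p * e \<le> c" using pq by (simp add: divide_le_cancel)
  then have "a powr p \<le> 1 / e * c" using \<open>e > 0\<close> by (simp add: field_simps)
  then have "ennreal (a powr p) \<le> ennreal (1/e * c)" by (rule ennreal_leI)
  also have "\<dots> = ennreal (1/e) * ?I" unfolding c(1) using c(2) \<open>e > 0\<close> by (intro ennreal_mult) auto
  finally show ?thesis by (simp add: a_def D_def)
qed

text \<open>Averaging does not increase the \<open>L\<^sup>p\<close> norm: after Jensen's inequality and Tonelli's theorem each point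
  is counted with total weight one.\<close>

lemma nn_integral_difference_quotient_powr_le:
  fixes M :: "real \<Rightarrow> real"
  assumes pq: "p > 1" "q > 1" "1/p + 1/q = 1" and M: "integrable lborel M" "\<And>r. 0 \<le> M r" and "e > 0"
  shows "(\<integral>\<^sup>+x. ennreal ((((LBINT r:{..x+e}. M r) - (LBINT r:{..x}. M r)) / e) powr p) \<partial>lborel)
     \<le> (\<integral>\<^sup>+r. ennreal (M r powr p) \<partial>lborel)"
proof -
  have Mm[measurable]: "M \<in> borel_measurable borel" using M(1) by auto
  let ?f = "\<lambda>x r. ennreal (M r powr p) * indicator {(x, r). x < r \<and> r \<le> x + e} (x, r)"
  have "{z \<in> space (borel \<Otimes>\<^sub>M borel). fst z < snd z \<and> snd z \<le> fst z + e} \<in> sets (borel \<Otimes>\<^sub>M borel)"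
    by measurable
  then have S[measurable]: "{(x, r). x < r \<and> r \<le> x + e} \<in> sets (borel \<Otimes>\<^sub>M borel)"
    by (simp add: space_pair_measure case_prod_beta')
  have fm: "case_prod ?f \<in> borel_measurable (lborel \<Otimes>\<^sub>M lborel)"
    unfolding case_prod_beta by measurable
  have "(\<integral>\<^sup>+x. ennreal ((((LBINT r:{..x+e}. M r) - (LBINT r:{..x}. M r)) / e) powr p) \<partial>lborel)
     \<le> (\<integral>\<^sup>+x. ennreal (1/e) * (\<integral>\<^sup>+r. ?f x r \<partial>lborel) \<partial>lborel)"
  proof (rule nn_integral_mono)
    fix x
    have "(\<integral>\<^sup>+r. ?f x r \<partial>lborel) = (\<integral>\<^sup>+r. ennreal (M r powr p) * indicator {x<..x+e} r \<partial>lborel)"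
      by (rule nn_integral_cong) (auto simp: indicator_def)
    then show "ennreal ((((LBINT r:{..x+e}. M r) - (LBINT r:{..x}. M r)) / e) powr p)
      \<le> ennreal (1/e) * (\<integral>\<^sup>+r. ?f x r \<partial>lborel)"
      using difference_quotient_powr_le[OF assms] by simp
  qed
  also have "\<dots> = ennreal (1/e) * (\<integral>\<^sup>+x. (\<integral>\<^sup>+r. ?f x r \<partial>lborel) \<partial>lborel)"
    using lborel.borel_measurable_nn_integral[OF fm] by (intro nn_integral_cmult) simp
  also have "(\<integral>\<^sup>+x. (\<integral>\<^sup>+r. ?f x r \<partial>lborel) \<partial>lborel) = (\<integral>\<^sup>+r. (\<integral>\<^sup>+x. ?f x r \<partial>lborel) \<partial>lborel)"
    by (rule lborel_pair.Fubini'[OF fm, symmetric])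
  also have "\<dots> = (\<integral>\<^sup>+r. ennreal e * ennreal (M r powr p) \<partial>lborel)"
  proof (rule nn_integral_cong)
    fix r
    have "(\<integral>\<^sup>+x. ?f x r \<partial>lborel) = (\<integral>\<^sup>+x. ennreal (M r powr p) * indicator {r-e..<r} x \<partial>lborel)"
      by (rule nn_integral_cong) (auto simp: indicator_def)
    also have "\<dots> = ennreal e * ennreal (M r powr p)"
      using \<open>e > 0\<close> by (simp add: nn_integral_cmult mult.commute)
    finally show "(\<integral>\<^sup>+x. ?f x r \<partial>lborel) = ennreal e * ennreal (M r powr p)" .
  qed
  also have "\<dots> = ennreal e * (\<integral>\<^sup>+r. ennreal (M r powr p) \<partial>lborel)" by (rule nn_integral_cmult) simp
  also have "ennreal (1/e) * \<dots> = (\<integral>\<^sup>+r. ennreal (M r powr p) \<partial>lborel)"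
    using \<open>e > 0\<close> by (simp add: mult.assoc[symmetric] ennreal_mult[symmetric])
  finally show ?thesis .
qed

text \<open>Weak lower semicontinuity of the \<open>L\<^sup>p\<close> norm, without weak topologies: pointwise convergence of the
  cumulative integrals is all that is known of the convergence of \<open>M n\<close>. For a fixed step the
  difference quotients of the cumulative integrals converge and have at most the norm of \<open>M n\<close>;
  the step then tends to zero. Both limits are taken by Fatou's lemma.\<close>

lemma nn_integral_derivative_powr_le_liminf:
  fixes M :: "nat \<Rightarrow> real \<Rightarrow> real" and G h :: "real \<Rightarrow> real"
  assumes pq: "p > 1" "q > 1" "1/p + 1/q = 1"
    and M: "\<And>n. integrable lborel (M n)" "\<And>n r. 0 \<le> M n r"
    and lim: "\<And>x. (\<lambda>n. LBINT r:{..x}. M n r) \<longlonglongrightarrow> G x"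
    and deriv: "AE x in lborel. (G has_real_derivative h x) (at x)"
  shows "(\<integral>\<^sup>+r. ennreal (h r powr p) \<partial>lborel) \<le> liminf (\<lambda>n. \<integral>\<^sup>+r. ennreal (M n r powr p) \<partial>lborel)"
proof -
  define F where "F n x = (LBINT r:{..x}. M n r)" for n x
  have Fmono: "mono (F n)" for n
    unfolding F_def by (intro monoI cumulative_integral_mono M)
  have Fm[measurable]: "F n \<in> borel_measurable borel" for n
    by (rule borel_measurable_mono[OF Fmono])
  have limF: "(\<lambda>n. F n x) \<longlonglongrightarrow> G x" for x using lim by (simp add: F_def)
  have Gm[measurable]: "G \<in> borel_measurable borel"
    by (rule borel_measurable_LIMSEQ_real[OF limF]) auto
  have Gmono: "G x \<le> G y" if "x \<le> y" for x y
    by (rule LIMSEQ_le[OF limF limF]) (use Fmono that in \<open>auto dest: monoD\<close>)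
  define e where "e k = 1 / real (Suc k)" for k
  have e: "e k > 0" for k by (simp add: e_def)
  have e_lim: "e \<longlonglongrightarrow> 0" unfolding e_def by (rule LIMSEQ_Suc[OF lim_1_over_n])
  let ?Q = "\<lambda>G k x. ennreal (((G (x + e k) - G x) / e k) powr p)"
  have powr_tendsto: "(\<lambda>n. ennreal (f n powr p)) \<longlonglongrightarrow> ennreal (l powr p)" if "f \<longlonglongrightarrow> l" "\<And>n. f n \<ge> 0" for f l
  proof -
    have "l \<ge> 0" using that by (intro LIMSEQ_le_const) auto
    then show ?thesis using that pq(1)
      by (intro tendsto_ennrealI tendsto_powr2) (auto intro: always_eventually)
  qed
  have "(\<integral>\<^sup>+r. ennreal (h r powr p) \<partial>lborel) = (\<integral>\<^sup>+x. liminf (\<lambda>k. ?Q G k x) \<partial>lborel)"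
  proof (rule nn_integral_cong_AE)
    show "AE x in lborel. ennreal (h x powr p) = liminf (\<lambda>k. ?Q G k x)"
      using deriv
    proof eventually_elim
      case (elim x)
      have "((\<lambda>d. (G (x + d) - G x) / d) \<longlongrightarrow> h x) (at 0)"
        using elim by (simp add: DERIV_def)
      moreover have "filterlim e (at 0) sequentially"
        using e_lim e[THEN less_imp_neq] by (simp add: filterlim_at)
      ultimately have "(\<lambda>k. (G (x + e k) - G x) / e k) \<longlonglongrightarrow> h x"
        by (rule filterlim_compose)
      then have "(\<lambda>k. ?Q G k x) \<longlonglongrightarrow> ennreal (h x powr p)"
        using e Gmono by (intro powr_tendsto) (auto intro!: divide_nonneg_pos simp: less_imp_le)
      then show ?case by (rule lim_imp_Liminf[symmetric, rotated]) simp
    qed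
  qed
  also have "\<dots> \<le> liminf (\<lambda>k. \<integral>\<^sup>+x. ?Q G k x \<partial>lborel)"
    by (rule nn_integral_liminf) simp
  also have "\<dots> \<le> liminf (\<lambda>n. \<integral>\<^sup>+r. ennreal (M n r powr p) \<partial>lborel)"
  proof (rule Liminf_le[OF sequentially_bot always_eventually], rule allI)
    fix k
    have "(\<integral>\<^sup>+x. ?Q G k x \<partial>lborel) = (\<integral>\<^sup>+x. liminf (\<lambda>n. ?Q (F n) k x) \<partial>lborel)"
    proof (rule nn_integral_cong)
      fix x
      have "(\<lambda>n. ?Q (F n) k x) \<longlonglongrightarrow> ?Q G k x"
        using e[of k] Fmono by (intro powr_tendsto tendsto_intros limF) (auto intro!: divide_nonneg_pos simp: less_imp_le mono_def)
      then show "?Q G k x = liminf (\<lambda>n. ?Q (F n) k x)" by (rule lim_imp_Liminf[symmetric, rotated]) simp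
    qed
    also have "\<dots> \<le> liminf (\<lambda>n. \<integral>\<^sup>+x. ?Q (F n) k x \<partial>lborel)"
      by (rule nn_integral_liminf) simp
    also have "\<dots> \<le> liminf (\<lambda>n. \<integral>\<^sup>+r. ennreal (M n r powr p) \<partial>lborel)"
      unfolding F_def
      by (intro Liminf_mono always_eventually allI nn_integral_difference_quotient_powr_le[OF pq M e])
    finally show "(\<integral>\<^sup>+x. ?Q G k x \<partial>lborel) \<le> liminf (\<lambda>n. \<integral>\<^sup>+r. ennreal (M n r powr p) \<partial>lborel)" .
  qed
  finally show ?thesis .
qed

section \<open>Existence of the metric derivative\<close>

text \<open>The curve is seen through the distances \<open>f r\<close> to its countably many points \<open>w r\<close>, \<open>r\<close> rational. Each
  \<open>f r\<close> is a real absolutely continuous function, so it has a derivative \<open>a r\<close> almost everywhere and is the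
  integral of it. By the triangle inequality and density of the points \<open>w r\<close>, the distance \<open>d(w s, w t)\<close> is the supremum
  of \<open>|f r t - f r s|\<close>, so it is at most the integral of \<open>\<mu> = sup |a r|\<close>. This bounds the difference
  quotients of the curve above by \<open>\<mu>\<close> in the limit, and each \<open>f r\<close> bounds them below by \<open>|a r|\<close>.\<close>

lemma AE_metric_derivative_exists:
  fixes w :: "real \<Rightarrow> 'a::metric_space" and m :: "real \<Rightarrow> real"
  assumes p: "p > 1" and m: "integrable lborel m" "\<And>r. 0 \<le> m r"
    and C: "(\<integral>\<^sup>+r. ennreal (m r powr p) \<partial>lborel) \<le> ennreal C" "C \<ge> 0"
    and w: "\<And>s t. s \<le> t \<Longrightarrow> dist (w s) (w t) \<le> (LBINT r:{s..t}. m r)"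
  obtains \<mu> where "\<mu> \<in> borel_measurable borel" "\<And>x. 0 \<le> \<mu> x" "\<And>x. \<mu> x \<le> m x"
    "AE x in lborel. ((\<lambda>s. dist (w s) (w x) / \<bar>x - s\<bar>) \<longlongrightarrow> \<mu> x) (at x)"
proof -
  have mm[measurable]: "m \<in> borel_measurable borel" using m(1) by auto
  have msi: "set_integrable lborel {x..y} m" for x y
    by (rule integrable_imp_set_integrable[OF m(1)]) simp
  define F where "F x = (LBINT r:{..x}. m r)" for x
  have Fd: "F y - F x = (LBINT r:{x..y}. m r)" if "x \<le> y" for x y
    unfolding F_def by (rule cumulative_integral_diff[OF m(1) that])
  have wF: "dist (w s) (w t) \<le> F t - F s" if "s \<le> t" for s t using w[OF that] Fd[OF that] by simp
  define f where "f r t = dist (w t) (w r)" for r t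
  have fd: "\<bar>f r t - f r s\<bar> \<le> dist (w s) (w t)" for r s t
    unfolding f_def by (smt (verit) dist_commute dist_triangle)
  have fF: "\<bar>f r t - f r s\<bar> \<le> F t - F s" if "s \<le> t" for r s t
    using fd[of r t s] wF[OF that] by simp
  \<comment> \<open>The function \<open>f r\<close> need not be monotone, but adding \<open>F\<close> makes it so at the price of doubling the increments.\<close>
  have "\<exists>h. h \<in> borel_measurable borel \<and> (\<forall>x y. set_integrable lborel {x..y} h) \<and>
      (\<forall>x y. x \<le> y \<longrightarrow> (f r y + F y) - (f r x + F x) = (LBINT r:{x..y}. h r))" for r
  proof -
    let ?g = "\<lambda>t. f r t + F t"
    have mono: "?g x \<le> ?g y" if "x \<le> y" for x y
      using fF[OF that, of r] by linarith
    have ac: "\<exists>K\<ge>0. \<forall>\<delta>>0. \<forall>J::int set. finite J \<longrightarrow>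
       (\<Sum>j\<in>J. ?g ((of_int j + 1) * \<delta>) - ?g (of_int j * \<delta>))
         \<le> \<eta> + K * (real (card J) * \<delta>)" if "\<eta> > 0" for \<eta>
    proof -
      have "\<eta> / 2 > 0" using that by simp
      from exists_large_powr_small[OF p C(2) this] obtain K where K: "K > 0" "C * K powr (1 - p) \<le> \<eta> / 2" .
      show ?thesis
      proof (intro exI[of _ "2 * K"] conjI allI impI)
        show "0 \<le> 2 * K" using K by simp
        fix \<delta> :: real and J :: "int set" assume "0 < \<delta>" "finite J"
        have "(\<Sum>j\<in>J. ?g ((of_int j + 1) * \<delta>) - ?g (of_int j * \<delta>))
           \<le> (\<Sum>j\<in>J. 2 * (F ((of_int j + 1) * \<delta>) - F (of_int j * \<delta>)))"
        proof (rule sum_mono)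
          fix j assume "j \<in> J"
          have "of_int j * \<delta> \<le> (of_int j + 1) * \<delta>" using \<open>0 < \<delta>\<close> by simp
          have aux: "(u + U) - (v + V) \<le> 2 * (U - V)" if "\<bar>u - v\<bar> \<le> U - V" for u v U V :: real
            using abs_le_D1[OF that] by simp
          show "?g ((of_int j + 1) * \<delta>) - ?g (of_int j * \<delta>)
             \<le> 2 * (F ((of_int j + 1) * \<delta>) - F (of_int j * \<delta>))"
            by (rule aux[OF fF]) fact
        qed
        also have "\<dots> = 2 * (\<Sum>j\<in>J. F ((of_int j + 1) * \<delta>) - F (of_int j * \<delta>))"
          by (rule sum_distrib_left[symmetric])
        also have "\<dots> \<le> 2 * (C * K powr (1 - p) + K * (real (card J) * \<delta>))"
          unfolding F_def
          by (intro mult_left_mono grid_increments_le_of_powr_bound[OF p m C K(1)] \<open>0 < \<delta>\<close> \<open>finite J\<close>) simp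
        also have "\<dots> \<le> \<eta> + 2 * K * (real (card J) * \<delta>)" using K(2) by (simp add: algebra_simps)
        finally show "(\<Sum>j\<in>J. ?g ((of_int j + 1) * \<delta>) - ?g (of_int j * \<delta>))
          \<le> \<eta> + 2 * K * (real (card J) * \<delta>)" .
      qed
    qed
    show ?thesis
      by (rule density_of_absolutely_continuous[of ?g, OF mono ac]) blast+
  qed
  then obtain H where H: "\<And>r. H r \<in> borel_measurable borel" "\<And>r x y. set_integrable lborel {x..y} (H r)"
      "\<And>r x y. x \<le> y \<Longrightarrow> (f r y + F y) - (f r x + F x) = (LBINT z:{x..y}. H r z)"
    by metis
  have Hm[measurable]: "H r \<in> borel_measurable borel" for r by (rule H(1))
  define a where "a r x = H r x - m x" for r x
  have am[measurable]: "a r \<in> borel_measurable borel" for r unfolding a_def by measurable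
  have F_deriv: "AE x in lborel. (F has_real_derivative m x) (at x)"
    by (rule AE_has_derivative_indefinite_integral[OF msi Fd])
  have g_deriv: "AE x in lborel. ((\<lambda>t. f r t + F t) has_real_derivative H r x) (at x)" for r
    by (rule AE_has_derivative_indefinite_integral[OF H(2)]) (rule H(3))
  have f_deriv: "AE x in lborel. (f r has_real_derivative a r x) (at x)" for r
    using F_deriv g_deriv[of r]
  proof eventually_elim
    case (elim x)
    have "((\<lambda>t. (f r t + F t) - F t) has_real_derivative a r x) (at x)"
      unfolding a_def by (rule DERIV_diff[OF elim(2,1)])
    then show ?case by simp
  qed
  have a_le: "\<bar>a r x\<bar> \<le> m x"
    if "(F has_real_derivative m x) (at x)" "(f r has_real_derivative a r x) (at x)" for r x
  proof (rule tendsto_le[of "at x"])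
    show "((\<lambda>y. (F y - F x) / (y - x)) \<longlongrightarrow> m x) (at x)"
      using that(1) by (simp add: has_field_derivative_iff)
    show "((\<lambda>y. \<bar>(f r y - f r x) / (y - x)\<bar>) \<longlongrightarrow> \<bar>a r x\<bar>) (at x)"
      using that(2) by (intro tendsto_rabs) (simp add: has_field_derivative_iff)
    have "\<bar>(f r y - f r x) / (y - x)\<bar> \<le> (F y - F x) / (y - x)" if "y \<noteq> x" for y
    proof (cases "x \<le> y")
      case True
      then show ?thesis using fF[OF True, of r] that by (simp add: divide_right_mono)
    next
      case False
      then have "\<bar>f r y - f r x\<bar> / (x - y) \<le> (F x - F y) / (x - y)"
        using fF[of y x r] by (intro divide_right_mono) auto
      also have "\<dots> = (F y - F x) / (y - x)" by (metis minus_diff_eq minus_divide_divide)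
      finally show ?thesis using False by simp
    qed
    then show "\<forall>\<^sub>F y in at x. \<bar>(f r y - f r x) / (y - x)\<bar> \<le> (F y - F x) / (y - x)"
      by (auto simp: eventually_at intro: exI[of _ 1])
  qed simp
  \<comment> \<open>The minimum with \<open>m x\<close> acts only on a null set, by \<open>a_le\<close>; it keeps the supremum finite everywhere.\<close>
  define \<mu> where "\<mu> x = (SUP r\<in>\<rat>. min (m x) \<bar>a r x\<bar>)" for x
  have bdd: "bdd_above ((\<lambda>r. min (m x) \<bar>a r x\<bar>) ` \<rat>)" for x
    by (rule bdd_aboveI[of _ "m x"]) auto
  have \<mu>m[measurable]: "\<mu> \<in> borel_measurable borel"
    unfolding \<mu>_def by (rule borel_measurable_cSUP) (auto simp: bdd countable_rat)
  have \<mu>_ge: "min (m x) \<bar>a r x\<bar> \<le> \<mu> x" if "r \<in> \<rat>" for r x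
    unfolding \<mu>_def by (rule cSUP_upper[OF that bdd])
  have \<mu>0: "0 \<le> \<mu> x" for x
    using \<mu>_ge[of 0 x] m(2)[of x] by (smt (verit) Rats_0)
  have \<mu>le: "\<mu> x \<le> m x" for x
    unfolding \<mu>_def by (rule cSUP_least) auto
  have \<mu>int: "integrable lborel \<mu>"
    by (rule Bochner_Integration.integrable_bound[OF m(1)]) (auto simp: \<mu>0 \<mu>le m(2))
  have \<mu>si: "set_integrable lborel {x..y} \<mu>" for x y
    by (rule integrable_imp_set_integrable[OF \<mu>int]) simp
  define F\<mu> where "F\<mu> x = (LBINT r:{..x}. \<mu> r)" for x
  have F\<mu>d: "F\<mu> y - F\<mu> x = (LBINT r:{x..y}. \<mu> r)" if "x \<le> y" for x y
    unfolding F\<mu>_def by (rule cumulative_integral_diff[OF \<mu>int that])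
  have F\<mu>_deriv: "AE x in lborel. (F\<mu> has_real_derivative \<mu> x) (at x)"
    by (rule AE_has_derivative_indefinite_integral[OF \<mu>si F\<mu>d])
  have w\<mu>: "dist (w s) (w t) \<le> F\<mu> t - F\<mu> s" if st: "s \<le> t" for s t
  proof (rule field_le_epsilon)
    fix e :: real assume "e > 0"
    then have "e / 4 > 0" by simp
    from exists_large_powr_small[OF p C(2) this] obtain K where K: "K > 0" "C * K powr (1 - p) \<le> e / 4" .
    have "s < s + e / (4 * K)" using K \<open>e > 0\<close> by simp
    then obtain r where r: "r \<in> \<rat>" "s < r" "r < s + e / (4 * K)"
      using Rats_dense_in_real by blast
    have "F r - F s \<le> C * K powr (1 - p) + K * (r - s)"
      unfolding F_def using r by (intro increment_le_of_powr_bound[OF p m C K(1)]) simp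
    also have "K * (r - s) \<le> K * (e / (4 * K))" using r K by (intro mult_left_mono) auto
    also have "K * (e / (4 * K)) = e / 4" using K by simp
    finally have "F r - F s \<le> e / 2" using K(2) by simp
    then have near: "dist (w s) (w r) \<le> e / 2" using wF[of s r] r by simp
    have "dist (w s) (w t) \<le> f r t - f r s + 2 * dist (w s) (w r)"
      unfolding f_def by (smt (verit) dist_commute dist_triangle)
    also have "\<dots> \<le> f r t - f r s + e" using near by simp
    also have "f r t - f r s = (LBINT z:{s..t}. H r z) - (LBINT z:{s..t}. m z)"
      using H(3)[OF st, of r] Fd[OF st] by simp
    also have "\<dots> = (LBINT z:{s..t}. a r z)"
      unfolding a_def by (rule set_integral_diff(2)[OF H(2) msi, symmetric])
    also have "\<dots> \<le> (LBINT z:{s..t}. \<mu> z)"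
    proof (rule set_integral_mono_AE)
      show "set_integrable lborel {s..t} (a r)"
        unfolding a_def by (rule set_integral_diff(1)[OF H(2) msi])
      show "set_integrable lborel {s..t} \<mu>" by (rule \<mu>si)
      show "AE z \<in> {s..t} in lborel. a r z \<le> \<mu> z"
        using F_deriv f_deriv[of r]
      proof eventually_elim
        case (elim z)
        show ?case using a_le[OF elim] \<mu>_ge[OF r(1), of z] by linarith
      qed
    qed
    also have "\<dots> = F\<mu> t - F\<mu> s" using F\<mu>d[OF st] by simp
    finally show "dist (w s) (w t) \<le> F\<mu> t - F\<mu> s + e" by simp
  qed
  have "AE x in lborel. \<forall>r\<in>\<rat>. (f r has_real_derivative a r x) (at x)"
    using f_deriv by (subst AE_ball_countable) (auto simp: countable_rat)
  with F_deriv F\<mu>_deriv have "AE x in lborel. ((\<lambda>s. dist (w s) (w x) / \<bar>x - s\<bar>) \<longlongrightarrow> \<mu> x) (at x)"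
  proof eventually_elim
    case (elim x)
    show ?case
    proof (rule order_tendstoI)
      fix c assume "c < \<mu> x"
      then obtain r where r: "r \<in> \<rat>" "c < min (m x) \<bar>a r x\<bar>"
        unfolding \<mu>_def by (subst (asm) less_cSUP_iff[OF _ bdd]) auto
      have "((\<lambda>y. \<bar>(f r y - f r x) / (y - x)\<bar>) \<longlongrightarrow> \<bar>a r x\<bar>) (at x)"
        using elim(3) r(1) by (intro tendsto_rabs) (simp add: has_field_derivative_iff)
      then have "\<forall>\<^sub>F y in at x. c < \<bar>(f r y - f r x) / (y - x)\<bar>"
        by (rule order_tendstoD) (use r in auto)
      then show "\<forall>\<^sub>F s in at x. c < dist (w s) (w x) / \<bar>x - s\<bar>"
      proof eventually_elim
        case (elim y)
        have "\<bar>(f r y - f r x) / (y - x)\<bar> \<le> dist (w y) (w x) / \<bar>x - y\<bar>"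
          using fd[of r y x] by (simp add: abs_minus_commute dist_commute divide_right_mono)
        with elim show ?case by simp
      qed
    next
      fix c assume c: "\<mu> x < c"
      have "((\<lambda>y. (F\<mu> y - F\<mu> x) / (y - x)) \<longlongrightarrow> \<mu> x) (at x)"
        using elim(2) by (simp add: has_field_derivative_iff)
      then have "\<forall>\<^sub>F y in at x. (F\<mu> y - F\<mu> x) / (y - x) < c"
        by (rule order_tendstoD) (rule c)
      moreover have "\<forall>\<^sub>F y in at x. y \<noteq> x" by (auto simp: eventually_at intro: exI[of _ 1])
      ultimately show "\<forall>\<^sub>F s in at x. dist (w s) (w x) / \<bar>x - s\<bar> < c"
      proof eventually_elim
        case (elim y)
        have "dist (w y) (w x) / \<bar>x - y\<bar> \<le> (F\<mu> y - F\<mu> x) / (y - x)"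
        proof (cases "x \<le> y")
          case True
          then show ?thesis using w\<mu>[OF True] by (simp add: dist_commute divide_right_mono)
        next
          case False
          then have "dist (w y) (w x) / (x - y) \<le> (F\<mu> x - F\<mu> y) / (x - y)"
            using w\<mu>[of y x] by (intro divide_right_mono) auto
          also have "\<dots> = (F\<mu> y - F\<mu> x) / (y - x)" by (metis minus_diff_eq minus_divide_divide)
          finally show ?thesis using False by simp
        qed
        with elim show ?case by simp
      qed
    qed
  qed
  with \<mu>m \<mu>0 \<mu>le show ?thesis by (rule that)
qed

section \<open>Pointwise compactness of curves\<close>

lemma limitin_seq_compactin:
  assumes "Hausdorff_space X" "seq_compactin X S" "\<And>n. w n \<in> S" "limitin X w l sequentially"
  shows "l \<in> S"
proof -
  obtain l' r where "l' \<in> S" "strict_mono (r :: nat \<Rightarrow> nat)" "limitin X (w \<circ> r) l' sequentially"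
    using assms(2,3) unfolding seq_compactin_def by blast
  moreover have "limitin X (w \<circ> r) l sequentially"
    by (rule limitin_subsequence) fact+
  ultimately show ?thesis
    using limitin_Hausdorff_unique[OF _ _ _ assms(1)] by (metis sequentially_bot)
qed

text \<open>A neighbourhood left infinitely often by the sequence is left by all terms of some subsequence.\<close>

lemma limitin_sequentially_subsubsequence:
  assumes "l \<in> topspace X"
    and sub: "\<And>r::nat \<Rightarrow> nat. strict_mono r \<Longrightarrow> \<exists>r'::nat \<Rightarrow> nat. limitin X (\<lambda>n. w (r (r' n))) l sequentially"
  shows "limitin X w l sequentially"
proof (rule ccontr)
  assume "\<not> limitin X w l sequentially"
  then obtain U where U: "openin X U" "l \<in> U" "\<not> (\<forall>\<^sub>F n in sequentially. w n \<in> U)"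
    using assms(1) by (auto simp: limitin_def)
  then have "infinite {n. w n \<notin> U}"
    by (simp add: cofinite_eq_sequentially[symmetric] eventually_cofinite)
  then obtain r :: "nat \<Rightarrow> nat" where r: "strict_mono r" "\<And>n. w (r n) \<notin> U"
    using infinite_enumerate by blast
  obtain r' :: "nat \<Rightarrow> nat" where "limitin X (\<lambda>n. w (r (r' n))) l sequentially"
    using sub[OF r(1)] by blast
  then have "\<forall>\<^sub>F n in sequentially. w (r (r' n)) \<in> U" using U by (auto simp: limitin_def)
  then show False using r(2) by simp
qed

text \<open>A version of the Arzela-Ascoli theorem in which compactness is with respect to \<open>X\<close> and equicontinuity
  with respect to the metric, and only up to the time lag \<open>\<epsilon> n\<close> (piecewise constant curves jump). A diagonal sequence
  converges at all rational times, in \<open>X\<close> for the curves and in the reals for the moduli \<open>F n\<close>. At another time \<open>s\<close> two subsequential limits of \<open>z n s\<close>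
  have, by compatibility of the two topologies, distance at most \<open>G y - G s\<close> from the limit at any rational
  \<open>y > s\<close>; letting \<open>y\<close> tend to \<open>s\<close> shows that they agree.\<close>

lemma curves_pointwise_compactness:
  fixes z :: "nat \<Rightarrow> real \<Rightarrow> 'a::metric_space" and F :: "nat \<Rightarrow> real \<Rightarrow> real"
  assumes X: "Hausdorff_space X" "compatible_topology X" "seq_compactin X S"
    and zS: "\<And>n s. z n s \<in> S"
    and zF: "\<And>n s t. s \<le> t \<Longrightarrow> dist (z n s) (z n t) \<le> F n (t + \<epsilon> n) - F n s"
    and Fmono: "\<And>n x y. x \<le> y \<Longrightarrow> F n x \<le> F n y"
    and Fac: "\<And>\<eta>. \<eta> > 0 \<Longrightarrow> \<exists>K\<ge>0. \<forall>n x y. x \<le> y \<longrightarrow> F n y - F n x \<le> \<eta> + K * (y - x)"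
    and F0: "\<And>n. F n 0 = 0" and \<epsilon>: "\<And>n. 0 \<le> \<epsilon> n" "\<epsilon> \<longlonglongrightarrow> 0"
  obtains r w G where "strict_mono (r :: nat \<Rightarrow> nat)"
    "\<And>s. limitin X (\<lambda>n. z (r n) s) (w s) sequentially"
    "\<And>x. (\<lambda>n. F (r n) x) \<longlonglongrightarrow> G x"
    "\<And>s t. s \<le> t \<Longrightarrow> dist (w s) (w t) \<le> G t - G s"
proof -
  have cpt: "\<exists>l r. strict_mono (r :: nat \<Rightarrow> nat) \<and> limitin X (y \<circ> r) l sequentially" if "\<forall>n. y n \<in> S" for y
    using X(3) that unfolding seq_compactin_def by blast
  define q where "q k = (from_nat_into \<rat> k :: real)" for k
  have q: "\<exists>k. q k = x" if "x \<in> \<rat>" for x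
    unfolding q_def using from_nat_into_surj[OF countable_rat that] by simp
  define P where "P k s \<longleftrightarrow> (\<exists>l. limitin X (\<lambda>n. z (s n) (q k)) l sequentially) \<and>
     convergent (\<lambda>n. F (s n) (q k))" for k and s :: "nat \<Rightarrow> nat"
  have bnd: "bounded (range (\<lambda>n. F (s n) x))" for s :: "nat \<Rightarrow> nat" and x
  proof -
    obtain K where K: "K \<ge> 0" "\<And>n x y. x \<le> y \<Longrightarrow> F n y - F n x \<le> 1 + K * (y - x)"
      using Fac[of 1] by (metis zero_less_one)
    have "\<bar>F n x\<bar> \<le> 1 + K * \<bar>x\<bar>" for n
    proof (cases "0 \<le> x")
      case True
      then show ?thesis using K(2)[OF True, of n] Fmono[OF True, of n] F0[of n] by simp
    next
      case False
      then show ?thesis using K(2)[of x 0 n] Fmono[of x 0 n] F0[of n] by simp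
    qed
    then show ?thesis by (auto simp: bounded_iff)
  qed
  interpret subseqs P
  proof
    fix k and s :: "nat \<Rightarrow> nat" assume "strict_mono s"
    obtain l r1 where r1: "strict_mono (r1 :: nat \<Rightarrow> nat)"
      "limitin X ((\<lambda>n. z (s n) (q k)) \<circ> r1) l sequentially"
      using cpt[of "\<lambda>n. z (s n) (q k)"] zS by blast
    obtain r2 y where r2: "strict_mono (r2 :: nat \<Rightarrow> nat)" "((\<lambda>n. F (s (r1 n)) (q k)) \<circ> r2) \<longlonglongrightarrow> y"
      using bounded_imp_convergent_subsequence[OF bnd[of "s \<circ> r1" "q k"]] by (auto simp: o_def)
    have "limitin X (((\<lambda>n. z (s n) (q k)) \<circ> r1) \<circ> r2) l sequentially"
      by (rule limitin_subsequence[OF r2(1) r1(2)])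
    with r2(2) have "P k (s \<circ> (r1 \<circ> r2))" unfolding P_def by (auto simp: o_def convergent_def)
    then show "\<exists>r'. strict_mono r' \<and> P k (s \<circ> r')"
      using strict_mono_o[OF r1(1) r2(1)] by blast
  qed
  define r where "r = diagseq"
  have r: "strict_mono r" unfolding r_def by (rule subseq_diagseq)
  have "P k (diagseq \<circ> (+) (Suc k))" for k
  proof (rule diagseq_holds)
    fix r s :: "nat \<Rightarrow> nat" and n assume r: "strict_mono r" and "P n s"
    then obtain l where l: "limitin X (\<lambda>i. z (s i) (q n)) l sequentially"
      and c: "convergent (\<lambda>i. F (s i) (q n))"
      unfolding P_def by blast
    from limitin_subsequence[OF r l] convergent_subseq_convergent[OF c r]
    show "P n (s \<circ> r)" unfolding P_def by (auto simp: o_def)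
  qed
  then have Pr: "P k r" for k
  proof -
    have "P k (\<lambda>n. r (n + Suc k))"
      using \<open>P k (diagseq \<circ> (+) (Suc k))\<close> by (simp add: o_def r_def add.commute)
    then obtain l y where "limitin X (\<lambda>n. z (r (n + Suc k)) (q k)) l sequentially"
       "(\<lambda>n. F (r (n + Suc k)) (q k)) \<longlonglongrightarrow> y" unfolding P_def convergent_def by blast
    then have "limitin X (\<lambda>n. z (r n) (q k)) l sequentially" "(\<lambda>n. F (r n) (q k)) \<longlonglongrightarrow> y"
      using limitin_sequentially_offset_rev[of X "\<lambda>n. z (r n) (q k)" "Suc k" l]
        LIMSEQ_offset[of "\<lambda>n. F (r n) (q k)" "Suc k" y] by auto
    then show ?thesis unfolding P_def convergent_def by blast
  qed
  have zlim: "\<exists>l. limitin X (\<lambda>n. z (r n) x) l sequentially" if "x \<in> \<rat>" for x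
    using Pr q[OF that] unfolding P_def by blast
  have Fconv: "convergent (\<lambda>n. F (r n) x)" if "x \<in> \<rat>" for x
    using Pr q[OF that] unfolding P_def by blast
  have small_step: "\<exists>y\<in>\<rat>. x < y \<and> (\<forall>n. F n y - F n x \<le> e)" if "e > 0" for x e
  proof -
    have "e / 2 > 0" using that by simp
    from Fac[OF this] obtain K where K: "K \<ge> 0" "\<And>n x y. x \<le> y \<Longrightarrow> F n y - F n x \<le> e/2 + K * (y - x)"
      by blast
    have "x < x + e / (2 * (K + 1))" using that K(1) by simp
    then obtain y where y: "y \<in> \<rat>" "x < y" "y < x + e / (2 * (K + 1))"
      using Rats_dense_in_real by blast
    have "K * (y - x) \<le> (K + 1) * (e / (2 * (K + 1)))" using y K(1) by (intro mult_mono) auto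
    also have "\<dots> = e / 2" using K(1) by (simp add: field_simps)
    finally have "K * (y - x) \<le> e / 2" .
    then have "F n y - F n x \<le> e" for n using K(2)[of x y n] y by simp
    then show ?thesis using y by blast
  qed
  have "convergent (\<lambda>n. F (r n) x)" for x
  proof (rule Cauchy_convergent, rule metric_CauchyI)
    fix e :: real assume "e > 0"
    then have "e / 4 > 0" by simp
    from small_step[OF this] obtain y where y: "y \<in> \<rat>" "x < y" "\<And>n. F n y - F n x \<le> e / 4" by blast
    obtain N where N: "\<And>m n. m \<ge> N \<Longrightarrow> n \<ge> N \<Longrightarrow> dist (F (r m) y) (F (r n) y) < e / 4"
      using metric_CauchyD[OF convergent_Cauchy[OF Fconv[OF y(1)]] \<open>e / 4 > 0\<close>] by blast
    have "dist (F (r m) x) (F (r n) x) < e" if "m \<ge> N" "n \<ge> N" for m n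
    proof -
      have "\<bar>F (r m) x - F (r n) x\<bar> \<le> \<bar>F (r m) y - F (r n) y\<bar> + (F (r m) y - F (r m) x) + (F (r n) y - F (r n) x)"
        using Fmono[of x y "r m"] Fmono[of x y "r n"] y(2) by (simp add: abs_if)
      also have "\<dots> < e" using N[OF that] y(3)[of "r m"] y(3)[of "r n"] \<open>e > 0\<close> by (simp add: dist_real_def)
      finally show ?thesis by (simp add: dist_real_def)
    qed
    then show "\<exists>N. \<forall>m\<ge>N. \<forall>n\<ge>N. dist (F (r m) x) (F (r n) x) < e" by blast
  qed
  then obtain G where G: "\<And>x. (\<lambda>n. F (r n) x) \<longlonglongrightarrow> G x" unfolding convergent_def by metis
  have Geps: "(\<lambda>n. F (r n) (x + \<epsilon> (r n))) \<longlonglongrightarrow> G x" for x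
  proof -
    have "(\<lambda>n. F (r n) (x + \<epsilon> (r n)) - F (r n) x) \<longlonglongrightarrow> 0"
      unfolding LIMSEQ_def
    proof (intro allI impI)
      fix e :: real assume "e > 0"
      then have "e / 2 > 0" by simp
      from small_step[OF this] obtain y where y: "x < y" "\<And>n. F n y - F n x \<le> e / 2" by blast
      have "(\<lambda>n. \<epsilon> (r n)) \<longlonglongrightarrow> 0" using LIMSEQ_subseq_LIMSEQ[OF \<epsilon>(2) r] by (simp add: o_def)
      then have "\<forall>\<^sub>F n in sequentially. \<epsilon> (r n) < y - x" by (rule order_tendstoD) (use y in simp)
      then obtain N where N: "\<And>n. n \<ge> N \<Longrightarrow> \<epsilon> (r n) < y - x" unfolding eventually_sequentially by blast
      have "dist (F (r n) (x + \<epsilon> (r n)) - F (r n) x) 0 < e" if "n \<ge> N" for n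
        using Fmono[of x "x + \<epsilon> (r n)" "r n"] Fmono[of "x + \<epsilon> (r n)" y "r n"] y(2)[of "r n"] N[OF that] \<epsilon>(1)[of "r n"] \<open>e > 0\<close>
        by (simp add: dist_real_def)
      then show "\<exists>N. \<forall>n\<ge>N. dist (F (r n) (x + \<epsilon> (r n)) - F (r n) x) 0 < e" by blast
    qed
    from tendsto_add[OF this G[of x]] show ?thesis by simp
  qed
  have dist_le: "dist a b \<le> G t - G s"
    if "s \<le> t" "strict_mono \<rho>" "limitin X (\<lambda>n. z (r (\<rho> n)) s) a sequentially"
      "limitin X (\<lambda>n. z (r (\<rho> n)) t) b sequentially" for s t a b and \<rho> :: "nat \<Rightarrow> nat"
  proof -
    have "(\<lambda>n. F (r n) (t + \<epsilon> (r n)) - F (r n) s) \<longlonglongrightarrow> G t - G s"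
      by (intro tendsto_diff Geps G)
    from LIMSEQ_subseq_LIMSEQ[OF this that(2)]
    have lim: "(\<lambda>n. ereal (F (r (\<rho> n)) (t + \<epsilon> (r (\<rho> n))) - F (r (\<rho> n)) s)) \<longlonglongrightarrow> ereal (G t - G s)"
      by (intro tendsto_ereal) (simp add: o_def)
    have "ereal (dist a b) \<le> liminf (\<lambda>n. ereal (dist (z (r (\<rho> n)) s) (z (r (\<rho> n)) t)))"
      using X(2) that(3,4) unfolding compatible_topology_def by blast
    also have "\<dots> \<le> liminf (\<lambda>n. ereal (F (r (\<rho> n)) (t + \<epsilon> (r (\<rho> n))) - F (r (\<rho> n)) s))"
      using zF[OF that(1)] by (intro Liminf_mono always_eventually allI) simp
    also have "\<dots> = ereal (G t - G s)" by (rule lim_imp_Liminf[OF _ lim]) simp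
    finally show ?thesis by simp
  qed
  have sub: "\<exists>l \<rho>'. strict_mono \<rho>' \<and> limitin X (\<lambda>n. z (r (\<rho> (\<rho>' n))) s) l sequentially" for s and \<rho> :: "nat \<Rightarrow> nat"
  proof -
    obtain l \<rho>' where "strict_mono (\<rho>' :: nat \<Rightarrow> nat)" "limitin X ((\<lambda>n. z (r (\<rho> n)) s) \<circ> \<rho>') l sequentially"
      using cpt[of "\<lambda>n. z (r (\<rho> n)) s"] zS by blast
    then show ?thesis by (auto simp: o_def)
  qed
  have uniq: "l1 = l2"
    if "strict_mono \<rho>1" "limitin X (\<lambda>n. z (r (\<rho>1 n)) s) l1 sequentially"
      "strict_mono \<rho>2" "limitin X (\<lambda>n. z (r (\<rho>2 n)) s) l2 sequentially" for s l1 l2 and \<rho>1 \<rho>2 :: "nat \<Rightarrow> nat"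
  proof -
    have "dist l1 l2 \<le> 0 + e" if "e > 0" for e
    proof -
      have "e / 2 > 0" using that by simp
      from small_step[OF this] obtain y where y: "y \<in> \<rat>" "s < y" "\<And>n. F n y - F n s \<le> e / 2" by blast
      have Gy: "G y - G s \<le> e / 2"
        by (rule LIMSEQ_le_const2[OF tendsto_diff[OF G G]]) (use y in blast)
      obtain l where l: "limitin X (\<lambda>n. z (r n) y) l sequentially" using zlim[OF y(1)] by blast
      have "dist l1 l \<le> G y - G s"
        using y(2) l by (intro dist_le[OF _ \<open>strict_mono \<rho>1\<close> \<open>limitin X (\<lambda>n. z (r (\<rho>1 n)) s) l1 sequentially\<close>])
          (auto dest: limitin_subsequence[OF \<open>strict_mono \<rho>1\<close>] simp: o_def)
      moreover have "dist l2 l \<le> G y - G s"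
        using y(2) l by (intro dist_le[OF _ \<open>strict_mono \<rho>2\<close> \<open>limitin X (\<lambda>n. z (r (\<rho>2 n)) s) l2 sequentially\<close>])
          (auto dest: limitin_subsequence[OF \<open>strict_mono \<rho>2\<close>] simp: o_def)
      ultimately show ?thesis using Gy dist_triangle2[of l1 l2 l] by simp
    qed
    then have "dist l1 l2 \<le> 0" by (rule field_le_epsilon)
    then show ?thesis by simp
  qed
  have "\<exists>l. limitin X (\<lambda>n. z (r n) s) l sequentially" for s
  proof -
    obtain l \<rho> where \<rho>: "strict_mono \<rho>" "limitin X (\<lambda>n. z (r (\<rho> n)) s) l sequentially"
      using sub[of id s] by auto
    have "limitin X (\<lambda>n. z (r n) s) l sequentially"
    proof (rule limitin_sequentially_subsubsequence)
      show "l \<in> topspace X" using \<rho>(2) by (rule limitin_topspace)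
      fix \<rho>1 :: "nat \<Rightarrow> nat" assume "strict_mono \<rho>1"
      obtain l' \<rho>2 where \<rho>2: "strict_mono \<rho>2" "limitin X (\<lambda>n. z (r (\<rho>1 (\<rho>2 n))) s) l' sequentially"
        using sub[of \<rho>1 s] by blast
      have "l' = l"
        using uniq[OF strict_mono_o[OF \<open>strict_mono \<rho>1\<close> \<rho>2(1)] _ \<rho>, of l'] \<rho>2(2) by (simp add: o_def)
      then show "\<exists>r'. limitin X (\<lambda>n. z (r (\<rho>1 (r' n))) s) l sequentially" using \<rho>2 by blast
    qed
    then show ?thesis by blast
  qed
  then obtain w where w: "\<And>s. limitin X (\<lambda>n. z (r n) s) (w s) sequentially" by metis
  show ?thesis
  proof (rule that[OF r w G])
    fix s t :: real assume "s \<le> t"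
    then show "dist (w s) (w t) \<le> G t - G s"
      using dist_le[of s t id "w s" "w t"] w by (simp add: strict_mono_def)
  qed
qed

text \<open>Curves with speeds \<open>M n\<close> bounded in \<open>L\<^sup>p\<close> have a limit curve whose speed is dominated by some \<open>h\<close>,
  the density of the limit of the cumulative speeds, with the lower semicontinuity of the action
  on every initial time interval.\<close>

lemma limit_curve_exists:
  fixes z :: "nat \<Rightarrow> real \<Rightarrow> 'a::metric_space" and M :: "nat \<Rightarrow> real \<Rightarrow> real"
  assumes pq: "p > 1" "q > 1" "1/p + 1/q = 1"
    and X: "Hausdorff_space X" "compatible_topology X" "seq_compactin X S"
    and zS: "\<And>n s. z n s \<in> S"
    and M: "\<And>n. integrable lborel (M n)" "\<And>n r. 0 \<le> M n r" "\<And>n r. r \<le> 0 \<Longrightarrow> M n r = 0"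
    and C: "\<And>n. (\<integral>\<^sup>+r. ennreal (M n r powr p) \<partial>lborel) \<le> ennreal C" "C \<ge> 0"
    and zM: "\<And>n s t. s \<le> t \<Longrightarrow> dist (z n s) (z n t) \<le> (LBINT r:{..t + \<epsilon> n}. M n r) - (LBINT r:{..s}. M n r)"
    and \<epsilon>: "\<And>n. 0 \<le> \<epsilon> n" "\<epsilon> \<longlonglongrightarrow> 0"
  obtains r w h where "strict_mono (r :: nat \<Rightarrow> nat)"
    "\<And>s. limitin X (\<lambda>n. z (r n) s) (w s) sequentially"
    "h \<in> borel_measurable borel" "\<And>x. 0 \<le> h x" "\<And>x y. set_integrable lborel {x..y} h"
    "\<And>s t. s \<le> t \<Longrightarrow> dist (w s) (w t) \<le> (LBINT x:{s..t}. h x)"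
    "\<And>\<tau>. (\<integral>\<^sup>+x. ennreal (h x powr p) * indicator {..\<tau>} x \<partial>lborel)
        \<le> liminf (\<lambda>n. \<integral>\<^sup>+x. ennreal (M (r n) x powr p) * indicator {..\<tau>} x \<partial>lborel)"
proof -
  define F where "F n x = (LBINT r:{..x}. M n r)" for n x
  have Fmono: "F n x \<le> F n y" if "x \<le> y" for n x y
    unfolding F_def by (rule cumulative_integral_mono[OF M(1,2) that])
  have Fac: "\<exists>K\<ge>0. \<forall>n x y. x \<le> y \<longrightarrow> F n y - F n x \<le> \<eta> + K * (y - x)" if "\<eta> > 0" for \<eta>
  proof -
    obtain K where K: "K > 0" "C * K powr (1 - p) \<le> \<eta>" using exists_large_powr_small[OF pq(1) C(2) \<open>\<eta> > 0\<close>] by blast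
    show ?thesis
    proof (intro exI[of _ K] conjI allI impI)
      fix n and x y :: real assume "x \<le> y"
      then show "F n y - F n x \<le> \<eta> + K * (y - x)"
        using increment_le_of_powr_bound[OF pq(1) M(1,2) C K(1), of x y n] K(2) by (simp add: F_def)
    qed (use K in simp)
  qed
  have F0: "F n 0 = 0" for n
  proof -
    have "(\<lambda>r. indicator {..0} r *\<^sub>R M n r) = (\<lambda>_. 0)" using M(3) by (auto simp: fun_eq_iff indicator_def)
    then show ?thesis by (simp add: F_def set_lebesgue_integral_def)
  qed
  have zF: "dist (z n s) (z n t) \<le> F n (t + \<epsilon> n) - F n s" if "s \<le> t" for n s t
    unfolding F_def by (rule zM[OF that])
  obtain r w G where r: "strict_mono (r :: nat \<Rightarrow> nat)"
    and w: "\<And>s. limitin X (\<lambda>n. z (r n) s) (w s) sequentially"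
    and G: "\<And>x. (\<lambda>n. F (r n) x) \<longlonglongrightarrow> G x"
    and wG: "\<And>s t. s \<le> t \<Longrightarrow> dist (w s) (w t) \<le> G t - G s"
    using curves_pointwise_compactness[OF X zS zF Fmono Fac F0 \<epsilon>] by metis
  have Gmono: "G x \<le> G y" if "x \<le> y" for x y
    by (rule LIMSEQ_le[OF G G]) (use Fmono that in auto)
  have Gac: "\<exists>K\<ge>0. \<forall>\<delta>>0. \<forall>J::int set. finite J \<longrightarrow>
       (\<Sum>j\<in>J. G ((of_int j + 1) * \<delta>) - G (of_int j * \<delta>)) \<le> \<eta> + K * (real (card J) * \<delta>)" if "\<eta> > 0" for \<eta>
  proof -
    obtain K where K: "K > 0" "C * K powr (1 - p) \<le> \<eta>" using exists_large_powr_small[OF pq(1) C(2) \<open>\<eta> > 0\<close>] by blast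
    show ?thesis
    proof (intro exI[of _ K] conjI allI impI)
      fix \<delta> :: real and J :: "int set" assume d: "0 < \<delta>" and J: "finite J"
      have lim: "(\<lambda>n. \<Sum>j\<in>J. F (r n) ((of_int j + 1) * \<delta>) - F (r n) (of_int j * \<delta>))
          \<longlonglongrightarrow> (\<Sum>j\<in>J. G ((of_int j + 1) * \<delta>) - G (of_int j * \<delta>))"
        by (intro tendsto_sum tendsto_diff G)
      have "(\<Sum>j\<in>J. F (r n) ((of_int j + 1) * \<delta>) - F (r n) (of_int j * \<delta>)) \<le> \<eta> + K * (real (card J) * \<delta>)" for n
        using grid_increments_le_of_powr_bound[OF pq(1) M(1,2) C K(1) J d, of "r n"] K(2) by (simp add: F_def)
      then show "(\<Sum>j\<in>J. G ((of_int j + 1) * \<delta>) - G (of_int j * \<delta>)) \<le> \<eta> + K * (real (card J) * \<delta>)"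
        by (intro LIMSEQ_le_const2[OF lim]) blast
    qed (use K in simp)
  qed
  obtain h where h: "h \<in> borel_measurable borel" "\<And>x. 0 \<le> h x" "\<And>x y. set_integrable lborel {x..y} h"
    "\<And>x y. x \<le> y \<Longrightarrow> G y - G x = (LBINT r:{x..y}. h r)"
    using density_of_absolutely_continuous[of G, OF Gmono Gac] by blast
  have deriv: "AE x in lborel. (G has_real_derivative h x) (at x)"
    by (rule AE_has_derivative_indefinite_integral[OF h(3,4)])
  \<comment> \<open>Cutting the speeds off after \<open>\<tau>\<close> freezes their cumulative integrals at \<open>\<tau>\<close>.\<close>
  have lsc: "(\<integral>\<^sup>+x. ennreal (h x powr p) * indicator {..\<tau>} x \<partial>lborel)
        \<le> liminf (\<lambda>n. \<integral>\<^sup>+x. ennreal (M (r n) x powr p) * indicator {..\<tau>} x \<partial>lborel)" for \<tau>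
  proof -
    have ip: "ennreal ((indicator {..\<tau>} x * a) powr p) = ennreal (a powr p) * indicator {..\<tau>} x" for x a :: real
      by (simp add: indicator_def)
    have "(\<integral>\<^sup>+x. ennreal ((indicator {..\<tau>} x * h x) powr p) \<partial>lborel)
        \<le> liminf (\<lambda>n. \<integral>\<^sup>+x. ennreal ((indicator {..\<tau>} x * M (r n) x) powr p) \<partial>lborel)"
    proof (rule nn_integral_derivative_powr_le_liminf[OF pq])
      show "integrable lborel (\<lambda>x. indicator {..\<tau>} x * M (r n) x)" for n
        using integrable_mult_indicator[OF _ M(1), of "{..\<tau>}" "r n"] by simp
      show "0 \<le> indicator {..\<tau>} x * M (r n) x" for n x using M(2) by simp
      show "(\<lambda>n. LBINT x:{..y}. indicator {..\<tau>} x * M (r n) x) \<longlonglongrightarrow> G (min y \<tau>)" for y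
      proof -
        have "(LBINT x:{..y}. indicator {..\<tau>} x * M (r n) x) = F (r n) (min y \<tau>)" for n
          unfolding F_def set_lebesgue_integral_def
          by (intro Bochner_Integration.integral_cong refl) (auto simp: indicator_def)
        then show ?thesis using G by simp
      qed
      show "AE x in lborel. ((\<lambda>y. G (min y \<tau>)) has_real_derivative indicator {..\<tau>} x * h x) (at x)"
        using deriv AE_lborel_singleton[of \<tau>]
      proof eventually_elim
        case (elim x)
        show ?case
        proof (cases "x < \<tau>")
          case True
          have "((\<lambda>y. G (min y \<tau>)) has_real_derivative h x) (at x)"
            by (rule has_field_derivative_transform_within_open[OF elim(1), of "{..<\<tau>}"]) (use True in auto)
          then show ?thesis using True by simp
        next
          case False
          then have "\<tau> < x" using elim(2) by simp
          have "((\<lambda>y. G (min y \<tau>)) has_real_derivative 0) (at x)"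
            by (rule has_field_derivative_transform_within_open[OF DERIV_const[of "G \<tau>"], of "{\<tau><..}"])
              (use \<open>\<tau> < x\<close> in auto)
          then show ?thesis using \<open>\<tau> < x\<close> by simp
        qed
      qed
    qed
    then show ?thesis by (simp only: ip)
  qed
  show ?thesis
    by (rule that[OF r w h(1,2,3) _ lsc]) (use wG h(4) in auto)
qed

section \<open>Minimizers of the incremental functionals\<close>

text \<open>Sequentially compact sublevels are sequentially closed because limits are unique.\<close>

lemma sublevel_compact_imp_seq_lsc:
  fixes \<phi> :: "'a \<Rightarrow> ereal"
  assumes "Hausdorff_space X" and cpt: "\<And>c::real. seq_compactin X {v. \<phi> v \<le> ereal c}"
    and l: "limitin X w l sequentially"
  shows "\<phi> l \<le> liminf (\<lambda>n. \<phi> (w n))"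
proof (rule ccontr)
  assume "\<not> \<phi> l \<le> liminf (\<lambda>n. \<phi> (w n))"
  then obtain c :: real where c: "liminf (\<lambda>n. \<phi> (w n)) < ereal c" "ereal c < \<phi> l"
    using ereal_dense2 by (metis not_le)
  have "\<not> (\<forall>\<^sub>F n in sequentially. ereal c \<le> \<phi> (w n))"
    using Liminf_bounded[of "ereal c" "\<lambda>n. \<phi> (w n)" sequentially] c(1) by auto
  then have "infinite {n. \<not> ereal c \<le> \<phi> (w n)}"
    by (simp add: cofinite_eq_sequentially[symmetric] eventually_cofinite)
  then obtain r :: "nat \<Rightarrow> nat" where r: "strict_mono r" "\<And>n. \<not> ereal c \<le> \<phi> (w (r n))"
    using infinite_enumerate by blast
  have "l \<in> {v. \<phi> v \<le> ereal c}"
  proof (rule limitin_seq_compactin[OF assms(1) cpt])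
    show "(w \<circ> r) n \<in> {v. \<phi> v \<le> ereal c}" for n using r(2)[of n] by auto
    show "limitin X (w \<circ> r) l sequentially" by (rule limitin_subsequence[OF r(1) l])
  qed
  then show False using c(2) by simp
qed

lemma seq_compactin_subseq:
  assumes "seq_compactin X S" "\<And>n. w n \<in> S"
  obtains l r where "l \<in> S" "strict_mono (r :: nat \<Rightarrow> nat)" "limitin X (\<lambda>n. w (r n)) l sequentially"
  using assms unfolding seq_compactin_def o_def by blast

lemma sublevel_compact_imp_bounded_below:
  fixes \<phi> :: "'a \<Rightarrow> ereal"
  assumes X: "Hausdorff_space X" and cpt: "\<And>c::real. seq_compactin X {v. \<phi> v \<le> ereal c}"
    and ninf: "\<And>v. \<phi> v \<noteq> -\<infinity>"
  obtains B :: real where "\<And>v. ereal B \<le> \<phi> v"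
proof (rule ccontr)
  assume "\<not> thesis"
  then have "\<forall>B::real. \<exists>v. \<phi> v < ereal B" using that by (metis not_le)
  then have "\<forall>n::nat. \<exists>v. \<phi> v < ereal (- real n)" by blast
  then obtain v where v: "\<And>n::nat. \<phi> (v n) < ereal (- real n)" by metis
  have v0: "v n \<in> {v. \<phi> v \<le> ereal 0}" for n
  proof -
    have "ereal (- real n) \<le> ereal 0" by simp
    with v[of n] have "\<phi> (v n) \<le> ereal 0" by (rule order.trans[OF less_imp_le])
    then show ?thesis by simp
  qed
  obtain l r where lr: "strict_mono (r :: nat \<Rightarrow> nat)" "limitin X (\<lambda>n. v (r n)) l sequentially"
    by (rule seq_compactin_subseq[OF cpt[of 0], of v]) (use v0 in auto)
  have "\<phi> l \<le> ereal B" for B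
  proof -
    have "\<phi> l \<le> liminf (\<lambda>n. \<phi> (v (r n)))"
      by (rule sublevel_compact_imp_seq_lsc[OF X cpt lr(2)])
    also have "\<dots> \<le> ereal B"
    proof (rule Liminf_le)
      obtain k :: nat where k: "- B < real k" using reals_Archimedean2 by blast
      show "\<forall>\<^sub>F n in sequentially. \<phi> (v (r n)) \<le> ereal B"
        unfolding eventually_sequentially
      proof (intro exI[of _ k] allI impI)
        fix n assume "k \<le> n"
        then have "real k \<le> real (r n)" using seq_suble[OF lr(1), of n] by linarith
        then have "ereal (- real (r n)) \<le> ereal B" using k by simp
        then show "\<phi> (v (r n)) \<le> ereal B" using v[of "r n"] by (meson less_imp_le order.trans)
      qed
    qed simp
    finally show ?thesis .
  qed
  then have "\<phi> l = -\<infinity>" by (rule ereal_bot)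
  then show False using ninf by blast
qed

text \<open>The direct method. Along a minimizing sequence the distances to \<open>v\<close> are bounded, so they may be
  assumed to converge to some \<open>D\<close>, which is at least the distance of the limit point by compatibility. Then
  the bound on the penalized values becomes a bound on \<open>\<phi>\<close> alone, to which lower semicontinuity applies.\<close>

lemma exists_minimizer_penalized:
  fixes \<phi> :: "'a::metric_space \<Rightarrow> ereal"
  assumes X: "topspace X = UNIV" "Hausdorff_space X" "compatible_topology X"
    and cpt: "\<And>c::real. seq_compactin X {v. \<phi> v \<le> ereal c}"
    and ninf: "\<And>v. \<phi> v \<noteq> -\<infinity>" and v: "\<phi> v < \<infinity>" and c: "c > 0" and p: "p > 0"
  obtains u where "\<And>x. \<phi> u + ereal (c * dist v u powr p) \<le> \<phi> x + ereal (c * dist v x powr p)"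
proof -
  obtain B where B: "\<And>v. ereal B \<le> \<phi> v"
    using sublevel_compact_imp_bounded_below[OF X(2) cpt ninf] by blast
  define \<psi> where "\<psi> x = \<phi> x + ereal (c * dist v x powr p)" for x
  define I where "I = (INF x. \<psi> x)"
  have \<psi>B: "ereal B \<le> \<psi> x" for x
  proof -
    have "ereal B + 0 \<le> \<psi> x" unfolding \<psi>_def using c by (intro add_mono B) simp
    then show ?thesis by simp
  qed
  have I1: "ereal B \<le> I" unfolding I_def by (intro INF_greatest \<psi>B)
  have I2: "I \<le> \<psi> v" unfolding I_def by (intro INF_lower) simp
  have "\<psi> v < \<infinity>" using v by (simp add: \<psi>_def)
  then obtain i where i: "I = ereal i" using I1 I2 by (cases I) auto
  have "\<exists>x. \<psi> x < ereal (i + 1 / real (Suc n))" for n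
  proof -
    have "(INF x. \<psi> x) < ereal (i + 1 / real (Suc n))" using i by (simp add: I_def)
    then show ?thesis unfolding INF_less_iff by blast
  qed
  then obtain x where x: "\<And>n. \<psi> (x n) < ereal (i + 1 / real (Suc n))" by metis
  have fin: "\<exists>f. \<phi> (x n) = ereal f \<and> B \<le> f \<and> f + c * dist v (x n) powr p \<le> i + 1 / real (Suc n)" for n
  proof -
    have "\<psi> (x n) \<noteq> \<infinity>" using x[of n] by auto
    then obtain f where "\<phi> (x n) = ereal f" using B[of "x n"] by (cases "\<phi> (x n)") (auto simp: \<psi>_def)
    then show ?thesis using x[of n] B[of "x n"] by (auto simp: \<psi>_def)
  qed
  then obtain f where f: "\<And>n. \<phi> (x n) = ereal (f n)" "\<And>n. B \<le> f n"
    "\<And>n. f n + c * dist v (x n) powr p \<le> i + 1 / real (Suc n)" by metis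
  have le1: "1 / real (Suc n) \<le> 1" for n by simp
  have fle: "f n \<le> i + 1" for n
  proof -
    have "0 \<le> c * dist v (x n) powr p" using c by simp
    then show ?thesis using f(3)[of n] le1[of n] by linarith
  qed
  have xS: "x n \<in> {v. \<phi> v \<le> ereal (i + 1)}" for n using f(1) fle by simp
  obtain l r where r: "strict_mono r" "limitin X (\<lambda>n. x (r n)) l sequentially"
    by (rule seq_compactin_subseq[OF cpt[of "i + 1"], of x]) (use xS in auto)
  have "dist v (x n) \<le> ((i + 1 - B) / c) powr (1/p)" for n
  proof -
    have "c * dist v (x n) powr p \<le> i + 1 - B"
      using f(2,3)[of n] le1[of n] by linarith
    then have "dist v (x n) powr p \<le> (i + 1 - B) / c"
      using c by (simp add: pos_le_divide_eq mult.commute)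
    then have "(dist v (x n) powr p) powr (1/p) \<le> ((i + 1 - B) / c) powr (1/p)"
      using p by (intro powr_mono2) auto
    then show ?thesis using p by (simp add: powr_powr)
  qed
  then have "bounded (range (\<lambda>n. dist v (x (r n))))" by (auto simp: bounded_iff)
  then obtain D r2 where r2: "strict_mono (r2 :: nat \<Rightarrow> nat)" "((\<lambda>n. dist v (x (r n))) \<circ> r2) \<longlonglongrightarrow> D"
    using bounded_imp_convergent_subsequence by blast
  define y where "y n = x (r (r2 n))" for n
  define s where "s n = r (r2 n)" for n
  have yl: "limitin X y l sequentially"
    using limitin_subsequence[OF r2(1) r(2)] by (simp add: o_def y_def[abs_def])
  have dD: "(\<lambda>n. dist v (y n)) \<longlonglongrightarrow> D" using r2(2) by (simp add: o_def y_def)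
  have "limitin X (\<lambda>n. v) v sequentially" using X(1) by simp
  then have "ereal (dist v l) \<le> liminf (\<lambda>n. ereal (dist v (y n)))"
    using X(3) yl unfolding compatible_topology_def by blast
  also have "\<dots> = ereal D" using dD by (intro lim_imp_Liminf) auto
  finally have dl: "dist v l \<le> D" by simp
  have slim: "filterlim s sequentially sequentially"
    unfolding s_def using r(1) r2(1) by (intro filterlim_compose[OF filterlim_subseq filterlim_subseq])
  have "(\<lambda>n. 1 / real (Suc (s n))) \<longlonglongrightarrow> 0"
    by (rule filterlim_compose[OF LIMSEQ_Suc[OF lim_1_over_n] slim])
  then have "(\<lambda>n. i + 1 / real (Suc (s n)) - c * dist v (y n) powr p) \<longlonglongrightarrow> i + 0 - c * D powr p"
    using p by (intro tendsto_intros dD tendsto_powr2) auto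
  then have lim: "(\<lambda>n. ereal (i + 1 / real (Suc (s n)) - c * dist v (y n) powr p)) \<longlonglongrightarrow> ereal (i - c * D powr p)"
    by (intro tendsto_ereal) simp
  have "\<phi> l \<le> liminf (\<lambda>n. \<phi> (y n))" by (rule sublevel_compact_imp_seq_lsc[OF X(2) cpt yl])
  also have "\<dots> \<le> liminf (\<lambda>n. ereal (i + 1 / real (Suc (s n)) - c * dist v (y n) powr p))"
    using f(3) by (intro Liminf_mono always_eventually allI) (simp add: y_def s_def f(1) algebra_simps)
  also have "\<dots> = ereal (i - c * D powr p)" by (rule lim_imp_Liminf[OF _ lim]) simp
  finally have \<phi>l: "\<phi> l \<le> ereal (i - c * D powr p)" .
  have "c * dist v l powr p \<le> c * D powr p"
    using dl c p by (intro mult_left_mono powr_mono2) auto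
  then have "\<psi> l \<le> ereal (i - c * D powr p) + ereal (c * D powr p)"
    unfolding \<psi>_def by (intro add_mono \<phi>l) simp
  then have "\<psi> l \<le> I" by (simp add: i)
  then have "\<psi> l \<le> \<psi> z" for z unfolding I_def by (meson INF_lower UNIV_I order.trans)
  then show ?thesis using that[of l] unfolding \<psi>_def by blast
qed

lemma powr_diff_le:
  fixes a b p q :: real
  assumes pq: "p > 1" "q > 1" "1/p + 1/q = 1" and ab: "0 \<le> a" "0 \<le> b"
  shows "b powr p - a powr p \<le> p * b powr (p - 1) * (b - a)"
proof -
  have q: "(p - 1) * q = p" using pq by (simp add: field_simps)
  have "b powr (p - 1) * a \<le> a powr p / p + b powr p / q"
    using Youngs_inequality[OF pq ab(1), of "b powr (p - 1)"] by (simp add: powr_powr q mult.commute[of a])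
  then have "p * (b powr (p - 1) * a) \<le> p * (a powr p / p + b powr p / q)"
    using pq by (intro mult_left_mono) auto
  also have "\<dots> = a powr p + p * (1/q) * b powr p" using pq by (simp add: distrib_left)
  also have "1/q = 1 - 1/p" using pq by simp
  also have "p * (1 - 1/p) = p - 1" using pq by (simp add: field_simps)
  finally have "p * (b powr (p - 1) * a) \<le> a powr p + (p - 1) * b powr p" .
  moreover have "b powr p = b powr (p - 1) * b"
    using ab(2) powr_add[of b "p - 1" 1] by (cases "b = 0") auto
  ultimately show ?thesis by (simp add: algebra_simps)
qed

text \<open>Minimality compares \<open>\<phi> u - \<phi> x\<close> with a difference of penalties, and the derivative of the penalty
  along a distance-increasing move is \<open>\<tau>\<^sup>1\<^sup>-\<^sup>p d\<^sup>p\<^sup>-\<^sup>1\<close>.\<close>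

lemma local_slope_penalized_minimizer_le:
  fixes \<phi> :: "'a::metric_space \<Rightarrow> ereal"
  assumes pq: "p > 1" "q > 1" "1/p + 1/q = 1" and \<tau>: "\<tau> > 0" and ninf: "\<And>v. \<phi> v \<noteq> -\<infinity>" and u: "\<phi> u < \<infinity>"
    and min: "\<And>x. \<phi> u + ereal (\<tau> powr (1 - p) / p * dist v u powr p) \<le> \<phi> x + ereal (\<tau> powr (1 - p) / p * dist v x powr p)"
  shows "local_slope \<phi> u \<le> ereal (\<tau> powr (1 - p) * dist v u powr (p - 1))"
proof -
  let ?b = "\<lambda>x. \<tau> powr (1 - p) * (dist v u + dist u x) powr (p - 1)"
  obtain f where f: "\<phi> u = ereal f" using u ninf[of u] by (cases "\<phi> u") auto
  have quot: "max 0 (\<phi> u - \<phi> x) / ereal (dist u x) \<le> ereal (?b x)" if "x \<noteq> u" for x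
  proof (cases "\<phi> x")
    case (real g)
    let ?h = "dist u x"
    have h: "?h > 0" using that by simp
    have "f - g \<le> \<tau> powr (1 - p) / p * (dist v x powr p - dist v u powr p)"
      using min[of x] f real by (simp add: algebra_simps)
    also have "\<dots> \<le> \<tau> powr (1 - p) / p * ((dist v u + ?h) powr p - dist v u powr p)"
      using pq by (intro mult_left_mono diff_right_mono powr_mono2) (auto simp: dist_triangle)
    also have "\<dots> \<le> \<tau> powr (1 - p) / p * (p * (dist v u + ?h) powr (p - 1) * ?h)"
      using powr_diff_le[OF pq, of "dist v u" "dist v u + ?h"] pq by (intro mult_left_mono) auto
    also have "\<dots> = ?b x * ?h" using pq by simp
    finally have "f - g \<le> ?b x * ?h" .
    moreover have "0 \<le> ?b x * ?h" by simp
    ultimately have "max 0 (f - g) / ?h \<le> ?b x" using h by (simp only: pos_divide_le_eq max_def split: if_split) simp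
    then show ?thesis using f real h by (simp add: zero_ereal_def flip: ereal_max)
  next
    case PInf
    then show ?thesis using that f by simp
  next
    case MInf
    then show ?thesis using ninf by simp
  qed
  have "Limsup (at u) (\<lambda>x. max 0 (\<phi> u - \<phi> x) / ereal (dist u x)) \<le> ereal (\<tau> powr (1 - p) * dist v u powr (p - 1))"
  proof (cases "at u = bot")
    case True
    then show ?thesis by simp
  next
    case False
    have "((\<lambda>x. dist u x) \<longlongrightarrow> dist u u) (at u)" by (intro tendsto_intros)
    then have "(?b \<longlongrightarrow> \<tau> powr (1 - p) * (dist v u + dist u u) powr (p - 1)) (at u)"
      using pq by (intro tendsto_intros tendsto_powr2) auto
    then have lim: "((\<lambda>x. ereal (?b x)) \<longlongrightarrow> ereal (\<tau> powr (1 - p) * dist v u powr (p - 1))) (at u)"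
      by (intro tendsto_ereal) simp
    have "Limsup (at u) (\<lambda>x. max 0 (\<phi> u - \<phi> x) / ereal (dist u x)) \<le> Limsup (at u) (\<lambda>x. ereal (?b x))"
      using quot by (intro Limsup_mono) (auto simp: eventually_at intro: exI[of _ 1])
    also have "\<dots> = ereal (\<tau> powr (1 - p) * dist v u powr (p - 1))" by (rule lim_imp_Limsup[OF False lim])
    finally show ?thesis .
  qed
  then show ?thesis using u by (simp add: local_slope_def edom_def)
qed

lemma local_slope_nonneg: "0 \<le> local_slope \<phi> u"
  by (simp add: local_slope_def)

lemma incr_G_real:
  assumes ninf: "\<And>v. \<phi> v \<noteq> -\<infinity>" and "v \<in> edom \<phi>" "u \<in> slope_dom \<phi>"
  shows "incr_G p q \<phi> \<tau> v u = ereal (real_of_ereal (\<phi> u) + \<tau> powr (1 - p) / p * dist v u powr p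
     + \<tau> / q * real_of_ereal (local_slope \<phi> u) powr q - real_of_ereal (\<phi> v))"
proof -
  obtain f where f: "\<phi> u = ereal f" using assms by (cases "\<phi> u") (auto simp: slope_dom_def edom_def)
  obtain g where g: "\<phi> v = ereal g" using assms by (cases "\<phi> v") (auto simp: edom_def)
  obtain s where s: "local_slope \<phi> u = ereal s"
    using assms local_slope_nonneg[of \<phi> u] by (cases "local_slope \<phi> u") (auto simp: slope_dom_def)
  show ?thesis by (simp add: incr_G_def ereal_powr_def f g s)
qed

text \<open>Compare the minimizer \<open>w\<close> of \<open>G\<close> with a minimizer \<open>u\<close> of \<open>E\<close>. Going from \<open>u\<close>
  towards \<open>v\<close> along the curve of generalized convexity cannot lower \<open>E\<close>, which forces \<open>E(u) \<le> - (\<kappa> / p) d\<^sup>p(v, u)\<close>. The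
  slope term of \<open>G(u)\<close> is at most \<open>(1 / q) \<tau>\<^sup>1\<^sup>-\<^sup>p d\<^sup>p(v, u)\<close>. As \<open>1 / q = (p - 1) / p\<close>, it cancels the part
  \<open>(p - 1) \<tau>\<^sup>1\<^sup>-\<^sup>p\<close> of \<open>\<kappa>\<close> exactly, and \<open>G(w) \<le> G(u) \<le> - (lam / p) d\<^sup>p(v, u)\<close> remains. For negative \<open>lam\<close> the
  distance is controlled by \<open>E(u) \<le> E(v) = 0\<close>.\<close>

lemma incr_G_argmin_le:
  fixes \<phi> :: "'a::metric_space \<Rightarrow> ereal"
  assumes pq: "p > 1" "q > 1" "1/p + 1/q = 1"
    and X: "topspace X = UNIV" "Hausdorff_space X" "compatible_topology X"
    and cpt: "\<And>c::real. seq_compactin X {v. \<phi> v \<le> ereal c}"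
    and ninf: "\<And>v. \<phi> v \<noteq> -\<infinity>" and B: "\<And>x. ereal B \<le> \<phi> x"
    and \<tau>: "\<tau> > 0" and v: "v \<in> edom \<phi>"
    and cvx: "gen_geod_convex ((p - 1) * \<tau> powr (1 - p) + lam) p (incr_E p \<phi> \<tau> v)"
    and w: "w \<in> argmin_G p q \<phi> \<tau> v"
  shows "w \<in> slope_dom \<phi>"
    and "incr_G p q \<phi> \<tau> v w \<le> ereal (max 0 (- lam) * \<tau> powr (p - 1) * (real_of_ereal (\<phi> v) - B))"
proof -
  show "w \<in> slope_dom \<phi>" using w by (simp add: argmin_G_def is_arg_min_def)
  have c: "\<tau> powr (1 - p) / p > 0" using \<tau> pq by simp
  obtain u where min: "\<And>x. \<phi> u + ereal (\<tau> powr (1 - p) / p * dist v u powr p) \<le> \<phi> x + ereal (\<tau> powr (1 - p) / p * dist v x powr p)"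
    using exists_minimizer_penalized[OF X cpt ninf _ c, of v p] v pq by (auto simp: edom_def)
  obtain g where g: "\<phi> v = ereal g" using v ninf by (cases "\<phi> v") (auto simp: edom_def)
  have "\<phi> u \<noteq> \<infinity>" using min[of v] g by auto
  then obtain f where f: "\<phi> u = ereal f" using ninf by (cases "\<phi> u") auto
  define D where "D = dist v u powr p"
  define e where "e = f + \<tau> powr (1 - p) / p * D - g"
  have Eu: "incr_E p \<phi> \<tau> v u = ereal e" by (simp add: incr_E_def f g e_def D_def)
  have Ev: "incr_E p \<phi> \<tau> v v = 0" by (simp add: incr_E_def g)
  have Emin: "incr_E p \<phi> \<tau> v u \<le> incr_E p \<phi> \<tau> v x" for x
    using min[of x] unfolding incr_E_def by (intro ereal_minus_mono) (simp_all add: g)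
  have e0: "e \<le> 0" using Emin[of v] Ev Eu by simp
  let ?\<kappa> = "(p - 1) * \<tau> powr (1 - p) + lam"
  have "u \<in> edom (incr_E p \<phi> \<tau> v)" "v \<in> edom (incr_E p \<phi> \<tau> v)" using Eu Ev by (simp_all add: edom_def)
  then obtain \<gamma> where \<gamma>: "\<And>\<theta>. \<theta> \<in> {0..1} \<Longrightarrow> incr_E p \<phi> \<tau> v (\<gamma> \<theta>) \<le> ereal \<theta> * incr_E p \<phi> \<tau> v u + ereal (1 - \<theta>) * incr_E p \<phi> \<tau> v v
            - ereal (?\<kappa> / p * \<theta> * (1 - \<theta>) * dist v u powr p)"
    using cvx unfolding gen_geod_convex_def by blast
  define k where "k = ?\<kappa> / p"
  \<comment> \<open>Convexity between \<open>v\<close> (\<open>\<theta> = 0\<close>) and \<open>u\<close> (\<open>\<theta> = 1\<close>), divided by \<open>1 - \<theta>\<close>.\<close>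
  have th: "e \<le> - (k * \<theta> * D)" if "0 < \<theta>" "\<theta> < 1" for \<theta>
  proof -
    have "ereal e \<le> ereal (\<theta> * e - k * \<theta> * (1 - \<theta>) * D)"
      using order.trans[OF Emin \<gamma>[of \<theta>]] that by (simp add: Eu Ev D_def k_def)
    then have "(1 - \<theta>) * e \<le> (1 - \<theta>) * (- (k * \<theta> * D))" by (simp add: algebra_simps)
    then show ?thesis using that by (simp only: mult_le_cancel_left_pos)
  qed
  have "((\<lambda>\<theta>. - (k * \<theta> * D)) \<longlongrightarrow> - (k * 1 * D)) (at_left 1)"
    by (intro tendsto_intros)
  moreover have "\<forall>\<^sub>F \<theta> in at_left (1::real). e \<le> - (k * \<theta> * D)"
    using th by (auto simp: eventually_at_left_field intro!: exI[of _ 0])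
  ultimately have "e \<le> - (k * 1 * D)"
    by (intro tendsto_lowerbound[where F = "at_left (1::real)"]) auto
  then have eD: "e \<le> - (?\<kappa> / p * D)" by (simp only: k_def mult_1_right)
  have sl: "local_slope \<phi> u \<le> ereal (\<tau> powr (1 - p) * dist v u powr (p - 1))"
    by (rule local_slope_penalized_minimizer_le[OF pq \<tau> ninf _ min]) (simp add: f)
  then obtain s where s: "local_slope \<phi> u = ereal s" "0 \<le> s" "s \<le> \<tau> powr (1 - p) * dist v u powr (p - 1)"
    using local_slope_nonneg[of \<phi> u] by (cases "local_slope \<phi> u") auto
  have q: "(p - 1) * q = p" "(1 - p) * q = - p" using pq by (simp_all add: field_simps)
  have "s powr q \<le> (\<tau> powr (1 - p) * dist v u powr (p - 1)) powr q"
    using s pq by (intro powr_mono2) auto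
  also have "\<dots> = \<tau> powr (- p) * D" by (simp add: powr_mult powr_powr q D_def)
  finally have "\<tau> / q * s powr q \<le> \<tau> / q * (\<tau> powr (- p) * D)" using \<tau> pq by (intro mult_left_mono) auto
  also have "\<dots> = (p - 1) / p * \<tau> powr (1 - p) * D"
  proof -
    have "1 / q = (p - 1) / p" using pq by (simp add: field_simps)
    moreover have "\<tau> * \<tau> powr (- p) = \<tau> powr (1 - p)" using \<tau> powr_add[of \<tau> 1 "-p"] by simp
    ultimately show ?thesis by (metis (no_types, opaque_lifting) mult.assoc mult.commute mult.left_commute mult.right_neutral times_divide_eq_right)
  qed
  finally have sq: "\<tau> / q * s powr q \<le> (p - 1) / p * \<tau> powr (1 - p) * D" .
  have us: "u \<in> slope_dom \<phi>" using f s by (simp add: slope_dom_def edom_def)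
  have "incr_G p q \<phi> \<tau> v w \<le> incr_G p q \<phi> \<tau> v u"
    using w us by (auto simp: argmin_G_def is_arg_min_def not_less)
  also have "\<dots> = ereal (e + \<tau> / q * s powr q)"
    by (simp add: incr_G_real[OF ninf v us] f g s e_def D_def)
  also have "\<dots> \<le> ereal (- lam / p * D)"
  proof -
    have "- (?\<kappa> / p * D) = - lam / p * D - (p - 1) / p * \<tau> powr (1 - p) * D" using pq by (simp add: field_simps)
    with eD sq show ?thesis by simp
  qed
  also have "\<dots> \<le> ereal (max 0 (- lam) * \<tau> powr (p - 1) * (g - B))"
  proof -
    have "f \<ge> B" using B[of u] f by simp
    then have "\<tau> powr (1 - p) / p * D \<le> g - B" using e0 by (simp add: e_def)
    then have *: "\<tau> powr (p - 1) * (\<tau> powr (1 - p) / p * D) \<le> \<tau> powr (p - 1) * (g - B)"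
      by (rule mult_left_mono) simp
    have **: "\<tau> powr (p - 1) * (\<tau> powr (1 - p) / p * D) = D / p"
      using \<tau> by (simp add: mult.assoc[symmetric] powr_add[symmetric])
    have "D / p \<le> \<tau> powr (p - 1) * (g - B)" using * unfolding ** .
    then have "max 0 (- lam) * (D / p) \<le> max 0 (- lam) * (\<tau> powr (p - 1) * (g - B))" by (rule mult_left_mono) simp
    moreover have "- lam / p * D \<le> max 0 (- lam) * (D / p)"
      using mult_right_mono[of "- lam" "max 0 (- lam)" "D / p"] pq by (simp add: D_def)
    ultimately show ?thesis by (simp add: mult.assoc)
  qed
  finally show "incr_G p q \<phi> \<tau> v w \<le> ereal (max 0 (- lam) * \<tau> powr (p - 1) * (real_of_ereal (\<phi> v) - B))"
    by (simp add: g)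
qed

section \<open>Partitions and step functions\<close>

lemma partition_less:
  assumes "is_partition T N t" "i < j" "j \<le> N"
  shows "t i < t j"
  using assms(2,3)
proof (induction j)
  case (Suc j)
  have "t j < t (Suc j)" using assms(1) Suc.prems by (auto simp: is_partition_def dest: bspec[of _ _ "Suc j"])
  then show ?case using Suc by (cases "i = j") auto
qed simp

lemma partition_le:
  assumes "is_partition T N t" "i \<le> j" "j \<le> N"
  shows "t i \<le> t j"
  using partition_less[OF assms(1) _ assms(3), of i] assms(2) by (cases "i = j") auto

lemma partition_cell_unique:
  assumes "is_partition T N t" "i \<in> {1..N}" "j \<in> {1..N}" "x \<in> {t (i-1)<..t i}" "x \<in> {t (j-1)<..t j}"
  shows "i = j"
proof (rule ccontr)
  assume "i \<noteq> j"
  then consider "i \<le> j - 1" "j - 1 \<le> N" | "j \<le> i - 1" "i - 1 \<le> N" using assms(2,3) by fastforce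
  then show False using partition_le[OF assms(1)] assms(4,5) by cases force+
qed

lemma step_le_mesh: "i \<in> {1..N} \<Longrightarrow> step t i \<le> mesh N t"
  unfolding mesh_def by (rule Max_ge) auto

lemma step_pos: "is_partition T N t \<Longrightarrow> i \<in> {1..N} \<Longrightarrow> 0 < step t i"
  by (simp add: is_partition_def step_def)

text \<open>At \<open>s = 0\<close> the interpolant takes the initial value, so the index \<open>0\<close> belongs to that time alone.\<close>

lemma partition_index:
  assumes P: "is_partition T N t" and s: "0 \<le> s" "s \<le> T" "0 < T"
  obtains i where "i \<le> N" "s \<le> t i" "t i \<le> s + mesh N t" "i = 0 \<Longrightarrow> s = 0" "i > 0 \<Longrightarrow> t (i-1) < s"
    "\<And>u. backward_interpolant N t u s = u i"
proof (cases "s = 0")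
  case True
  have "N > 0" using P s(3) by (cases N) (auto simp: is_partition_def)
  then have "0 \<le> mesh N t"
    using step_le_mesh[of 1 N t] step_pos[OF P, of 1] by simp
  then show ?thesis using P True by (intro that[of 0]) (auto simp: is_partition_def backward_interpolant_def)
next
  case False
  define i where "i = (LEAST i. s \<le> t i)"
  have ex: "s \<le> t N" using P s by (simp add: is_partition_def)
  have i1: "s \<le> t i" unfolding i_def by (rule LeastI[of _ N]) (rule ex)
  have i2: "i \<le> N" unfolding i_def by (rule Least_le) (rule ex)
  have i3: "i > 0" using i1 P False s by (cases i) (auto simp: is_partition_def)
  have i4: "t (i - 1) < s"
    using not_less_Least[of "i - 1" "\<lambda>i. s \<le> t i"] i3 unfolding i_def[symmetric] by simp
  have "backward_interpolant N t u s = u i" for u :: "nat \<Rightarrow> 'b"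
  proof -
    have "(THE i. i \<in> {1..N} \<and> s \<in> {t (i - 1)<..t i}) = i"
      using i1 i2 i3 i4 by (intro the_equality) (auto intro!: partition_cell_unique[OF P])
    then show ?thesis using False by (simp add: backward_interpolant_def)
  qed
  moreover have "t i \<le> s + mesh N t"
    using step_le_mesh[of i N t] i2 i3 i4 by (simp add: step_def)
  ultimately show ?thesis using i1 i2 i3 i4 by (intro that[of i]) auto
qed

definition step_function :: "nat \<Rightarrow> (nat \<Rightarrow> real) \<Rightarrow> (nat \<Rightarrow> real) \<Rightarrow> real \<Rightarrow> real" where
  "step_function N t c x = (\<Sum>i=1..N. c i * indicator {t (i-1)<..t i} x)"

lemma step_function_measurable[measurable]: "step_function N t c \<in> borel_measurable borel"
  unfolding step_function_def by measurable

lemma step_function_eq: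
  assumes "is_partition T N t" "i \<in> {1..N}" "x \<in> {t (i-1)<..t i}"
  shows "step_function N t c x = c i"
proof -
  have "x \<notin> {t (j-1)<..t j}" if "j \<in> {1..N}" "j \<noteq> i" for j
    using partition_cell_unique[OF assms(1) assms(2) that(1) assms(3)] that(2) by blast
  then have "step_function N t c x = (\<Sum>j=1..N. if j = i then c i else 0)"
    unfolding step_function_def using assms(3) by (intro sum.cong refl) (auto simp: indicator_def)
  then show ?thesis using assms(2) by simp
qed

lemma step_function_outside:
  assumes "is_partition T N t" "x \<le> 0 \<or> T < x"
  shows "step_function N t c x = 0"
  unfolding step_function_def
proof (intro sum.neutral ballI)
  fix i assume i: "i \<in> {1..N}"
  have "t i \<le> T" "0 \<le> t (i - 1)"
    using partition_le[OF assms(1), of i N] partition_le[OF assms(1), of 0 "i-1"] i assms(1)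
    by (auto simp: is_partition_def)
  then show "c i * indicator {t (i-1)<..t i} x = 0" using assms(2) by (auto simp: indicator_def)
qed

text \<open>The condition \<open>f 0 = 0\<close> accounts for the points outside the partitioned interval.\<close>

lemma step_function_compose:
  assumes "is_partition T N t" "f 0 = 0"
  shows "f (step_function N t c x) = step_function N t (\<lambda>i. f (c i)) x"
proof (cases "\<exists>i\<in>{1..N}. x \<in> {t (i-1)<..t i}")
  case True
  then show ?thesis using step_function_eq[OF assms(1)] by metis
next
  case False
  then have "step_function N t c x = 0" for c
    unfolding step_function_def by (intro sum.neutral) (auto simp: indicator_def)
  then show ?thesis using assms(2) by simp
qed

lemma step_function_truncate:
  assumes "is_partition T N t" "k \<le> N"
  shows "indicator {..t k} x * step_function N t c x = step_function k t c x"
proof -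
  have "indicator {..t k} x * step_function N t c x
     = (\<Sum>i=1..N. indicator {..t k} x * (c i * indicator {t (i-1)<..t i} x))"
    unfolding step_function_def by (rule sum_distrib_left)
  also have "\<dots> = (\<Sum>i=1..k. indicator {..t k} x * (c i * indicator {t (i-1)<..t i} x))"
  proof (rule sum.mono_neutral_right)
    show "\<forall>i\<in>{1..N} - {1..k}. indicator {..t k} x * (c i * indicator {t (i-1)<..t i} x) = 0"
    proof
      fix i assume "i \<in> {1..N} - {1..k}"
      then have "t k \<le> t (i - 1)" using assms by (intro partition_le[OF assms(1)]) auto
      then show "indicator {..t k} x * (c i * indicator {t (i-1)<..t i} x) = 0" by (auto simp: indicator_def)
    qed
  qed (use assms in auto)
  also have "\<dots> = step_function k t c x"
    unfolding step_function_def
  proof (intro sum.cong refl)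
    fix i assume "i \<in> {1..k}"
    then have "t i \<le> t k" using assms by (intro partition_le[OF assms(1)]) auto
    then show "indicator {..t k} x * (c i * indicator {t (i-1)<..t i} x) = c i * indicator {t (i-1)<..t i} x"
      by (auto simp: indicator_def)
  qed
  finally show ?thesis .
qed

lemma step_function_nonneg: "(\<And>i. i \<in> {1..N} \<Longrightarrow> 0 \<le> c i) \<Longrightarrow> 0 \<le> step_function N t c x"
  unfolding step_function_def by (intro sum_nonneg) auto

lemma integrable_indicator_Ioc: "integrable lborel (\<lambda>x. indicator {a<..b} x :: real)" for a b :: real
  by (intro integrable_real_indicator) (cases "a \<le> b"; auto)+

lemma integrable_step_function: "integrable lborel (step_function N t c)"
  unfolding step_function_def
  by (intro Bochner_Integration.integrable_sum integrable_mult_right integrable_indicator_Ioc)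

lemma cumulative_step_function:
  assumes "is_partition T N t" "k \<le> N"
  shows "(LBINT x:{..t k}. step_function N t c x) = (\<Sum>i=1..k. c i * step t i)"
proof -
  have "(LBINT x:{..t k}. step_function N t c x) = (LBINT x. step_function k t c x)"
    by (simp add: set_lebesgue_integral_def step_function_truncate[OF assms])
  also have "\<dots> = (\<Sum>i=1..k. LBINT x. c i * indicator {t (i-1)<..t i} x)"
    unfolding step_function_def
    by (rule Bochner_Integration.integral_sum)
      (intro integrable_mult_right integrable_indicator_Ioc)
  also have "\<dots> = (\<Sum>i=1..k. c i * step t i)"
  proof (intro sum.cong refl)
    fix i assume "i \<in> {1..k}"
    then have "t (i - 1) \<le> t i" using assms by (intro partition_le[OF assms(1)]) auto
    then show "(LBINT x. c i * indicator {t (i-1)<..t i} x) = c i * step t i" by (simp add: step_def)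
  qed
  finally show ?thesis .
qed

lemma nn_integral_step_function:
  assumes "is_partition T N t" "k \<le> N" "\<And>i. i \<in> {1..N} \<Longrightarrow> 0 \<le> c i"
  shows "(\<integral>\<^sup>+x. ennreal (step_function N t c x) * indicator {..t k} x \<partial>lborel) = ennreal (\<Sum>i=1..k. c i * step t i)"
proof -
  have "(\<integral>\<^sup>+x. ennreal (step_function N t c x) * indicator {..t k} x \<partial>lborel) = (\<integral>\<^sup>+x. ennreal (step_function k t c x) \<partial>lborel)"
  proof (rule nn_integral_cong)
    fix x
    show "ennreal (step_function N t c x) * indicator {..t k} x = ennreal (step_function k t c x)"
      using step_function_truncate[OF assms(1,2), of x c] by (auto simp: indicator_def split: if_splits)
  qed
  also have "\<dots> = ennreal (LBINT x. step_function k t c x)"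
    using assms(2,3) by (intro nn_integral_eq_integral integrable_step_function AE_I2 step_function_nonneg) auto
  also have "(LBINT x. step_function k t c x) = (LBINT x:{..t k}. step_function N t c x)"
    by (simp add: set_lebesgue_integral_def step_function_truncate[OF assms(1,2)])
  finally show ?thesis by (simp add: cumulative_step_function[OF assms(1,2)])
qed

text \<open>Since \<open>a\<close> grows at most exponentially, every increment is at most \<open>c\<close> times the length of its step
  times one and the same number.\<close>

lemma discrete_gronwall_sum:
  fixes a g t :: "nat \<Rightarrow> real"
  assumes "t 0 = 0" "c \<ge> 0" "\<And>i. i \<in> {1..N} \<Longrightarrow> t (i-1) \<le> t i"
    and a: "\<And>i. i \<le> N \<Longrightarrow> 0 \<le> a i" "\<And>i. i \<in> {1..N} \<Longrightarrow> a i \<le> a (i-1) + g i"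
    and g: "\<And>i. i \<in> {1..N} \<Longrightarrow> g i \<le> c * (t i - t (i-1)) * a (i-1)"
  shows "(\<Sum>i=1..N. g i) \<le> c * t N * (a 0 * exp (c * t N))"
proof -
  have tm: "t i \<le> t j" if "i \<le> j" "j \<le> N" for i j
    using that
  proof (induction j)
    case (Suc j)
    have "t j \<le> t (Suc j)" using assms(3)[of "Suc j"] Suc.prems by simp
    then show ?case using Suc by (cases "i = Suc j") auto
  qed simp
  have ai: "a i \<le> a 0 * exp (c * t i)" if "i \<le> N" for i
    using that
  proof (induction i)
    case 0
    then show ?case using assms(1) by simp
  next
    case (Suc i)
    let ?d = "c * (t (Suc i) - t i)"
    have "a (Suc i) \<le> a i * (1 + ?d)" using a(2)[of "Suc i"] g[of "Suc i"] Suc.prems by (simp add: algebra_simps)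
    also have "\<dots> \<le> a i * exp ?d" using exp_ge_add_one_self[of ?d] a(1)[of i] Suc.prems by (intro mult_left_mono) auto
    also have "\<dots> \<le> a 0 * exp (c * t i) * exp ?d" using Suc by (intro mult_right_mono) auto
    also have "\<dots> = a 0 * exp (c * t (Suc i))" by (simp add: mult.assoc exp_add[symmetric] algebra_simps)
    finally show ?case .
  qed
  have "(\<Sum>i=1..N. g i) \<le> (\<Sum>i=1..N. (c * (a 0 * exp (c * t N))) * (t i - t (i-1)))"
  proof (rule sum_mono)
    fix i assume i: "i \<in> {1..N}"
    have "a (i-1) \<le> a 0 * exp (c * t (i-1))" using i by (intro ai) auto
    also have "\<dots> \<le> a 0 * exp (c * t N)"
      using a(1)[of 0] assms(2) tm[of "i-1" N] i by (intro mult_left_mono) (auto intro: mult_left_mono)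
    finally have "c * (t i - t (i-1)) * a (i-1) \<le> c * (t i - t (i-1)) * (a 0 * exp (c * t N))"
      using assms(2) assms(3)[OF i] by (intro mult_left_mono) auto
    with g[OF i] show "g i \<le> (c * (a 0 * exp (c * t N))) * (t i - t (i-1))" by (simp add: algebra_simps)
  qed
  also have "\<dots> = (c * (a 0 * exp (c * t N))) * (\<Sum>i=1..N. t i - t (i-1))" by (rule sum_distrib_left[symmetric])
  also have "(\<Sum>i=1..N. t i - t (i-1)) = t N"
    using sum_telescope''[of 0 N t] assms(1) by (simp add: atLeastSucAtMost_greaterThanAtMost)
  finally show ?thesis by (simp add: algebra_simps)
qed

section \<open>Estimates along the scheme\<close>

text \<open>Summing the one-step estimates. If \<open>lam\<close> is negative then \<open>p > 2\<close>, and \<open>\<tau>\<^sup>p\<^sup>-\<^sup>1\<close> is at most the small factor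
  \<open>mesh\<^sup>p\<^sup>-\<^sup>2\<close> times \<open>\<tau>\<close>, so the Gronwall argument applies with a constant that vanishes with the mesh. If
  \<open>lam\<close> is nonnegative the constant \<open>K\<close> is zero. The definition of \<open>G\<close>, summed over the steps, turns the
  bound on the positive parts into an approximate energy inequality.\<close>

lemma scheme_estimates:
  fixes \<phi> :: "'a::metric_space \<Rightarrow> ereal"
  assumes pq: "p > 1" "q > 1" "1/p + 1/q = 1" and T: "T > 0"
    and X: "topspace X = UNIV" "Hausdorff_space X" "compatible_topology X"
    and cpt: "\<And>c::real. seq_compactin X {v. \<phi> v \<le> ereal c}"
    and ninf: "\<And>v. \<phi> v \<noteq> -\<infinity>" and B: "\<And>x. ereal B \<le> \<phi> x" and u0: "u0 \<in> edom \<phi>"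
    and cvx: "\<And>\<tau> v. 0 < \<tau> \<Longrightarrow> \<tau> < \<tau>s \<Longrightarrow> v \<in> edom \<phi> \<Longrightarrow>
           gen_geod_convex ((p - 1) * \<tau> powr (1 - p) + lam) p (incr_E p \<phi> \<tau> v)"
    and lam: "lam \<ge> 0 \<or> p > 2"
    and P: "is_partition T N t" and mesh: "mesh N t < \<tau>s"
    and sol: "scheme_solution p q \<phi> u0 N t u"
  defines "K \<equiv> max 0 (- lam) * mesh N t powr (p - 2) * T"
  shows "\<And>i. i \<le> N \<Longrightarrow> u i \<in> edom \<phi>"
    and "\<And>i. i \<in> {1..N} \<Longrightarrow> u i \<in> slope_dom \<phi>"
    and "\<exists>\<rho>\<ge>0. (\<Sum>i=1..N. max 0 (incr_G p q \<phi> (step t i) (u (i - 1)) (u i))) = ereal \<rho> \<and>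
      \<rho> \<le> K * ((real_of_ereal (\<phi> u0) - B) * exp K) \<and>
      (\<forall>k\<le>N. real_of_ereal (\<phi> (u k)) + (1/p) * (\<Sum>i=1..k. (dist (u (i-1)) (u i) / step t i) powr p * step t i)
         + (1/q) * (\<Sum>i=1..k. real_of_ereal (local_slope \<phi> (u i)) powr q * step t i)
         \<le> real_of_ereal (\<phi> u0) + \<rho>)" (is ?bound)
proof -
  have u_0: "u 0 = u0" and arg: "\<And>i. i \<in> {1..N} \<Longrightarrow> u i \<in> argmin_G p q \<phi> (step t i) (u (i - 1))"
    using sol by (auto simp: scheme_solution_def)
  have sd: "u i \<in> slope_dom \<phi>" if "i \<in> {1..N}" for i
    using arg[OF that] by (simp add: argmin_G_def is_arg_min_def)
  then show "u i \<in> slope_dom \<phi>" if "i \<in> {1..N}" for i using that by blast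
  have ed: "u i \<in> edom \<phi>" if "i \<le> N" for i
    using sd[of i] that u0 u_0 by (cases "i = 0") (auto simp: slope_dom_def)
  show "u i \<in> edom \<phi>" if "i \<le> N" for i by (rule ed[OF that])
  define f where "f i = real_of_ereal (\<phi> (u i))" for i
  define g where "g i = f i + step t i powr (1 - p) / p * dist (u (i-1)) (u i) powr p
     + step t i / q * real_of_ereal (local_slope \<phi> (u i)) powr q - f (i - 1)" for i
  have f: "\<phi> (u i) = ereal (f i)" "B \<le> f i" if "i \<le> N" for i
    using ed[OF that] ninf[of "u i"] B[of "u i"] by (cases "\<phi> (u i)"; auto simp: f_def edom_def)+
  have G: "incr_G p q \<phi> (step t i) (u (i-1)) (u i) = ereal (g i)" if "i \<in> {1..N}" for i
    unfolding g_def f_def using that by (intro incr_G_real ninf ed sd) auto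
  define L where "L = max 0 (- lam)"
  define c where "c = L * mesh N t powr (p - 2)"
  have c0: "c \<ge> 0" by (simp add: c_def L_def)
  have gle: "max 0 (g i) \<le> c * (t i - t (i-1)) * (f (i-1) - B)" if i: "i \<in> {1..N}" for i
  proof -
    have tp: "0 < step t i" "step t i \<le> mesh N t" using step_pos[OF P i] step_le_mesh[OF i] by auto
    have i': "i - 1 \<le> N" using i by auto
    have "ereal (g i) \<le> ereal (L * step t i powr (p - 1) * (f (i-1) - B))"
      unfolding G[OF i, symmetric] L_def f_def
      using tp mesh by (intro incr_G_argmin_le(2)[OF pq X cpt ninf B tp(1) ed[OF i'] cvx arg[OF i]] ed i') auto
    then have 1: "g i \<le> L * step t i powr (p - 1) * (f (i-1) - B)" by simp
    have "L * step t i powr (p - 1) \<le> c * step t i"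
    proof (cases "L = 0")
      case True
      then show ?thesis by (simp add: c_def)
    next
      case False
      then have "p > 2" using lam by (auto simp: L_def)
      have "step t i powr (p - 1) = step t i powr (p - 2) * step t i"
        using tp powr_add[of "step t i" "p - 2" 1] by simp
      also have "\<dots> \<le> mesh N t powr (p - 2) * step t i"
        using tp \<open>p > 2\<close> by (intro mult_right_mono powr_mono2) auto
      finally show ?thesis by (simp add: c_def L_def mult.assoc mult_left_mono)
    qed
    then have "L * step t i powr (p - 1) * (f (i-1) - B) \<le> c * step t i * (f (i-1) - B)"
      using f(2)[OF i'] by (intro mult_right_mono) auto
    with 1 have "g i \<le> c * step t i * (f (i-1) - B)" by simp
    moreover have "0 \<le> c * step t i * (f (i-1) - B)"
      using c0 tp f(2)[OF i'] by simp
    ultimately show ?thesis by (simp add: step_def)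
  qed
  have flow: "f i + step t i powr (1 - p) / p * dist (u (i-1)) (u i) powr p
     + step t i / q * real_of_ereal (local_slope \<phi> (u i)) powr q \<le> f (i - 1) + max 0 (g i)" if "i \<in> {1..N}" for i
    by (simp add: g_def)
  have aflow: "f i - B \<le> f (i - 1) - B + max 0 (g i)" if i: "i \<in> {1..N}" for i
  proof -
    have "0 \<le> step t i powr (1 - p) / p * dist (u (i-1)) (u i) powr p"
      "0 \<le> step t i / q * real_of_ereal (local_slope \<phi> (u i)) powr q"
      using pq step_pos[OF P i] by auto
    with flow[OF i] show ?thesis by linarith
  qed
  define \<rho> where "\<rho> = (\<Sum>i=1..N. max 0 (g i))"
  have t0N: "t 0 = 0" "t N = T" using P by (auto simp: is_partition_def)
  have "\<rho> \<le> c * t N * ((f 0 - B) * exp (c * t N))"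
    unfolding \<rho>_def
  proof (rule discrete_gronwall_sum[where a = "\<lambda>i. f i - B"])
    show "t (i-1) \<le> t i" if "i \<in> {1..N}" for i using step_pos[OF P that] by (simp add: step_def)
  qed (use t0N c0 f gle aflow in auto)
  then have "\<rho> \<le> K * ((real_of_ereal (\<phi> u0) - B) * exp K)"
    by (simp add: K_def c_def L_def t0N f_def u_0)
  moreover have "\<rho> \<ge> 0" unfolding \<rho>_def by (intro sum_nonneg) simp
  moreover have "(\<Sum>i=1..N. max 0 (incr_G p q \<phi> (step t i) (u (i - 1)) (u i))) = ereal \<rho>"
  proof -
    have "(\<Sum>i=1..N. max 0 (incr_G p q \<phi> (step t i) (u (i - 1)) (u i))) = (\<Sum>i=1..N. ereal (max 0 (g i)))"
    proof (intro sum.cong refl)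
      fix i assume i: "i \<in> {1..N}"
      show "max 0 (incr_G p q \<phi> (step t i) (u (i - 1)) (u i)) = ereal (max 0 (g i))"
        unfolding G[OF i] by (simp add: zero_ereal_def)
    qed
    also have "\<dots> = ereal \<rho>" unfolding \<rho>_def by (rule sum_ereal)
    finally show ?thesis .
  qed
  moreover let ?E = "\<lambda>k. f k + (1/p) * (\<Sum>i=1..k. (dist (u (i-1)) (u i) / step t i) powr p * step t i)
         + (1/q) * (\<Sum>i=1..k. real_of_ereal (local_slope \<phi> (u i)) powr q * step t i)"
  have "?E k
         \<le> f 0 + \<rho>" if k: "k \<le> N" for k
  proof -
    have "?E k
         \<le> f 0 + (\<Sum>i=1..k. max 0 (g i))"
      using k
    proof (induction k)
      case (Suc k)
      have i: "Suc k \<in> {1..N}" using Suc.prems by simp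
      have tp: "0 < step t (Suc k)" by (rule step_pos[OF P i])
      have "(dist (u k) (u (Suc k)) / step t (Suc k)) powr p * step t (Suc k)
         = step t (Suc k) powr (1 - p) * dist (u k) (u (Suc k)) powr p"
        using tp powr_diff[of "step t (Suc k)" 1 p] by (simp add: powr_divide)
      then have e1: "(1/p) * ((dist (u k) (u (Suc k)) / step t (Suc k)) powr p * step t (Suc k))
         = step t (Suc k) powr (1 - p) / p * dist (u k) (u (Suc k)) powr p" by simp
      have e2: "(1/q) * (real_of_ereal (local_slope \<phi> (u (Suc k))) powr q * step t (Suc k))
         = step t (Suc k) / q * real_of_ereal (local_slope \<phi> (u (Suc k))) powr q" by simp
      have IH: "?E k
         \<le> f 0 + (\<Sum>i=1..k. max 0 (g i))"
        using Suc by simp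
      have split: "(\<Sum>i=1..Suc k. X i) = (\<Sum>i=1..k. X i) + X (Suc k)" for X :: "nat \<Rightarrow> real" by simp
      show ?case
        unfolding split distrib_left diff_Suc_1 e1 e2 using IH flow[OF i, unfolded diff_Suc_1] by linarith
    qed simp
    also have "(\<Sum>i=1..k. max 0 (g i)) \<le> \<rho>"
      unfolding \<rho>_def using k by (intro sum_mono2) auto
    finally show ?thesis by simp
  qed
  ultimately show ?bound
    unfolding f_def u_0 by blast
qed

section \<open>Lower limits of extended nonnegative numbers\<close>

text \<open>This is Fatou's lemma for the counting measure on two points.\<close>

lemma liminf_add_le_ennreal:
  fixes f g :: "nat \<Rightarrow> ennreal"
  shows "liminf f + liminf g \<le> liminf (\<lambda>n. f n + g n)"
proof -
  have "(\<integral>\<^sup>+b. liminf (\<lambda>n. if b then f n else g n) \<partial>count_space UNIV)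
      \<le> liminf (\<lambda>n. \<integral>\<^sup>+b. (if b then f n else g n) \<partial>count_space UNIV)"
    by (rule nn_integral_liminf) simp
  then show ?thesis by (simp add: nn_integral_count_space_finite UNIV_bool add.commute)
qed

lemma cmult_liminf_le:
  fixes f :: "nat \<Rightarrow> ennreal"
  assumes "c < \<infinity>"
  shows "c * liminf f \<le> liminf (\<lambda>n. c * f n)"
proof -
  have "liminf (\<lambda>n. c * f n) = c * liminf f"
    using assms by (intro Liminf_compose_continuous_mono ennreal_continuous_on_cmult continuous_on_id)
      (auto intro!: monoI mult_left_mono)
  then show ?thesis by simp
qed

lemma ereal_liminf_minus_const:
  assumes "ereal a \<le> liminf (\<lambda>n. ereal (f n))"
  shows "ereal (a - B) \<le> liminf (\<lambda>n. ereal (f n - B))"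
  unfolding le_Liminf_iff
proof (intro allI impI)
  fix y assume y: "y < ereal (a - B)"
  show "\<forall>\<^sub>F n in sequentially. y < ereal (f n - B)"
  proof (cases y)
    case (real y')
    then have "ereal (y' + B) < ereal a" using y by simp
    then have "\<forall>\<^sub>F n in sequentially. ereal (y' + B) < ereal (f n)"
      using assms unfolding le_Liminf_iff by blast
    then show ?thesis by eventually_elim (simp add: real less_diff_eq)
  qed (use y in auto)
qed

text \<open>A continuous increasing function may be moved into a lower limit; the case \<open>q = 1\<close> also serves to
  pass from extended reals to extended nonnegative reals.\<close>

lemma e2ennreal_powr_le_liminf:
  fixes L :: ereal and s :: "nat \<Rightarrow> real"
  assumes q: "q > 0" and L: "L \<ge> 0" and s: "\<And>n. s n \<ge> 0" and le: "L \<le> liminf (\<lambda>n. ereal (s n))"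
  shows "e2ennreal (ereal_powr L q) \<le> liminf (\<lambda>n. ennreal (s n powr q))"
  unfolding le_Liminf_iff
proof (intro allI impI)
  fix y assume y: "y < e2ennreal (ereal_powr L q)"
  then have "y < \<infinity>" by (metis less_top top.not_eq_extremum infinity_ennreal_def not_less_iff_gr_or_eq top_greatest leD)
  then obtain y' where y': "y = ennreal y'" "0 \<le> y'" by (cases y) auto
  have "ereal (y' powr (1/q)) < L"
  proof (cases L)
    case (real l)
    then have "ennreal y' < ennreal (l powr q)" using y y' by (simp add: ereal_powr_def flip: ennreal.abs_eq)
    then have "y' < l powr q" using y'(2) by (simp add: ennreal_less_iff)
    then have "y' powr (1/q) < (l powr q) powr (1/q)" using q y'(2) by (intro powr_less_mono2) auto
    also have "\<dots> = l" using q L real by (simp add: powr_powr)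
    finally show ?thesis using real by simp
  qed (use L in auto)
  with le have "\<forall>\<^sub>F n in sequentially. ereal (y' powr (1/q)) < ereal (s n)"
    unfolding le_Liminf_iff by blast
  then show "\<forall>\<^sub>F n in sequentially. y < ennreal (s n powr q)"
  proof eventually_elim
    case (elim n)
    then have "(y' powr (1/q)) powr q < s n powr q" using q by (intro powr_less_mono2) auto
    moreover have "(y' powr (1/q)) powr q = y'" using q y'(2) by (simp add: powr_powr)
    ultimately show ?case using y' by (simp add: ennreal_less_iff)
  qed
qed

section \<open>Curves of maximal slope from the energy inequality\<close>

lemma test_function_deriv:
  assumes "test_function T \<psi>"
  shows "(\<psi> has_real_derivative deriv \<psi> x) (at x)" "isCont (deriv \<psi>) x"
    "x \<le> 0 \<or> T \<le> x \<Longrightarrow> \<psi> x = 0"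
proof -
  have d: "(deriv ^^ k) \<psi> differentiable (at x)" for k x using assms by (simp add: test_function_def)
  show "(\<psi> has_real_derivative deriv \<psi> x) (at x)"
    using d[of 0 x] by (simp add: DERIV_deriv_iff_real_differentiable)
  show "isCont (deriv \<psi>) x"
    using d[of 1 x] by (simp add: differentiable_imp_continuous_within)
  show "x \<le> 0 \<or> T \<le> x \<Longrightarrow> \<psi> x = 0"
    using assms unfolding test_function_def by fastforce
qed

text \<open>Integration by parts against a test function, obtained from Fubini's theorem for the product
  \<open>\<psi>' x \<cdot> g r\<close> on the triangle \<open>r \<le> x\<close>; the weak derivative is \<open>- g\<close>.\<close>

lemma W11_indefinite_integral:
  fixes f g :: "real \<Rightarrow> real"
  assumes T: "T > 0" and g: "integrable lborel g" "\<And>r. 0 \<le> g r"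
    and f: "\<And>x. x \<in> {0<..<T} \<Longrightarrow> f x = c - (LBINT r:{..x}. g r)"
  shows "W11 T f"
proof -
  have gm[measurable]: "g \<in> borel_measurable borel" using g(1) by auto
  define G where "G x = (LBINT r:{..x}. g r)" for x
  have Gm[measurable]: "G \<in> borel_measurable borel"
    unfolding G_def by (intro borel_measurable_mono monoI cumulative_integral_mono g)
  have gsi: "set_integrable lborel A g" if "A \<in> sets borel" for A
    by (rule integrable_imp_set_integrable[OF g(1) that])
  have Gb: "\<bar>G x\<bar> \<le> (LBINT r. g r)" for x
  proof -
    have "0 \<le> G x" unfolding G_def set_lebesgue_integral_def
      by (rule Bochner_Integration.integral_nonneg) (simp add: g(2))
    moreover have "G x \<le> (LBINT r. g r)" unfolding G_def set_lebesgue_integral_def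
      using gsi[of "{..x}"] by (intro integral_mono g(1)) (auto simp: set_integrable_def g(2) indicator_def)
    ultimately show ?thesis by simp
  qed
  have ind: "integrable lborel (\<lambda>x. indicator {0<..<T} x :: real)" using T by (intro integrable_real_indicator) auto
  have fint: "set_integrable lborel {0<..<T} f"
  proof -
    have "integrable lborel (\<lambda>x. indicator {0<..<T} x * (c - G x))"
    proof (rule Bochner_Integration.integrable_bound)
      show "integrable lborel (\<lambda>x. indicator {0<..<T} x * (\<bar>c\<bar> + (LBINT r. g r)))"
        using ind by (rule integrable_mult_left)
      show "AE x in lborel. norm (indicator {0<..<T} x * (c - G x)) \<le> norm (indicator {0<..<T} x * (\<bar>c\<bar> + (LBINT r. g r)))"
        using Gb by (intro AE_I2) (auto simp: indicator_def abs_if split: if_splits; smt (verit))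
    qed simp
    also have "(\<lambda>x. indicator {0<..<T} x * (c - G x)) = (\<lambda>x. indicator {0<..<T} x *\<^sub>R f x)"
      by (auto simp: fun_eq_iff indicator_def f G_def)
    finally show ?thesis by (simp add: set_integrable_def)
  qed
  have weak: "(LBINT x:{0<..<T}. f x * deriv \<psi> x) = - (LBINT x:{0<..<T}. (- g x) * \<psi> x)"
    if \<psi>: "test_function T \<psi>" for \<psi>
  proof -
    note d = test_function_deriv[OF \<psi>]
    have cont: "continuous_on UNIV (deriv \<psi>)" using d(2) by (simp add: continuous_at_imp_continuous_on)
    have dm[measurable]: "deriv \<psi> \<in> borel_measurable borel" by (rule borel_measurable_continuous_onI[OF cont])
    have "bounded (deriv \<psi> ` {0..T})"
      by (intro compact_imp_bounded compact_continuous_image continuous_on_subset[OF cont]) auto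
    then obtain D where "\<forall>x\<in>{0..T}. \<bar>deriv \<psi> x\<bar> \<le> D" by (auto simp: bounded_iff)
    then have D: "\<bar>deriv \<psi> x\<bar> \<le> D" if "x \<in> {0..T}" for x using that by blast
    have D0: "0 \<le> D" using D[of 0] T by simp
    have FTC: "(LBINT x. deriv \<psi> x * indicator {r..T} x) = \<psi> T - \<psi> r" if "r \<le> T" for r
      using that by (intro integral_FTC_Icc_real) (auto intro: d)
    define \<Psi> where "\<Psi> x = deriv \<psi> x * indicator {0..T} x" for x
    have \<Psi>m[measurable]: "\<Psi> \<in> borel_measurable borel" unfolding \<Psi>_def by measurable
    have \<Psi>i: "integrable lborel \<Psi>"
    proof (rule Bochner_Integration.integrable_bound)
      show "integrable lborel (\<lambda>x. indicator {0..T} x * D)" using T by (intro integrable_mult_left integrable_real_indicator) auto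
      show "AE x in lborel. norm (\<Psi> x) \<le> norm (indicator {0..T} x * D)"
        using D D0 by (intro AE_I2) (auto simp: \<Psi>_def indicator_def)
    qed simp
    have tail: "(LBINT x. \<Psi> x * indicator {r..} x) = - \<psi> r" if "r \<in> {0..T}" for r
    proof -
      have "(\<lambda>x. \<Psi> x * indicator {r..} x) = (\<lambda>x. deriv \<psi> x * indicator {r..T} x)"
        using that by (auto simp: \<Psi>_def indicator_def fun_eq_iff)
      then show ?thesis using FTC[of r] that d(3)[of T] by simp
    qed
    define k where "k = (\<lambda>(x, r). \<Psi> x * g r * indicator {z. snd z \<le> fst z} (x, r :: real))"
    have S[measurable]: "{z. snd z \<le> (fst z :: real)} \<in> sets (borel \<Otimes>\<^sub>M borel)"
    proof -
      have "{z \<in> space (borel \<Otimes>\<^sub>M borel). snd z \<le> (fst z :: real)} \<in> sets (borel \<Otimes>\<^sub>M borel)" by measurable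
      then show ?thesis by (simp add: space_pair_measure)
    qed
    have km[measurable]: "k \<in> borel_measurable (lborel \<Otimes>\<^sub>M lborel)"
      unfolding k_def case_prod_beta by measurable
    have prodi: "integrable (lborel \<Otimes>\<^sub>M lborel) (\<lambda>(x, r). \<Psi> x * g r)"
    proof (rule lborel_pair.Fubini_integrable)
      show "(\<lambda>(x, r). \<Psi> x * g r) \<in> borel_measurable (lborel \<Otimes>\<^sub>M lborel)"
        unfolding case_prod_beta by measurable
      show "integrable lborel (\<lambda>x. LINT y|lborel. norm (case (x, y) of (x, r) \<Rightarrow> \<Psi> x * g r))"
        using \<Psi>i by (simp add: abs_mult)
      show "AE x in lborel. integrable lborel (\<lambda>y. case (x, y) of (x, r) \<Rightarrow> \<Psi> x * g r)"
        using g(1) by simp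
    qed
    have ki: "integrable (lborel \<Otimes>\<^sub>M lborel) k"
      by (rule Bochner_Integration.integrable_bound[OF prodi km])
        (auto intro!: AE_I2 simp: k_def indicator_def)
    \<comment> \<open>The inner integral in \<open>x\<close> is \<open>- \<psi> r\<close> for nonnegative \<open>r\<close>, because \<open>\<psi>\<close> vanishes at \<open>T\<close>.\<close>
    have swap: "(LBINT x. LBINT r. k (x, r)) = (LBINT r. LBINT x. k (x, r))"
      using lborel_pair.Fubini_integral[of "\<lambda>x r. k (x, r)"] ki by simp
    have inner1: "(LBINT r. k (x, r)) = \<Psi> x * G x" for x
    proof -
      have "(LBINT r. k (x, r)) = (LBINT r. \<Psi> x * (indicator {..x} r *\<^sub>R g r))"
        by (intro Bochner_Integration.integral_cong) (auto simp: k_def indicator_def)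
      then show ?thesis by (simp add: G_def set_lebesgue_integral_def)
    qed
    have inner2: "(LBINT x. k (x, r)) = g r * (if r < 0 then 0 else - \<psi> r)" for r
    proof -
      have "(LBINT x. k (x, r)) = (LBINT x. g r * (\<Psi> x * indicator {r..} x))"
        by (intro Bochner_Integration.integral_cong) (auto simp: k_def indicator_def)
      also have "\<dots> = g r * (LBINT x. \<Psi> x * indicator {r..} x)" by simp
      also have "(LBINT x. \<Psi> x * indicator {r..} x) = (if r < 0 then 0 else - \<psi> r)"
      proof (cases "r \<le> T")
        case True
        show ?thesis
        proof (cases "r < 0")
          case True
          then have "(\<lambda>x. \<Psi> x * indicator {r..} x) = (\<lambda>x. \<Psi> x * indicator {0..} x)"
            by (auto simp: \<Psi>_def indicator_def fun_eq_iff)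
          then show ?thesis using tail[of 0] True T d(3)[of 0] by simp
        next
          case False
          then show ?thesis using tail[of r] True by simp
        qed
      next
        case False
        then have "(\<lambda>x. \<Psi> x * indicator {r..} x) = (\<lambda>x. 0)"
          by (auto simp: \<Psi>_def indicator_def fun_eq_iff)
        then show ?thesis using False d(3)[of r] by simp
      qed
      finally show ?thesis .
    qed
    have AEio: "AE x in lborel. x \<noteq> 0 \<and> x \<noteq> T"
      using AE_lborel_singleton[of 0] AE_lborel_singleton[of T] by eventually_elim simp
    have "(LBINT x:{0<..<T}. f x * deriv \<psi> x) = (LBINT x. c * \<Psi> x - \<Psi> x * G x)"
      unfolding set_lebesgue_integral_def
    proof (rule integral_cong_AE)
      have "(\<lambda>x. indicator {0<..<T} x *\<^sub>R (f x * deriv \<psi> x)) = (\<lambda>x. (indicator {0<..<T} x *\<^sub>R f x) * deriv \<psi> x)"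
        by (simp add: fun_eq_iff)
      moreover have "(\<lambda>x. (indicator {0<..<T} x *\<^sub>R f x)) \<in> borel_measurable lborel"
        using fint unfolding set_integrable_def by (rule borel_measurable_integrable)
      ultimately show "(\<lambda>x. indicator {0<..<T} x *\<^sub>R (f x * deriv \<psi> x)) \<in> borel_measurable lborel" by simp
      show "AE x in lborel. indicator {0<..<T} x *\<^sub>R (f x * deriv \<psi> x) = c * \<Psi> x - \<Psi> x * G x"
        using AEio by eventually_elim (auto simp: indicator_def \<Psi>_def f G_def algebra_simps)
    qed simp
    also have "\<dots> = (LBINT x. c * \<Psi> x) - (LBINT x. \<Psi> x * G x)"
    proof (rule Bochner_Integration.integral_diff)
      show "integrable lborel (\<lambda>x. \<Psi> x * G x)"
        using lborel_pair.integrable_fst[of "\<lambda>x r. k (x, r)"] ki by (simp add: inner1)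
    qed (simp add: \<Psi>i)
    also have "(LBINT x. c * \<Psi> x) = c * (LBINT x. \<Psi> x * indicator {0..} x)"
    proof -
      have "(\<lambda>x. \<Psi> x * indicator {0..} x) = \<Psi>" by (auto simp: \<Psi>_def indicator_def fun_eq_iff)
      then show ?thesis by simp
    qed
    also have "\<dots> = 0" using tail[of 0] T d(3)[of 0] by simp
    also have "(LBINT x. \<Psi> x * G x) = (LBINT r. g r * (if r < 0 then 0 else - \<psi> r))"
      using swap by (simp only: inner1 inner2)
    also have "(\<lambda>r. g r * (if r < 0 then 0 else - \<psi> r)) = (\<lambda>r. indicator {0<..<T} r *\<^sub>R ((- g r) * \<psi> r))"
    proof
      fix r
      show "g r * (if r < 0 then 0 else - \<psi> r) = indicator {0<..<T} r *\<^sub>R ((- g r) * \<psi> r)"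
      proof (cases "r \<le> 0 \<or> T \<le> r")
        case True
        then show ?thesis using d(3)[OF True] by (auto simp: indicator_def)
      qed (auto simp: indicator_def)
    qed
    finally show ?thesis by (simp add: set_lebesgue_integral_def)
  qed
  have "set_integrable lborel {0<..<T} (\<lambda>x. - g x)"
    using gsi[of "{0<..<T}"] by (simp add: set_integrable_def)
  with fint weak show ?thesis unfolding W11_def by blast
qed

lemma measurable_e2ennreal_ereal_powr[measurable]: "(\<lambda>x. e2ennreal (ereal_powr x q)) \<in> borel_measurable borel"
proof -
  have "{x \<in> space borel. x = (\<infinity>::ereal)} \<in> sets borel" by simp
  then have "(\<lambda>x. ereal_powr x q) \<in> borel_measurable borel"
    unfolding ereal_powr_def by (intro measurable_If) auto
  then show ?thesis by measurable
qed

text \<open>Young's inequality with a possibly infinite slope.\<close>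

lemma slope_speed_Young:
  assumes pq: "p > 1" "q > 1" "1/p + 1/q = 1" and L: "L \<ge> 0" and m: "m \<ge> 0"
  shows "e2ennreal L * ennreal m \<le> ennreal (1/p) * ennreal (m powr p) + ennreal (1/q) * e2ennreal (ereal_powr L q)"
proof (cases L)
  case (real l)
  then have l: "l \<ge> 0" using L by simp
  have "e2ennreal L * ennreal m = ennreal (m * l)"
    using real l m by (simp add: ennreal_mult mult.commute)
  also have "\<dots> \<le> ennreal (m powr p / p + l powr q / q)"
    by (rule ennreal_leI[OF Youngs_inequality[OF pq m l]])
  also have "\<dots> = ennreal (1/p * m powr p) + ennreal (1/q * l powr q)" using pq by simp
  also have "\<dots> = ennreal (1/p) * ennreal (m powr p) + ennreal (1/q) * ennreal (l powr q)"
    using pq by (simp only: ennreal_mult powr_ge_zero divide_nonneg_nonneg)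
  finally show ?thesis using real by (simp add: ereal_powr_def)
next
  case PInf
  then have "ennreal (1/q) * e2ennreal (ereal_powr L q) = \<infinity>"
    using pq by (simp add: ereal_powr_def ennreal_mult_top)
  then show ?thesis by simp
qed (use L in simp)

text \<open>The energy inequality with \<open>h\<close> in place of the metric derivative suffices, since \<open>|w'| \<le> h\<close> almost
  everywhere. For the opposite inequality, the strong upper gradient property bounds the energy
  loss by the integral of slope times speed, and Young's inequality splits the product. Equality then exhibits \<open>\<phi> \<circ> w\<close> as a constant minus an indefinite
  integral, so it is in \<open>W\<^sup>1\<^sup>,\<^sup>1\<close>.\<close>

lemma curve_of_maximal_slope_if_energy_inequality:
  fixes w :: "real \<Rightarrow> 'a::metric_space" and h :: "real \<Rightarrow> real" and \<phi> :: "'a \<Rightarrow> ereal"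
  assumes pq: "p > 1" "q > 1" "1/p + 1/q = 1" and T: "T > 0"
    and ninf: "\<And>v. \<phi> v \<noteq> -\<infinity>" and B: "\<And>x. ereal B \<le> \<phi> x"
    and sug: "strong_upper_gradient p T \<phi> (local_slope \<phi>)"
    and h: "h \<in> borel_measurable borel" "\<And>x. 0 \<le> h x" "\<And>x y. set_integrable lborel {x..y} h"
    and w: "\<And>s t. s \<le> t \<Longrightarrow> dist (w s) (w t) \<le> (LBINT x:{s..t}. h x)"
    and dom: "\<And>t. t \<in> {0..T} \<Longrightarrow> w t \<in> edom \<phi>"
    and energy: "\<And>t. t \<in> {0..T} \<Longrightarrow> ennreal (real_of_ereal (\<phi> (w t)) - B)
       + ennreal (1/p) * (\<integral>\<^sup>+r\<in>{0..t}. ennreal (h r powr p) \<partial>lborel)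
       + ennreal (1/q) * (\<integral>\<^sup>+r\<in>{0..t}. e2ennreal (ereal_powr (local_slope \<phi> (w r)) q) \<partial>lborel)
       \<le> ennreal (real_of_ereal (\<phi> (w 0)) - B)"
  shows "curve_of_maximal_slope p q T \<phi> w"
proof -
  note hm[measurable] = h(1)
  define f where "f t = real_of_ereal (\<phi> (w t))" for t
  have f: "\<phi> (w t) = ereal (f t)" "B \<le> f t" if "t \<in> {0..T}" for t
    using dom[OF that] ninf[of "w t"] B[of "w t"] by (cases "\<phi> (w t)"; auto simp: f_def edom_def)+
  have T0: "T \<in> {0..T}" "0 \<in> {0..T}" using T by auto

  let ?H = "\<integral>\<^sup>+r\<in>{0..T}. ennreal (h r powr p) \<partial>lborel"
  have hT: "?H < \<infinity>"
  proof -
    have "ennreal (1/p) * ?H \<le> ennreal (f 0 - B)"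
      by (rule order.trans[OF _ energy[OF T0(1), folded f_def]]) (simp add: add_increasing add_increasing2)
    then have "ennreal (1/p) * ?H < \<infinity>"
      by (simp add: le_less_trans)
    then show ?thesis using pq by (auto simp: ennreal_mult_less_top)
  qed
  then obtain C where C: "?H = ennreal C" "C \<ge> 0"
    by (cases "?H") auto

  have AC: "w \<in> ACp p T"
    unfolding ACp_def
  proof (intro CollectI exI[of _ h] conjI allI impI)
    have "set_integrable lborel {0..T} (\<lambda>r. \<bar>h r\<bar> powr p)"
      unfolding set_integrable_def
    proof (rule integrableI_nonneg)
      have "(\<integral>\<^sup>+x. ennreal (indicator {0..T} x *\<^sub>R \<bar>h x\<bar> powr p) \<partial>lborel) = ?H"
        using h(2) by (intro nn_integral_cong) (auto simp: indicator_def)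
      then show "(\<integral>\<^sup>+x. ennreal (indicator {0..T} x *\<^sub>R \<bar>h x\<bar> powr p) \<partial>lborel) < \<infinity>" using hT by simp
    qed auto
    then have "set_integrable lborel {0<..<T} (\<lambda>r. \<bar>h r\<bar> powr p)"
      by (rule set_integrable_subset) auto
    then show "Lp_on p {0<..<T} h"
      unfolding Lp_on_def set_borel_measurable_def by simp
  qed (use w in auto)

  \<comment> \<open>The curve is frozen outside \<open>[0, T]\<close>, because the metric derivative was found for curves on the whole line.\<close>
  define cl where "cl t = max 0 (min T t)" for t
  have cl: "cl t \<in> {0..T}" for t using T by (auto simp: cl_def)
  define m where "m r = indicator {0..T} r * h r" for r
  have mm[measurable]: "m \<in> borel_measurable borel" unfolding m_def by measurable
  have m0: "0 \<le> m r" for r using h(2) by (simp add: m_def)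
  have mint: "integrable lborel m"
    using h(3)[of 0 T] by (simp add: set_integrable_def m_def[abs_def])
  have mp: "ennreal (m r powr p) = ennreal (h r powr p) * indicator {0..T} r" for r
    by (simp add: m_def indicator_def)
  have mC: "(\<integral>\<^sup>+r. ennreal (m r powr p) \<partial>lborel) \<le> ennreal C" by (simp add: mp C(1))
  have wcl: "dist (w (cl s)) (w (cl t)) \<le> (LBINT r:{s..t}. m r)" if "s \<le> t" for s t
  proof -
    have cls: "cl s \<le> cl t" using that by (auto simp: cl_def)
    show ?thesis
    proof (cases "s \<le> T \<and> 0 \<le> t")
      case True
      have "(LBINT r:{cl s..cl t}. h r) = (LBINT r:{s..t}. m r)"
        unfolding set_lebesgue_integral_def
        by (intro Bochner_Integration.integral_cong refl) (use True T in \<open>auto simp: m_def cl_def indicator_def\<close>)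
      then show ?thesis using w[OF cls] by simp
    next
      case False
      then have "cl s = cl t" using that T by (auto simp: cl_def)
      moreover have "0 \<le> (LBINT r:{s..t}. m r)" unfolding set_lebesgue_integral_def
        by (rule Bochner_Integration.integral_nonneg) (simp add: m0)
      ultimately show ?thesis by simp
    qed
  qed
  obtain \<mu> where \<mu>[measurable]: "\<mu> \<in> borel_measurable borel" and \<mu>0: "\<And>x. 0 \<le> \<mu> x" and \<mu>m: "\<And>x. \<mu> x \<le> m x"
    and \<mu>lim: "AE x in lborel. ((\<lambda>s. dist (w (cl s)) (w (cl x)) / \<bar>x - s\<bar>) \<longlongrightarrow> \<mu> x) (at x)"
    by (rule AE_metric_derivative_exists[OF pq(1) mint m0 mC C(2), of "\<lambda>t. w (cl t)"], rule wcl, assumption, blast)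
  have md: "AE x in lborel. x \<in> {0..T} \<longrightarrow> metric_derivative w x = \<mu> x"
    using \<mu>lim AE_lborel_singleton[of 0] AE_lborel_singleton[of T]
  proof eventually_elim
    case (elim x)
    show ?case
    proof
      assume "x \<in> {0..T}"
      then have x: "x \<in> {0<..<T}" using elim(2,3) by simp
      have "\<forall>\<^sub>F s in at x. s \<in> {0<..<T}"
        using x by (intro eventually_at_in_open') auto
      then have "\<forall>\<^sub>F s in at x. dist (w (cl s)) (w (cl x)) / \<bar>x - s\<bar> = dist (w s) (w x) / \<bar>x - s\<bar>"
        by eventually_elim (use x in \<open>auto simp: cl_def\<close>)
      with elim(1) have "((\<lambda>s. dist (w s) (w x) / \<bar>x - s\<bar>) \<longlongrightarrow> \<mu> x) (at x)"
        by (rule Lim_transform_eventually)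
      then show "metric_derivative w x = \<mu> x"
        unfolding metric_derivative_def by (intro tendsto_Lim) auto
    qed
  qed

  \<comment> \<open>The functions are cut off to \<open>[0, T]\<close> because measurability of the slope along \<open>w\<close> is known only there.\<close>
  define V where "V r = e2ennreal (ereal_powr (local_slope \<phi> (w r)) q) * indicator {0..T} r" for r
  have slm: "(\<lambda>r. local_slope \<phi> (w r)) \<in> borel_measurable (restrict_space borel {0..T})"
    using sug AC unfolding strong_upper_gradient_def by blast
  have Vm[measurable]: "V \<in> borel_measurable borel"
  proof -
    have "(\<lambda>r. e2ennreal (ereal_powr (local_slope \<phi> (w r)) q)) \<in> borel_measurable (restrict_space borel {0..T})"
      by (rule measurable_compose[OF slm]) measurable
    then show ?thesis unfolding V_def by (subst (asm) borel_measurable_restrict_space_iff_ennreal) auto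
  qed
  define W where "W r = ennreal (1/p) * (ennreal (\<mu> r powr p) * indicator {0..T} r) + ennreal (1/q) * V r" for r
  have Wm[measurable]: "W \<in> borel_measurable borel" unfolding W_def by measurable
  define A where "A t = (\<integral>\<^sup>+r\<in>{0..t}. ennreal (metric_derivative w r powr p) \<partial>lborel)" for t
  define S where "S t = (\<integral>\<^sup>+r\<in>{0..t}. e2ennreal (ereal_powr (local_slope \<phi> (w r)) q) \<partial>lborel)" for t
  define P where "P t = (\<integral>\<^sup>+r\<in>{..t}. W r \<partial>lborel)" for t
  have A: "A t = (\<integral>\<^sup>+r. ennreal (\<mu> r powr p) * indicator {0..T} r * indicator {..t} r \<partial>lborel)" if "t \<in> {0..T}" for t
    unfolding A_def
  proof (rule nn_integral_cong_AE)
    show "AE r in lborel. ennreal (metric_derivative w r powr p) * indicator {0..t} r = ennreal (\<mu> r powr p) * indicator {0..T} r * indicator {..t} r"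
      using md by eventually_elim (use that in \<open>auto simp: indicator_def\<close>)
  qed
  have S: "S t = (\<integral>\<^sup>+r. V r * indicator {..t} r \<partial>lborel)" if "t \<in> {0..T}" for t
    unfolding S_def V_def by (intro nn_integral_cong) (use that in \<open>auto simp: indicator_def\<close>)
  have P: "P t = ennreal (1/p) * A t + ennreal (1/q) * S t" if "t \<in> {0..T}" for t
  proof -
    have "P t = (\<integral>\<^sup>+r. ennreal (1/p) * (ennreal (\<mu> r powr p) * indicator {0..T} r * indicator {..t} r)
        + ennreal (1/q) * (V r * indicator {..t} r) \<partial>lborel)"
      unfolding P_def W_def by (intro nn_integral_cong) (simp add: distrib_right mult.assoc)
    also have "\<dots> = ennreal (1/p) * A t + ennreal (1/q) * S t"
      unfolding A[OF that] S[OF that] by (subst nn_integral_add) (simp_all add: nn_integral_cmult)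
    finally show ?thesis .
  qed
  have upper: "ennreal (f t - B) + P t \<le> ennreal (f 0 - B)" if t: "t \<in> {0..T}" for t
  proof -
    have "A t \<le> (\<integral>\<^sup>+r\<in>{0..t}. ennreal (h r powr p) \<partial>lborel)"
      unfolding A[OF t]
    proof (rule nn_integral_mono)
      fix r
      have "\<mu> r powr p \<le> m r powr p" using \<mu>0 \<mu>m pq by (intro powr_mono2) auto
      then have "ennreal (\<mu> r powr p) \<le> ennreal (m r powr p)" by (rule ennreal_leI)
      then show "ennreal (\<mu> r powr p) * indicator {0..T} r * indicator {..t} r \<le> ennreal (h r powr p) * indicator {0..t} r"
        using t by (auto simp: indicator_def m_def)
    qed
    then have "ennreal (f t - B) + (ennreal (1/p) * A t + ennreal (1/q) * S t) \<le> ennreal (f t - B)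
       + ennreal (1/p) * (\<integral>\<^sup>+r\<in>{0..t}. ennreal (h r powr p) \<partial>lborel) + ennreal (1/q) * S t"
      unfolding add.assoc by (intro add_mono mult_left_mono order_refl) auto
    also have "\<dots> \<le> ennreal (f 0 - B)" using energy[OF t] by (simp add: f_def S_def)
    finally show ?thesis by (simp add: P[OF t])
  qed
  have Pfin: "\<exists>\<pi>\<ge>0. P t = ennreal \<pi>" if "t \<in> {0..T}" for t
  proof -
    have "P t \<le> ennreal (f 0 - B)" by (rule order.trans[OF _ upper[OF that]]) (simp add: add_increasing)
    then have "P t \<noteq> top" by (auto simp: top_unique)
    then show ?thesis by (cases "P t") auto
  qed
  then obtain \<pi> where \<pi>: "\<And>t. t \<in> {0..T} \<Longrightarrow> 0 \<le> \<pi> t \<and> P t = ennreal (\<pi> t)" by metis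
  have lower: "f 0 - f t \<le> \<pi> t" if t: "t \<in> {0..T}" for t
  proof -
    have "\<bar>\<phi> (w t) - \<phi> (w 0)\<bar> \<le> enn2ereal (\<integral>\<^sup>+r\<in>{0..t}. e2ennreal (local_slope \<phi> (w r)) * ennreal (metric_derivative w r) \<partial>lborel)"
    proof -
      have "\<not> (\<phi> (w 0) = \<infinity> \<and> \<phi> (w t) = \<infinity>)" using f(1)[OF t] by simp
      then show ?thesis using sug AC t unfolding strong_upper_gradient_def by auto
    qed
    also have "(\<integral>\<^sup>+r\<in>{0..t}. e2ennreal (local_slope \<phi> (w r)) * ennreal (metric_derivative w r) \<partial>lborel) \<le> P t"
      unfolding P_def
    proof (rule nn_integral_mono_AE)
      show "AE r in lborel. e2ennreal (local_slope \<phi> (w r)) * ennreal (metric_derivative w r) * indicator {0..t} r \<le> W r * indicator {..t} r"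
        using md
      proof eventually_elim
        case (elim r)
        show ?case
        proof (cases "r \<in> {0..t}")
          case True
          then have "r \<in> {0..T}" using t by auto
          then show ?thesis using True elim slope_speed_Young[OF pq local_slope_nonneg[of \<phi> "w r"] \<mu>0[of r]]
            by (simp add: W_def V_def)
        qed simp
      qed
    qed
    finally have "\<bar>\<phi> (w t) - \<phi> (w 0)\<bar> \<le> enn2ereal (P t)" by (simp add: less_eq_ennreal.rep_eq)
    then have "\<bar>f t - f 0\<bar> \<le> \<pi> t" using \<pi>[OF t] by (simp add: f(1)[OF t] f(1)[OF T0(2)] enn2ereal_ennreal)
    then show ?thesis by simp
  qed
  have eq: "f t = f 0 - \<pi> t" if t: "t \<in> {0..T}" for t
  proof -
    have "ennreal (f t - B + \<pi> t) \<le> ennreal (f 0 - B)"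
      using upper[OF t] \<pi>[OF t] f(2)[OF t] by simp
    then have "f t - B + \<pi> t \<le> f 0 - B"
      using f(2)[OF T0(2)] by (subst (asm) ennreal_le_iff) auto
    then show ?thesis using lower[OF t] by simp
  qed

  have "W11 T f"
  proof (rule W11_indefinite_integral[OF T])
    have Wout: "W r * indicator {..T} r = W r" for r by (auto simp: W_def V_def indicator_def)
    have "(\<integral>\<^sup>+r. W r \<partial>lborel) = P T" unfolding P_def by (simp add: Wout)
    then have WT: "(\<integral>\<^sup>+r. W r \<partial>lborel) \<noteq> \<infinity>" using \<pi>[OF T0(1)] by simp
    then have WAE: "AE r in lborel. W r \<noteq> \<infinity>" by (intro nn_integral_PInf_AE) auto
    have WI: "(\<integral>\<^sup>+r. ennreal (indicator {..t} r * enn2real (W r)) \<partial>lborel) = P t" for t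
      unfolding P_def
    proof (rule nn_integral_cong_AE)
      show "AE r in lborel. ennreal (indicator {..t} r * enn2real (W r)) = W r * indicator {..t} r"
        using WAE by eventually_elim (auto simp: indicator_def less_top)
    qed
    show "integrable lborel (\<lambda>r. enn2real (W r))"
    proof (rule integrableI_nonneg)
      have "(\<integral>\<^sup>+r. ennreal (enn2real (W r)) \<partial>lborel) = (\<integral>\<^sup>+r. W r \<partial>lborel)"
        by (rule nn_integral_cong_AE) (use WAE in eventually_elim, auto simp: less_top)
      then show "(\<integral>\<^sup>+r. ennreal (enn2real (W r)) \<partial>lborel) < \<infinity>" using WT by (simp add: less_top)
    qed auto
    show "0 \<le> enn2real (W r)" for r by simp
    fix t assume "t \<in> {0<..<T}"
    then have t: "t \<in> {0..T}" by auto
    have "(LBINT r:{..t}. enn2real (W r)) = enn2real (P t)"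
      unfolding set_lebesgue_integral_def
      by (subst integral_eq_nn_integral) (auto simp: WI)
    also have "\<dots> = \<pi> t" using \<pi>[OF t] by simp
    finally show "f t = f 0 - (LBINT r:{..t}. enn2real (W r))" using eq[OF t] by simp
  qed
  moreover have "\<phi> (w t) + ereal (1 / p) * enn2ereal (A t) + ereal (1 / q) * enn2ereal (S t) = \<phi> (w 0)" if t: "t \<in> {0..T}" for t
  proof -
    have "ereal (1 / p) * enn2ereal (A t) + ereal (1 / q) * enn2ereal (S t) = enn2ereal (P t)"
      using pq by (simp add: P[OF t] plus_ennreal.rep_eq times_ennreal.rep_eq enn2ereal_ennreal)
    also have "\<dots> = ereal (\<pi> t)" using \<pi>[OF t] by (simp add: enn2ereal_ennreal)
    finally have "\<phi> (w t) + (ereal (1 / p) * enn2ereal (A t) + ereal (1 / q) * enn2ereal (S t)) = \<phi> (w 0)"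
      using eq[OF t] by (simp add: f(1)[OF t] f(1)[OF T0(2)])
    then show ?thesis by (simp add: add.assoc)
  qed
  ultimately show ?thesis
    unfolding curve_of_maximal_slope_def A_def S_def using AC dom by (simp add: f_def[abs_def])
qed

section \<open>Convergence of the scheme\<close>

theorem theorem3p2:
  fixes p q T \<tau>s lam :: real
    and \<sigma> :: "'a::complete_space topology"
    and \<phi> :: "'a \<Rightarrow> ereal"
    and u0 :: 'a
    and N :: "nat \<Rightarrow> nat"
    and t :: "nat \<Rightarrow> nat \<Rightarrow> real"
  assumes "p > 1" and "q > 1" and "1 / p + 1 / q = 1" and "T > 0"
    and "topspace \<sigma> = UNIV" and "Hausdorff_space \<sigma>" and "compatible_topology \<sigma>"
    and "\<And>v. \<phi> v \<noteq> - \<infinity>" and "edom \<phi> \<noteq> {}"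
    and "\<And>c::real. seq_compactin \<sigma> {v. \<phi> v \<le> ereal c}"
    and "strong_upper_gradient p T \<phi> (local_slope \<phi>)"
    and "\<And>(c::real) S. bounded S \<Longrightarrow> S \<subseteq> {v. \<phi> v \<le> ereal c} \<Longrightarrow> seq_lsc_on \<sigma> S (local_slope \<phi>)"
    and "u0 \<in> edom \<phi>"
    and "\<tau>s > 0"
    and "\<And>\<tau> v. 0 < \<tau> \<Longrightarrow> \<tau> < \<tau>s \<Longrightarrow> v \<in> edom \<phi> \<Longrightarrow>
           gen_geod_convex ((p - 1) * \<tau> powr (1 - p) + lam) p (incr_E p \<phi> \<tau> v)"
    and "lam \<ge> 0 \<or> p > 2"
    and "\<And>n. is_partition T (N n) (t n)"
    and "\<And>n. mesh (N n) (t n) < \<tau>s"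
    and "(\<lambda>n. mesh (N n) (t n)) \<longlonglongrightarrow> 0"
  shows "\<forall>u :: nat \<Rightarrow> nat \<Rightarrow> 'a. (\<forall>n. scheme_solution p q \<phi> u0 (N n) (t n) (u n)) \<longrightarrow>
      ((\<lambda>n. \<Sum>i=1..N n. max 0 (incr_G p q \<phi> (step (t n) i) (u n (i - 1)) (u n i)))
          \<longlonglongrightarrow> (0::ereal)) \<and>
      (\<exists>(r::nat \<Rightarrow> nat) (w :: real \<Rightarrow> 'a). strict_mono r \<and> curve_of_maximal_slope p q T \<phi> w \<and>
         (\<forall>s\<in>{0..T}. limitin \<sigma>
            (\<lambda>k. backward_interpolant (N (r k)) (t (r k)) (u (r k)) s) (w s) sequentially))"
proof (intro allI impI conjI)
  note pq = assms(1,2,3) and T = assms(4)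
  note X = assms(5,6,7) and ninf = assms(8) and cpt = assms(10) and sug = assms(11)
  note slsc = assms(12) and u0 = assms(13) and cvx = assms(15) and lam = assms(16)
  note part = assms(17) and mesh_less = assms(18) and mesh_lim = assms(19)
  fix u :: "nat \<Rightarrow> nat \<Rightarrow> 'a"
  assume sol: "\<forall>n. scheme_solution p q \<phi> u0 (N n) (t n) (u n)"
  obtain B where B: "\<And>v. ereal B \<le> \<phi> v"
    using sublevel_compact_imp_bounded_below[OF X(2) cpt ninf] by blast
  define f where "f v = real_of_ereal (\<phi> v)" for v
  have f: "\<phi> v = ereal (f v)" "B \<le> f v" if "v \<in> edom \<phi>" for v
    using that ninf[of v] B[of v] by (cases "\<phi> v"; auto simp: f_def edom_def)+
  define \<epsilon> where "\<epsilon> n = mesh (N n) (t n)" for n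
  have N0: "1 \<in> {1..N n}" for n
    using part[of n] T by (cases "N n") (auto simp: is_partition_def)
  have \<epsilon>0: "0 < \<epsilon> n" for n
    using step_pos[OF part N0] step_le_mesh[OF N0] unfolding \<epsilon>_def by (rule less_le_trans)
  have \<epsilon>lim: "\<epsilon> \<longlonglongrightarrow> 0" using mesh_lim by (simp add: \<epsilon>_def[abs_def])
  note est = scheme_estimates[OF pq T X cpt ninf B u0 cvx lam part mesh_less sol[rule_format], folded f_def]
  have ed: "u n i \<in> edom \<phi>" if "i \<le> N n" for n i by (rule est(1)[OF _ _ _ that])
  have sd: "u n i \<in> slope_dom \<phi>" if "i \<in> {1..N n}" for n i by (rule est(2)[OF _ _ _ that])
  define d where "d n i = dist (u n (i-1)) (u n i) / step (t n) i" for n i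
  define sl where "sl n i = real_of_ereal (local_slope \<phi> (u n i)) powr q" for n i
  define K where "K n = max 0 (- lam) * \<epsilon> n powr (p - 2) * T" for n
  let ?D = "\<lambda>n k. \<Sum>i=1..k. d n i powr p * step (t n) i" and ?S = "\<lambda>n k. \<Sum>i=1..k. sl n i * step (t n) i"
  obtain \<rho> where \<rho>0: "\<And>n. 0 \<le> \<rho> n"
    and \<rho>: "\<And>n. (\<Sum>i=1..N n. max 0 (incr_G p q \<phi> (step (t n) i) (u n (i - 1)) (u n i))) = ereal (\<rho> n)"
    and \<rho>K: "\<And>n. \<rho> n \<le> K n * ((f u0 - B) * exp (K n))"
    and en: "\<And>n k. k \<le> N n \<Longrightarrow> f (u n k) + (1/p) * ?D n k
         + (1/q) * ?S n k \<le> f u0 + \<rho> n"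
  proof -
    have "\<forall>n. \<exists>\<rho>\<ge>0. (\<Sum>i=1..N n. max 0 (incr_G p q \<phi> (step (t n) i) (u n (i - 1)) (u n i))) = ereal \<rho> \<and>
      \<rho> \<le> K n * ((f u0 - B) * exp (K n)) \<and>
      (\<forall>k\<le>N n. f (u n k) + (1/p) * ?D n k
         + (1/q) * ?S n k \<le> f u0 + \<rho>)"
      unfolding d_def sl_def K_def \<epsilon>_def by (intro allI est(3))
    from choice[OF this] show ?thesis using that by blast
  qed
  have "K \<longlonglongrightarrow> max 0 (- lam) * 0 * T"
  proof (cases "lam \<ge> 0")
    case True
    then show ?thesis by (simp add: K_def[abs_def])
  next
    case False
    then have "p > 2" using lam by simp
    then have "(\<lambda>n. \<epsilon> n powr (p - 2)) \<longlonglongrightarrow> 0 powr (p - 2)"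
      using \<epsilon>0 by (intro tendsto_powr2 \<epsilon>lim tendsto_const) (auto intro!: always_eventually less_imp_le)
    then show ?thesis unfolding K_def[abs_def] by (intro tendsto_intros) simp
  qed
  then have "K \<longlonglongrightarrow> 0" by simp
  then have "(\<lambda>n. K n * ((f u0 - B) * exp (K n))) \<longlonglongrightarrow> 0 * ((f u0 - B) * exp 0)"
    by (intro tendsto_intros)
  then have \<rho>lim: "\<rho> \<longlonglongrightarrow> 0"
    by (intro tendsto_sandwich[OF _ _ tendsto_const, of 0 \<rho>]) (auto intro!: always_eventually \<rho>0 \<rho>K)
  then have "(\<lambda>n. ereal (\<rho> n)) \<longlonglongrightarrow> 0" unfolding zero_ereal_def by (rule tendsto_ereal)
  then show "(\<lambda>n. \<Sum>i=1..N n. max 0 (incr_G p q \<phi> (step (t n) i) (u n (i - 1)) (u n i))) \<longlonglongrightarrow> (0::ereal)"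
    by (simp only: \<rho>)
  obtain R where R: "\<And>n. \<rho> n \<le> R"
  proof -
    have "bounded (range \<rho>)" using \<rho>lim by (intro convergent_imp_bounded)
    then show ?thesis using that by (auto simp: bounded_iff abs_le_iff)
  qed

  \<comment> \<open>Times outside \<open>[0, T]\<close> are projected onto the interval, so that the interpolants are curves on the whole line.\<close>
  define cl where "cl s = max 0 (min T s)" for s
  have cl: "0 \<le> cl s" "cl s \<le> T" for s using T by (auto simp: cl_def)
  define z where "z n s = backward_interpolant (N n) (t n) (u n) (cl s)" for n s
  define M where "M n = step_function (N n) (t n) (d n)" for n
  define Sl where "Sl n = step_function (N n) (t n) (sl n)" for n
  have d0: "0 \<le> d n i" if "i \<in> {1..N n}" for n i
    using step_pos[OF part that] by (simp add: d_def)
  have sl0: "0 \<le> sl n i" for n i by (simp add: sl_def)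
  have sum0: "0 \<le> ?D n k" "0 \<le> ?S n k"
    if "k \<le> N n" for n k
    using step_pos[OF part] that sl0 by (intro sum_nonneg mult_nonneg_nonneg; force intro: less_imp_le)+
  have idx: "\<exists>k\<le>N n. z n s = u n k \<and> cl s \<le> t n k \<and> t n k \<le> cl s + \<epsilon> n \<and> (k = 0 \<longrightarrow> cl s = 0) \<and> (k > 0 \<longrightarrow> t n (k - 1) < cl s)" for n s
    using partition_index[OF part cl T, of n s] unfolding z_def \<epsilon>_def by metis
  define S where "S = {v. \<phi> v \<le> ereal (f u0 + R)}"
  have fz: "f (u n k) \<le> f u0 + R" if "k \<le> N n" for n k
  proof -
    have "0 \<le> (1/p) * ?D n k" "0 \<le> (1/q) * ?S n k"
      using sum0[OF that] pq by (auto intro!: mult_nonneg_nonneg simp del: mult_nonneg_nonneg)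
    then show ?thesis using en[OF that] R[of n] by linarith
  qed
  have zed: "z n s \<in> edom \<phi>" for n s using idx[of n s] ed[of _ n] by metis
  have zS: "z n s \<in> S" for n s using idx[of n s] fz[of _ n] f(1)[OF ed, of _ n] by (auto simp: S_def)
  have Mint: "integrable lborel (M n)" for n unfolding M_def by (rule integrable_step_function)
  have Mnn: "0 \<le> M n x" for n x unfolding M_def by (intro step_function_nonneg d0)
  have M0: "M n x = 0" if "x \<le> 0" for n x
    unfolding M_def by (rule step_function_outside[OF part]) (use that in simp)
  have MT: "M n x = 0" if "T < x" for n x
    unfolding M_def by (rule step_function_outside[OF part]) (use that in simp)
  have Mp: "M n x powr p = step_function (N n) (t n) (\<lambda>i. d n i powr p) x" for n x
    unfolding M_def by (rule step_function_compose[OF part, of "\<lambda>y. y powr p"]) simp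
  have Mk: "(\<integral>\<^sup>+x. ennreal (M n x powr p) * indicator {..t n k} x \<partial>lborel) = ennreal (?D n k)"
    if "k \<le> N n" for n k
    unfolding Mp by (rule nn_integral_step_function[OF part that]) simp
  have Slk: "(\<integral>\<^sup>+x. ennreal (Sl n x) * indicator {..t n k} x \<partial>lborel) = ennreal (?S n k)"
    if "k \<le> N n" for n k
    unfolding Sl_def by (rule nn_integral_step_function[OF part that]) (rule sl0)
  define C where "C = p * (f u0 + R - B)"
  have fB: "B \<le> f u0" by (rule f(2)[OF u0])
  have R0: "0 \<le> R" using \<rho>0[of 0] R[of 0] by simp
  have C0: "0 \<le> C" using pq fB R0 by (simp add: C_def)
  have MC: "(\<integral>\<^sup>+x. ennreal (M n x powr p) \<partial>lborel) \<le> ennreal C" for n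
  proof -
    have tN: "t n (N n) = T" using part[of n] by (simp add: is_partition_def)
    have "(\<integral>\<^sup>+x. ennreal (M n x powr p) \<partial>lborel) = (\<integral>\<^sup>+x. ennreal (M n x powr p) * indicator {..t n (N n)} x \<partial>lborel)"
      by (intro nn_integral_cong) (auto simp: tN indicator_def MT)
    also have "\<dots> = ennreal (?D n (N n))" by (rule Mk) simp
    also have "\<dots> \<le> ennreal C"
    proof (rule ennreal_leI)
      have "0 \<le> (1/q) * ?S n (N n)"
        using sum0[of "N n" n] pq by simp
      then have "(1/p) * ?D n (N n) \<le> f u0 + R - B"
        using en[of "N n" n] R[of n] f(2)[OF ed, of "N n" n] by simp
      then have "p * ((1/p) * ?D n (N n)) \<le> C"
        unfolding C_def using pq by (intro mult_left_mono) auto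
      then show "?D n (N n) \<le> C" using pq by simp
    qed
    finally show ?thesis .
  qed
  have zM: "dist (z n s) (z n s') \<le> (LBINT x:{..s' + \<epsilon> n}. M n x) - (LBINT x:{..s}. M n x)" if "s \<le> s'" for n s s'
  proof -
    let ?F = "\<lambda>x. LBINT r:{..x}. M n r"
    have Fm: "?F x \<le> ?F y" if "x \<le> y" for x y by (rule cumulative_integral_mono[OF Mint Mnn that])
    have "dist (z n s) (z n s') \<le> ?F (s' + \<epsilon> n) - ?F s"
    proof (cases "cl s = cl s'")
      case True
      then show ?thesis using Fm[of s "s' + \<epsilon> n"] that \<epsilon>0[of n] by (simp add: z_def)
    next
      case False
      then have c: "cl s < cl s'" "0 < s'" "s < T" using that by (auto simp: cl_def split: if_splits)
      obtain i where i: "i \<le> N n" "z n s = u n i" "cl s \<le> t n i" "i > 0 \<longrightarrow> t n (i - 1) < cl s" using idx[of n s] by blast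
      obtain j where j: "j \<le> N n" "z n s' = u n j" "cl s' \<le> t n j" "t n j \<le> cl s' + \<epsilon> n" using idx[of n s'] by blast
      have ij: "i \<le> j"
      proof (rule ccontr)
        assume "\<not> i \<le> j"
        then have "t n j \<le> t n (i - 1)" using i(1) by (intro partition_le[OF part]) auto
        then show False using i(4) \<open>\<not> i \<le> j\<close> j(3) c(1) by simp
      qed
      have Fk: "?F (t n k) = (\<Sum>i=1..k. dist (u n (i-1)) (u n i))" if "k \<le> N n" for k
      proof -
        have "?F (t n k) = (\<Sum>i=1..k. d n i * step (t n) i)"
          unfolding M_def by (rule cumulative_step_function[OF part that])
        also have "\<dots> = (\<Sum>i=1..k. dist (u n (i-1)) (u n i))"
        proof (intro sum.cong refl)
          fix i assume "i \<in> {1..k}"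
          then have "0 < step (t n) i" using that by (intro step_pos[OF part]) auto
          then show "d n i * step (t n) i = dist (u n (i-1)) (u n i)" by (simp add: d_def)
        qed
        finally show ?thesis .
      qed
      \<comment> \<open>The interpolant sits at a node up to one step later, which is why the time lag \<open>\<epsilon> n\<close> appears.\<close>
      have "dist (u n i) (u n j) \<le> (\<Sum>k=1..j. dist (u n (k-1)) (u n k)) - (\<Sum>k=1..i. dist (u n (k-1)) (u n k))"
        using ij
      proof (induction j rule: dec_induct)
        case (step j)
        then show ?case using dist_triangle[of "u n i" "u n (Suc j)" "u n j"] by simp
      qed simp
      also have "\<dots> = ?F (t n j) - ?F (t n i)" by (simp only: Fk[OF i(1)] Fk[OF j(1)])
      also have "\<dots> \<le> ?F (s' + \<epsilon> n) - ?F s"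
      proof (rule diff_mono)
        have "cl s' \<le> s'" using c(2) by (simp add: cl_def)
        then show "?F (t n j) \<le> ?F (s' + \<epsilon> n)" using j(4) by (intro Fm) simp
        have "s \<le> cl s" using c(3) by (simp add: cl_def)
        then show "?F s \<le> ?F (t n i)" using i(3) by (intro Fm) simp
      qed
      finally show ?thesis by (simp add: i(2) j(2))
    qed
    then show ?thesis .
  qed

  have cptS: "seq_compactin \<sigma> S" unfolding S_def by (rule cpt)
  obtain r w h where r: "strict_mono (r :: nat \<Rightarrow> nat)"
    and w: "\<And>s. limitin \<sigma> (\<lambda>n. z (r n) s) (w s) sequentially"
    and h: "h \<in> borel_measurable borel" "\<And>x. 0 \<le> h x" "\<And>x y. set_integrable lborel {x..y} h"
    and wh: "\<And>s t. s \<le> t \<Longrightarrow> dist (w s) (w t) \<le> (LBINT x:{s..t}. h x)"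
    and hlsc: "\<And>\<tau>. (\<integral>\<^sup>+x. ennreal (h x powr p) * indicator {..\<tau>} x \<partial>lborel)
        \<le> liminf (\<lambda>n. \<integral>\<^sup>+x. ennreal (M (r n) x powr p) * indicator {..\<tau>} x \<partial>lborel)"
    using limit_curve_exists[OF pq X(2,3) cptS zS Mint Mnn M0 MC C0 zM less_imp_le[OF \<epsilon>0] \<epsilon>lim] by blast
  have hm[measurable]: "h \<in> borel_measurable borel" by (rule h(1))
  have wS: "w s \<in> S" for s by (rule limitin_seq_compactin[OF X(2) cptS zS w])
  have wed: "w s \<in> edom \<phi>" for s using wS[of s] by (auto simp: S_def edom_def)
  have z0: "z n s = u0" if "s \<le> 0" for n s
  proof -
    have "cl s = 0" using that T by (simp add: cl_def)
    then show ?thesis using sol by (simp add: z_def backward_interpolant_def scheme_solution_def)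
  qed
  have w0: "w 0 = u0"
  proof -
    have "limitin \<sigma> (\<lambda>n. u0) (w 0) sequentially" using w[of 0] by (simp add: z0)
    moreover have "limitin \<sigma> (\<lambda>n. u0) u0 sequentially" using X(1) by simp
    ultimately show ?thesis using limitin_Hausdorff_unique[OF _ _ _ X(2)] by (metis sequentially_bot)
  qed
  have rlim: "(\<lambda>n. \<rho> (r n)) \<longlonglongrightarrow> 0" using LIMSEQ_subseq_LIMSEQ[OF \<rho>lim r] by (simp add: o_def)

  have f_lsc: "ennreal (f (w s) - B) \<le> liminf (\<lambda>n. ennreal (f (z (r n) s) - B))" for s
  proof -
    have "\<phi> (w s) \<le> liminf (\<lambda>n. \<phi> (z (r n) s))"
      by (rule sublevel_compact_imp_seq_lsc[OF X(2) cpt w])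
    then have "ereal (f (w s)) \<le> liminf (\<lambda>n. ereal (f (z (r n) s)))" by (simp only: f(1)[OF wed] f(1)[OF zed])
    then have "ereal (f (w s) - B) \<le> liminf (\<lambda>n. ereal (f (z (r n) s) - B))" by (rule ereal_liminf_minus_const)
    from e2ennreal_powr_le_liminf[OF zero_less_one _ _ this]
    show ?thesis using f(2)[OF wed] f(2)[OF zed] by (simp add: ereal_powr_def)
  qed
  have slope_lsc: "e2ennreal (ereal_powr (local_slope \<phi> (w x)) q) \<le> liminf (\<lambda>n. ennreal (Sl (r n) x))"
    if x: "0 < x" "x \<le> T" for x
  proof -
    let ?s = "\<lambda>n. real_of_ereal (local_slope \<phi> (z (r n) x))"
    have cx: "cl x = x" using x by (simp add: cl_def)
    have k: "z (r n) x \<in> slope_dom \<phi> \<and> Sl (r n) x = ?s n powr q" for n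
    proof -
      obtain k where k: "k \<le> N (r n)" "z (r n) x = u (r n) k" "x \<le> t (r n) k" "k = 0 \<longrightarrow> x = 0" "k > 0 \<longrightarrow> t (r n) (k - 1) < x"
        using idx[of "r n" x] unfolding cx by blast
      then have k1: "k \<in> {1..N (r n)}" using x by (cases k) auto
      then have "Sl (r n) x = sl (r n) k"
        unfolding Sl_def using k by (intro step_function_eq[OF part]) auto
      then show ?thesis using sd[OF k1] by (simp add: sl_def k(2))
    qed
    have sfin: "local_slope \<phi> (z (r n) x) = ereal (?s n)" for n
      using k[of n] local_slope_nonneg[of \<phi> "z (r n) x"]
      by (cases "local_slope \<phi> (z (r n) x)") (auto simp: slope_dom_def)
    have s0: "0 \<le> ?s n" for n using local_slope_nonneg[of \<phi> "z (r n) x"] by (rule real_of_ereal_pos)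
    \<comment> \<open>The lower semicontinuity of the slope is available only along bounded sets in a sublevel; the diameter bound comes from the action bound with \<open>K = 1\<close>.\<close>
    define Q where "Q = insert (w x) (range (\<lambda>n. z (r n) x))"
    have "dist u0 (z n x) \<le> C * 1 powr (1 - p) + 1 * (x + \<tau>s - 0)" for n
    proof -
      have "dist u0 (z n x) \<le> (LBINT y:{..x + \<epsilon> n}. M n y) - (LBINT y:{..0}. M n y)"
        using zM[of 0 x n] x z0[of 0 n] by simp
      also have "\<dots> \<le> C * 1 powr (1 - p) + 1 * (x + \<epsilon> n - 0)"
        using x \<epsilon>0[of n] by (intro increment_le_of_powr_bound[OF pq(1) Mint Mnn MC C0]) auto
      also have "\<dots> \<le> C * 1 powr (1 - p) + 1 * (x + \<tau>s - 0)"
        using mesh_less[of n] by (simp add: \<epsilon>_def)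
      finally show ?thesis .
    qed
    then have "bounded (range (\<lambda>n. z (r n) x))"
      unfolding bounded_def by (intro exI[of _ u0] exI[of _ "C * 1 powr (1 - p) + 1 * (x + \<tau>s - 0)"]) auto
    then have "bounded Q" unfolding Q_def by (simp add: bounded_insert)
    moreover have "Q \<subseteq> {v. \<phi> v \<le> ereal (f u0 + R)}"
      using wS zS by (auto simp: Q_def S_def)
    ultimately have "seq_lsc_on \<sigma> Q (local_slope \<phi>)" by (rule slsc)
    then have "local_slope \<phi> (w x) \<le> liminf (\<lambda>n. local_slope \<phi> (z (r n) x))"
      unfolding seq_lsc_on_def using w[of x] by (auto simp: Q_def)
    also have "(\<lambda>n. local_slope \<phi> (z (r n) x)) = (\<lambda>n. ereal (?s n))" by (rule ext) (rule sfin)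
    finally have "local_slope \<phi> (w x) \<le> liminf (\<lambda>n. ereal (?s n))" .
    from e2ennreal_powr_le_liminf[OF _ local_slope_nonneg s0 this, of q]
    show ?thesis using pq k by simp
  qed
  have energy: "ennreal (f (w s) - B)
       + ennreal (1/p) * (\<integral>\<^sup>+r\<in>{0..s}. ennreal (h r powr p) \<partial>lborel)
       + ennreal (1/q) * (\<integral>\<^sup>+r\<in>{0..s}. e2ennreal (ereal_powr (local_slope \<phi> (w r)) q) \<partial>lborel)
       \<le> ennreal (f (w 0) - B)" if s: "s \<in> {0..T}" for s
  proof -
    let ?H = "\<integral>\<^sup>+r\<in>{0..s}. ennreal (h r powr p) \<partial>lborel"
    let ?V = "\<integral>\<^sup>+r\<in>{0..s}. e2ennreal (ereal_powr (local_slope \<phi> (w r)) q) \<partial>lborel"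
    let ?a = "\<lambda>n. ennreal (f (z (r n) s) - B)"
    let ?b = "\<lambda>n. \<integral>\<^sup>+x. ennreal (M (r n) x powr p) * indicator {..s} x \<partial>lborel"
    let ?c = "\<lambda>n. \<integral>\<^sup>+x. ennreal (Sl (r n) x) * indicator {..s} x \<partial>lborel"
    have b: "?H \<le> liminf ?b"
      by (rule order.trans[OF nn_integral_mono hlsc]) (auto simp: indicator_def)
    have c: "?V \<le> liminf ?c"
    proof -
      have "?V
         \<le> (\<integral>\<^sup>+x. liminf (\<lambda>n. ennreal (Sl (r n) x) * indicator {..s} x) \<partial>lborel)"
      proof (rule nn_integral_mono_AE)
        show "AE x in lborel. e2ennreal (ereal_powr (local_slope \<phi> (w x)) q) * indicator {0..s} x
            \<le> liminf (\<lambda>n. ennreal (Sl (r n) x) * indicator {..s} x)"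
          using AE_lborel_singleton[of 0]
        proof eventually_elim
          case (elim x)
          show ?case
          proof (cases "x \<in> {0..s}")
            case True
            then show ?thesis using slope_lsc[of x] elim s by simp
          qed simp
        qed
      qed
      also have "\<dots> \<le> liminf ?c"
        by (rule nn_integral_liminf) (simp add: Sl_def)
      finally show ?thesis .
    qed
    have step: "?a n + ennreal (1/p) * ?b n + ennreal (1/q) * ?c n \<le> ennreal (f u0 - B + \<rho> (r n))" for n
    proof -
      obtain k where k: "k \<le> N (r n)" "z (r n) s = u (r n) k" "s \<le> t (r n) k"
        using idx[of "r n" s] s by (auto simp: cl_def)
      let ?Sb = "\<Sum>i=1..k. d (r n) i powr p * step (t (r n)) i"
      let ?Sc = "\<Sum>i=1..k. sl (r n) i * step (t (r n)) i"
      have "?b n \<le> ennreal ?Sb" unfolding Mk[OF k(1), symmetric]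
        using k(3) by (intro nn_integral_mono) (auto simp: indicator_def)
      moreover have "?c n \<le> ennreal ?Sc" unfolding Slk[OF k(1), symmetric]
        using k(3) by (intro nn_integral_mono) (auto simp: indicator_def)
      ultimately have "?a n + ennreal (1/p) * ?b n + ennreal (1/q) * ?c n
          \<le> ennreal (f (u (r n) k) - B) + ennreal (1/p) * ennreal ?Sb + ennreal (1/q) * ennreal ?Sc"
        unfolding k(2) by (intro add_mono mult_left_mono order_refl) auto
      also have "\<dots> = ennreal ((f (u (r n) k) - B) + (1/p) * ?Sb + (1/q) * ?Sc)"
      proof -
        have pos: "0 \<le> f (u (r n) k) - B" "0 \<le> 1/p" "0 \<le> 1/q" "0 \<le> (1/p) * ?Sb" "0 \<le> (1/q) * ?Sc"
          using f(2)[OF ed[OF k(1)]] sum0[OF k(1)] pq by auto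
        show ?thesis
          by (simp only: ennreal_plus[OF pos(1,4)] ennreal_plus[OF add_nonneg_nonneg[OF pos(1,4)] pos(5)]
              ennreal_mult[OF pos(2) sum0(1)[OF k(1)]] ennreal_mult[OF pos(3) sum0(2)[OF k(1)]])
      qed
      also have "\<dots> \<le> ennreal (f u0 - B + \<rho> (r n))"
        using en[OF k(1)] by (intro ennreal_leI) linarith
      finally show ?thesis .
    qed
    have "ennreal (f (w s) - B) + ennreal (1/p) * ?H
       + ennreal (1/q) * ?V
       \<le> liminf ?a + ennreal (1/p) * liminf ?b + ennreal (1/q) * liminf ?c"
      by (intro add_mono mult_left_mono f_lsc b c) auto
    also have "\<dots> \<le> liminf ?a + liminf (\<lambda>n. ennreal (1/p) * ?b n) + liminf (\<lambda>n. ennreal (1/q) * ?c n)"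
      by (intro add_mono cmult_liminf_le order_refl) auto
    also have "\<dots> \<le> liminf (\<lambda>n. ?a n + ennreal (1/p) * ?b n) + liminf (\<lambda>n. ennreal (1/q) * ?c n)"
      by (intro add_mono liminf_add_le_ennreal order_refl)
    also have "\<dots> \<le> liminf (\<lambda>n. ?a n + ennreal (1/p) * ?b n + ennreal (1/q) * ?c n)"
      by (rule liminf_add_le_ennreal)
    also have "\<dots> \<le> liminf (\<lambda>n. ennreal (f u0 - B + \<rho> (r n)))"
      by (intro Liminf_mono always_eventually allI step)
    also have "\<dots> = ennreal (f u0 - B + 0)"
      by (intro lim_imp_Liminf tendsto_ennrealI tendsto_intros rlim) simp
    finally show ?thesis by (simp add: w0)
  qed
  have "curve_of_maximal_slope p q T \<phi> w"
    by (rule curve_of_maximal_slope_if_energy_inequality[OF pq T ninf B sug h wh wed energy[unfolded f_def]])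
  moreover have "limitin \<sigma> (\<lambda>k. backward_interpolant (N (r k)) (t (r k)) (u (r k)) s) (w s) sequentially" if "s \<in> {0..T}" for s
  proof -
    have "cl s = s" using that by (simp add: cl_def)
    then show ?thesis using w[of s] by (simp add: z_def)
  qed
  ultimately show "\<exists>(r::nat \<Rightarrow> nat) (w :: real \<Rightarrow> 'a). strict_mono r \<and> curve_of_maximal_slope p q T \<phi> w \<and>
         (\<forall>s\<in>{0..T}. limitin \<sigma>
            (\<lambda>k. backward_interpolant (N (r k)) (t (r k)) (u (r k)) s) (w s) sequentially)"
    using r by blast
qed

end
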